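(* Let $X$ be either a complete connected Riemannian manifold with Riemannian volume measure $v$, or a lattice $l\mathbb{Z}^d\subset\mathbb{R}^d$ ($l>0$) with $v$ equal to $l^d$ times counting measure. Let $\Lambda\subseteq X$ be a measurable region with $|\Lambda|:=v(\Lambda)<\infty$. Let $u\colon X\times X\to\mathbb{R}$ be a symmetric conditionally positive definite kernel, i.e. for all $n\ge 2$, $x_1,\dots,x_n\in X$ and $c_1,\dots,c_n\in\mathbb{R}$ with $\sum_j c_j=0$ one has $\sum_{j,k=1}^n c_jc_k u(x_j,x_k)\ge 0$ (all functions are assumed measurable so that the integrals below are defined). Let $\beta>0$, $e>0$, $u_0\in\mathbb{R}$, and consider $s$ species $\alpha=1,\dots,s$ with activities $z_\alpha>0$ and charges $e_\alpha\in e\mathbb{Z}$; write $q_\alpha=e_\alpha/e\in\mathbb{Z}$. Assume charge symmetry: there is $c\in\mathbb{R}$ such that $\sum_{\alpha=1}^s e_\alpha^{2n+1}\mathrm{e}^{e_\alpha c}z_\alpha=0$ for all $n\in\{0,1,2,\dots\}$; fix such $c$ and set $z'_\alpha=\mathrm{e}^{e_\alpha c}z_\alpha$. Let $A_n=\{(\alpha_1,\dots,\alpha_n)\in\{1,\dots,s\}^n:\sum_j e_{\alpha_j}=0\}$ and $U_{\alpha_1,\dots,\alpha_n}(x_1,\dots,x_n)=\tfrac12\sum_{j,k=1}^n e_{\alpha_j}e_{\alpha_k}u(x_j,x_k)$. Define the neutral grand canonical partition function $$\Xi=\sum_{n=0}^\infty\frac1{n!}\sum_{(\alpha_1,\dots,\alpha_n)\in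 A_n}\int_{\Lambda^n}\mathrm{e}^{-\beta U_{\alpha_1,\dots,\alpha_n}(x_1,\dots,x_n)}\prod_{j=1}^n \mathrm{e}^{\frac12\beta e_{\alpha_j}^2u_0}z_{\alpha_j}\,v(\mathrm{d}x_j)$$ and the ideal-gas partition function $\Xi_0=\sum_{n=0}^\infty\frac1{n!}\sum_{(\alpha_1,\dots,\alpha_n)\in A_n}\prod_{j=1}^n z_{\alpha_j}|\Lambda|$ (the $n=0$ terms are $1$). For $q\in\mathbb{Z}$ let $$\hat\eta_q=\frac{\int_0^{2\pi}\exp\big[|\Lambda|\sum_{\alpha}z'_\alpha\cos(q_\alpha\theta)\big]\mathrm{e}^{\mathrm{i}q\theta}\,\mathrm{d}\theta}{\int_0^{2\pi}\exp\big[|\Lambda|\sum_{\alpha}z'_\alpha\cos(q_\alpha\theta)\big]\,\mathrm{d}\theta},\qquad \xi_0^{-2}=\beta\sum_{\alpha=1}^s e_\alpha^2z'_\alpha\hat\eta_{q_\alpha}.$$ Fix a basepoint $x_0\in X$ and let $\gamma$ be the centered Gaussian measure on the space of real functions on $X$ modulo constants whose covariance is $C$, i.e. under $\gamma$ the (well-defined) variables $\phi(x)-\phi(x_0)$ form a centered Gaussian process with $\mathbb{E}[(\phi(x)-\phi(x_0))(\phi(y)-\phi(x_0))]=u(x,y)-u(x,x_0)-u(x_0,y)+u(x_0,x_0)$. Set $$V_2(\phi)=\tfrac12\xi_0^{-2}\int_\Lambda(\phi(x)-\phi(x_0))^2\,v(\mathrm{d}x)-\tfrac12\xi_0^{-2}u_0|\Lambda|.$$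 Then $$\Xi\ \ge\ \Xi_0\int \mathrm{e}^{-V_2(\phi)}\,\gamma(\mathrm{d}\phi).$$
   Context: The Gaussian measure $\gamma$ lives on $\mathbb{R}^X/\Theta$, where $\mathbb{R}^X$ carries the product topology and $\Theta$ is the subspace of constant functions; its covariance $C$ is the positive semidefinite form on neutral finite charge distributions $\rho=\sum_j c_j\delta_{x_j}$ ($\sum_j c_j=0$) given by $C(\rho,\sigma)=\sum_{j,k}c_jd_ku(x_j,y_k)$ for $\sigma=\sum_k d_k\delta_{y_k}$, so that $\int \mathrm{e}^{\mathrm{i}\sum_j c_j\phi(x_j)}\gamma(\mathrm{d}\phi)=\exp[-\tfrac12C(\rho,\rho)]$. The quantity $\xi_0$ is the (volume-dependent) mean-field correlation length; $\hat\eta_q$ are the Fourier coefficients of the probability measure on $\mathbb{R}/2\pi\mathbb{Z}$ with density proportional to $\exp[|\Lambda|\sum_\alpha z'_\alpha\cos(q_\alpha\theta)]$. *)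

theory Defs
  imports "HOL-Probability.Probability"
begin

definition neutral_configs :: "(nat \<Rightarrow> real) \<Rightarrow> nat \<Rightarrow> nat \<Rightarrow> (nat \<Rightarrow> nat) set" where
  "neutral_configs ech s n = {\<alpha> \<in> {..<n} \<rightarrow>\<^sub>E {1..s}. (\<Sum>j<n. ech (\<alpha> j)) = 0}"

definition Uen :: "(nat \<Rightarrow> real) \<Rightarrow> ('x \<Rightarrow> 'x \<Rightarrow> real) \<Rightarrow> nat \<Rightarrow> (nat \<Rightarrow> nat) \<Rightarrow> (nat \<Rightarrow> 'x) \<Rightarrow> real" where
  "Uen ech u n \<alpha> x = 1/2 * (\<Sum>j<n. \<Sum>k<n. ech (\<alpha> j) * ech (\<alpha> k) * u (x j) (x k))"

definition Xi :: "'x measure \<Rightarrow> 'x set \<Rightarrow> (nat \<Rightarrow> real) \<Rightarrow> nat \<Rightarrow> (nat \<Rightarrow> real)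
    \<Rightarrow> ('x \<Rightarrow> 'x \<Rightarrow> real) \<Rightarrow> real \<Rightarrow> real \<Rightarrow> ennreal" where
  "Xi v \<Lambda> ech s z u \<beta> u0 =
    (\<Sum>n. ennreal (1 / fact n) *
      (\<Sum>\<alpha>\<in>neutral_configs ech s n.
         \<integral>\<^sup>+ x. (\<Prod>j<n. indicator \<Lambda> (x j)) *
             ennreal (exp (- \<beta> * Uen ech u n \<alpha> x) *
                      (\<Prod>j<n. exp (\<beta> * (ech (\<alpha> j))\<^sup>2 * u0 / 2) * z (\<alpha> j)))
         \<partial>(PiM {..<n} (\<lambda>_. v))))"

definition Xi0 :: "real \<Rightarrow> (nat \<Rightarrow> real) \<Rightarrow> nat \<Rightarrow> (nat \<Rightarrow> real) \<Rightarrow> ennreal" where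
  "Xi0 L ech s z =
    (\<Sum>n. ennreal (1 / fact n) *
      (\<Sum>\<alpha>\<in>neutral_configs ech s n. ennreal (\<Prod>j<n. z (\<alpha> j) * L)))"

definition weight :: "real \<Rightarrow> (nat \<Rightarrow> real) \<Rightarrow> (nat \<Rightarrow> int) \<Rightarrow> nat \<Rightarrow> real \<Rightarrow> real" where
  "weight L zp q s \<theta> = exp (L * (\<Sum>\<alpha>=1..s. zp \<alpha> * cos (of_int (q \<alpha>) * \<theta>)))"

definition eta_hat :: "real \<Rightarrow> (nat \<Rightarrow> real) \<Rightarrow> (nat \<Rightarrow> int) \<Rightarrow> nat \<Rightarrow> int \<Rightarrow> complex" where
  "eta_hat L zp q s qq =
     (LINT \<theta>:{0..2*pi}|lborel. complex_of_real (weight L zp q s \<theta>) * cis (of_int qq * \<theta>))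
     / complex_of_real (LINT \<theta>:{0..2*pi}|lborel. weight L zp q s \<theta>)"

text \<open>xi_0^{-2}; the complex sum is real (eta_hat is real by symmetry), we take Re.\<close>
definition xi0_inv2 :: "real \<Rightarrow> (nat \<Rightarrow> real) \<Rightarrow> (nat \<Rightarrow> real) \<Rightarrow> (nat \<Rightarrow> int) \<Rightarrow> real \<Rightarrow> nat \<Rightarrow> real" where
  "xi0_inv2 \<beta> ech zp q L s =
     Re (complex_of_real \<beta> *
         (\<Sum>\<alpha>=1..s. complex_of_real ((ech \<alpha>)\<^sup>2 * zp \<alpha>) * eta_hat L zp q s (q \<alpha>)))"

text \<open>exp(-V2) where V2 = xi/2 * I - xi/2 * u0 * L, I = int_Lambda (phi x - phi x0)^2 in [0,\<infinity>],
  with the extended-real conventions 0 * \<infinity> = 0, exp(-\<infinity>) = 0, exp(\<infinity>) = \<infinity>.\<close>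
definition exp_neg_V2 :: "real \<Rightarrow> real \<Rightarrow> real \<Rightarrow> ennreal \<Rightarrow> ennreal" where
  "exp_neg_V2 \<xi> u0 L I =
     (if \<xi> = 0 then 1
      else if I = \<infinity> then (if \<xi> > 0 then 0 else \<infinity>)
      else ennreal (exp (- (\<xi> / 2 * enn2real I - \<xi> / 2 * u0 * L))))"

end

theory Submission
  imports Defs
begin

text \<open>
  The sine-Gordon transformation writes \<open>\<Xi>\<close> as the mean of \<open>exp W\<close> over the Gaussian field \<open>\<phi>\<close> and an
  independent uniform angle \<open>\<theta>\<close>, whose Fourier modes enforce neutrality; the ideal gas \<open>\<Xi>\<^sub>0\<close> is the
  mean of \<open>exp W\<^sub>0\<close>, with \<open>W\<^sub>0\<close> depending on \<open>\<theta>\<close> only. From \<open>exp y \<ge> 1 + y\<close> one gets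
  \<open>exp W \<ge> exp (W\<^sub>0 - V\<^sub>2) (1 + W - W\<^sub>0 + V\<^sub>2)\<close>, so it suffices that \<open>W - W\<^sub>0 + V\<^sub>2\<close> has nonnegative mean
  under the weight \<open>exp (W\<^sub>0 - V\<^sub>2)\<close>. Under that weight the field is Gaussian with some variance
  \<open>k(x)\<close>, and by the choice of \<open>\<xi>\<^sub>0\<close> the mean is a combination, with coefficients \<open>z'\<^sub>\<alpha>\<close> times the Fourier
  coefficients of \<open>exp W\<^sub>0\<close>, of integrals of \<open>exp t - 1 - t \<ge> 0\<close> where \<open>t = \<beta> e\<^sub>\<alpha>\<^sup>2 (u\<^sub>0 - k(x)) / 2\<close>.
  The Fourier coefficients are nonnegative because products of cosines have nonnegative ones.
\<close>

section \<open>Gaussian fields under quadratic weights\<close>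

text \<open>Obstacle: the variance \<open>k(x)\<close> under the weight would have to come from a
  resolvent of the covariance operator on the region, while the field is known only through
  characteristic functions of finitely many values and the integral of its square may be infinite.
  So the weight is replaced by finite products of \<open>exp (- \<nu> \<phi>(x)\<^sup>2)\<close>,
  under which the covariance changes by explicit rank-one terms. Averages of such products recover
  the weight: the exponential of minus the integral of
  \<open>r (1 - exp (- \<nu> \<phi>\<^sup>2))\<close> is the Laplace functional of a Poisson
  process, a series with nonnegative coefficients in powers of the integral of
  \<open>exp (- \<nu> \<phi>\<^sup>2)\<close>, and \<open>r = 2 ^ n\<close>,
  \<open>\<nu> = \<mu> / 2 ^ n\<close> with growing \<open>n\<close> turns it into
  \<open>exp_neg\<close>. The constant of \<open>V\<^sub>2\<close> is exactly the one that
  distributes its quadratic term over the species in proportion to \<open>z'\<^sub>\<alpha>\<close>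
  times the Fourier coefficient times \<open>e\<^sub>\<alpha>\<^sup>2\<close>, so that the mean
  splits into one integral per species and point. Nonnegative Fourier coefficients serve twice: they
  sign these integrals and they make the quadratic term of \<open>V\<^sub>2\<close> nonnegative,
  hence the weight bounded.\<close>

lemma measurable_cis [measurable]: "cis \<in> borel_measurable borel"
  by (intro borel_measurable_continuous_onI continuous_intros)

text \<open>Completing the square gives a normal density of mean \<open>- b / (1 + c)\<close> and
  variance \<open>1 / (1 + c)\<close>. This is the integral over the auxiliary normal variable: the
  root becomes the loss of mass of the weight, the exponential the change of covariance.\<close>

lemma integral_std_normal_exp_quadratic:
  fixes b c :: real
  assumes c: "0 \<le> c"
  shows "(\<integral>x. exp (- (b * x + c * x\<^sup>2 / 2)) \<partial>std_normal_distribution)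
          = exp (b\<^sup>2 / (2 * (1 + c))) / sqrt (1 + c)"
proof -
  let ?A = "exp (b\<^sup>2 / (2 * (1 + c))) / sqrt (1 + c)"
  have pos: "1 + c > 0" using c by simp
  have eq: "std_normal_density x * exp (- (b * x + c * x\<^sup>2 / 2))
          = ?A * normal_density (- b / (1 + c)) (1 / sqrt (1 + c)) x" for x
  proof -
    have sq: "(1 / sqrt (1 + c))\<^sup>2 = 1 / (1 + c)" using pos by (simp add: power_divide)
    have "- (x - - b / (1 + c))\<^sup>2 / (2 * (1 / (1 + c))) + b\<^sup>2 / (2 * (1 + c))
            = - x\<^sup>2 / 2 - (b * x + c * x\<^sup>2 / 2)"
      using pos by (simp add: divide_simps power2_eq_square) algebra
    then have e: "exp (- x\<^sup>2 / 2) * exp (- (b * x + c * x\<^sup>2 / 2))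
        = exp (b\<^sup>2 / (2 * (1 + c))) * exp (- (x - - b / (1 + c))\<^sup>2 / (2 * (1 / (1 + c))))"
      by (simp flip: exp_add add: add.commute)
    have s: "1 / sqrt (2 * pi) = 1 / sqrt (1 + c) * (1 / sqrt (2 * pi * (1 / (1 + c))))"
      using pos by (simp add: real_sqrt_mult real_sqrt_divide)
    have "std_normal_density x * exp (- (b * x + c * x\<^sup>2 / 2))
        = 1 / sqrt (2 * pi) * (exp (- x\<^sup>2 / 2) * exp (- (b * x + c * x\<^sup>2 / 2)))"
      by (simp add: std_normal_density_def)
    also have "\<dots> = ?A * normal_density (- b / (1 + c)) (1 / sqrt (1 + c)) x"
      unfolding e normal_density_def sq by (subst s) simp
    finally show ?thesis .
  qed
  have "(\<integral>x. exp (- (b * x + c * x\<^sup>2 / 2)) \<partial>std_normal_distribution)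
      = (\<integral>x. std_normal_density x * exp (- (b * x + c * x\<^sup>2 / 2)) \<partial>lborel)"
    by (subst integral_density) (auto simp: normal_density_nonneg)
  also have "\<dots> = (\<integral>x. ?A * normal_density (- b / (1 + c)) (1 / sqrt (1 + c)) x \<partial>lborel)"
    by (simp only: eq)
  also have "\<dots> = ?A" using pos by simp
  finally show ?thesis .
qed

lemma integral_std_normal_cis:
  "(\<integral>x. cis (t * x) \<partial>std_normal_distribution) = complex_of_real (exp (- (t\<^sup>2) / 2))"
  using fun_cong[OF char_std_normal_distribution, of t]
  by (simp add: char_def cis_conv_exp)

text \<open>For nonnegative \<open>w\<close>: the measure with density \<open>w\<close> has mass
  \<open>Z\<close> (take \<open>n = 0\<close>), and after division by \<open>Z\<close> the field on
  \<open>S\<close> is centered Gaussian with covariance \<open>K\<close>. Only the symmetric part of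
  \<open>K\<close> enters; its nonnegativity on the diagonal is recovered as a lemma.\<close>

definition gaussian_weight ::
    "'w measure \<Rightarrow> 'x set \<Rightarrow> ('w \<Rightarrow> 'x \<Rightarrow> real) \<Rightarrow> ('w \<Rightarrow> real) \<Rightarrow> real \<Rightarrow> ('x \<Rightarrow> 'x \<Rightarrow> real) \<Rightarrow> bool"
  where "gaussian_weight M S \<phi> w Z K \<longleftrightarrow> Z > 0 \<and>
    (\<forall>n (x::nat \<Rightarrow> 'x) (c::nat \<Rightarrow> real). (\<forall>j<n. x j \<in> S) \<longrightarrow>
       (LINT \<omega>|M. complex_of_real (w \<omega>) * cis (\<Sum>j<n. c j * \<phi> \<omega> (x j)))
         = complex_of_real (Z * exp (- (1/2) * (\<Sum>j<n. \<Sum>k<n. c j * c k * K (x j) (x k)))))"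

lemma gaussian_weightD:
  fixes n :: nat
  assumes "gaussian_weight M S \<phi> w Z K" "\<And>j. j < n \<Longrightarrow> x j \<in> S"
  shows "(LINT \<omega>|M. complex_of_real (w \<omega>) * cis (\<Sum>j<n. c j * \<phi> \<omega> (x j)))
         = complex_of_real (Z * exp (- (1/2) * (\<Sum>j<n. \<Sum>k<n. c j * c k * K (x j) (x k))))"
  by (rule assms(1)[unfolded gaussian_weight_def, THEN conjunct2, rule_format, OF assms(2)])

lemma gaussian_weight_one_point:
  assumes "gaussian_weight M S \<phi> w Z K" "y \<in> S"
  shows "(LINT \<omega>|M. complex_of_real (w \<omega>) * cis (t * \<phi> \<omega> y))
         = complex_of_real (Z * exp (- (t\<^sup>2 * K y y / 2)))"
  using gaussian_weightD[OF assms(1), of "Suc 0" "\<lambda>_. y" "\<lambda>_. t"] assms(2)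
  by (simp add: power2_eq_square lessThan_Suc)

text \<open>A characteristic function is largest in modulus at 0, so
  \<open>Z * exp (- (K y y / 2)) \<le> Z\<close>.\<close>

lemma (in finite_measure) gaussian_weight_variance_nonneg:
  assumes g: "gaussian_weight M S \<phi> w Z K" and y: "y \<in> S"
    and w: "\<And>\<omega>. 0 \<le> w \<omega>"
  shows "0 \<le> K y y"
proof -
  have Z: "Z > 0" using g by (simp add: gaussian_weight_def)
  have "(LINT \<omega>|M. complex_of_real (w \<omega>)) = complex_of_real Z"
    using gaussian_weight_one_point[OF g y, of 0] by simp
  then have Zw: "(LINT \<omega>|M. w \<omega>) = Z" by (metis integral_complex_of_real of_real_eq_iff)
  have "norm (LINT \<omega>|M. complex_of_real (w \<omega>) * cis (1 * \<phi> \<omega> y)) \<le> (LINT \<omega>|M. norm (complex_of_real (w \<omega>) * cis (1 * \<phi> \<omega> y)))"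
    by (rule integral_norm_bound)
  also have "\<dots> = Z" using w Zw by (simp add: norm_mult)
  finally have "Z * exp (- (K y y / 2)) \<le> Z"
    unfolding gaussian_weight_one_point[OF g y] using Z by (simp add: norm_mult)
  then show ?thesis using Z by simp
qed

text \<open>Linearising \<open>exp (- \<mu> t\<^sup>2)\<close> as the characteristic function of an auxiliary normal
  variable (Hubbard--Stratonovich) keeps the weighted field Gaussian.\<close>

lemma (in finite_measure) gaussian_weight_step:
  assumes g: "gaussian_weight M S \<phi> w Z K" and y: "y \<in> S" and \<mu>: "0 \<le> \<mu>"
    and w: "\<And>\<omega>. 0 \<le> w \<omega>" "\<And>\<omega>. w \<omega> \<le> 1" and wm [measurable]: "w \<in> borel_measurable M"
    and \<phi>m: "\<And>x. x \<in> S \<Longrightarrow> (\<lambda>\<omega>. \<phi> \<omega> x) \<in> borel_measurable M"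
  shows "\<exists>Z' K'. gaussian_weight M S \<phi> (\<lambda>\<omega>. exp (- (\<mu> * (\<phi> \<omega> y)\<^sup>2)) * w \<omega>) Z' K'"
proof -
  define N where "N = std_normal_distribution"
  interpret N: prob_space N unfolding N_def by (rule prob_space_normal_density) simp
  interpret pair_sigma_finite M N ..
  have Z: "Z > 0" using g by (simp add: gaussian_weight_def)
  have Kyy: "0 \<le> K y y" by (rule gaussian_weight_variance_nonneg[OF g y w(1)])
  \<comment> \<open>With this \<open>r\<close>, \<open>exp (- \<mu> t\<^sup>2)\<close> is the mean
    of \<open>cis (r * \<zeta> * t)\<close> over a standard normal \<open>\<zeta>\<close>.\<close>
  define r where "r = sqrt (2 * \<mu>)"
  have r2: "r\<^sup>2 = 2 * \<mu>" using \<mu> by (simp add: r_def)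
  define c0 where "c0 = r\<^sup>2 * K y y"
  have c0: "0 \<le> c0" unfolding c0_def using Kyy by simp
  \<comment> \<open>\<open>B\<close> is the symmetrised covariance with the value at
    \<open>y\<close>. The weight adds \<open>2 * \<mu>\<close> to the precision at \<open>y\<close>,
    and \<open>K'\<close> is the resulting rank-one update of the covariance, as in the
    Sherman-Morrison formula; \<open>c0 \<ge> 0\<close> keeps its denominator positive.\<close>
  define B where "B x = (K x y + K y x) / 2" for x
  define K' where "K' x x' = K x x' - r\<^sup>2 * B x * B x' / (1 + c0)" for x x'
  have [measurable]: "(\<lambda>\<omega>. \<phi> \<omega> y) \<in> borel_measurable M" by (rule \<phi>m[OF y])
  have [measurable_cong]: "sets N = sets borel" by (simp add: N_def)
  have "gaussian_weight M S \<phi> (\<lambda>\<omega>. exp (- (\<mu> * (\<phi> \<omega> y)\<^sup>2)) * w \<omega>) (Z / sqrt (1 + c0)) K'"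
    unfolding gaussian_weight_def
  proof (intro conjI allI impI)
    show "0 < Z / sqrt (1 + c0)" using Z c0 by simp
  next
    fix n and x :: "nat \<Rightarrow> _" and c :: "nat \<Rightarrow> real"
    assume x: "\<forall>j<n. x j \<in> S"
    define X where "X \<omega> = (\<Sum>j<n. c j * \<phi> \<omega> (x j))" for \<omega>
    have [measurable]: "X \<in> borel_measurable M"
      unfolding X_def using x \<phi>m by (intro borel_measurable_sum) auto
    define Q where "Q = (\<Sum>j<n. \<Sum>k<n. c j * c k * K (x j) (x k))"
    define b where "b = (\<Sum>j<n. c j * B (x j))"
    have HS: "complex_of_real (exp (- (\<mu> * (\<phi> \<omega> y)\<^sup>2)) * w \<omega>) * cis (X \<omega>)
        = (\<integral>\<zeta>. complex_of_real (w \<omega>) * cis (X \<omega> + r * \<zeta> * \<phi> \<omega> y) \<partial>N)" for \<omega>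
    proof -
      have "(\<integral>\<zeta>. complex_of_real (w \<omega>) * cis (X \<omega> + r * \<zeta> * \<phi> \<omega> y) \<partial>N)
          = (\<integral>\<zeta>. complex_of_real (w \<omega>) * cis (X \<omega>) * cis (r * \<phi> \<omega> y * \<zeta>) \<partial>N)"
        by (simp add: mult.assoc cis_mult) (simp add: mult_ac)
      also have "\<dots> = complex_of_real (w \<omega>) * cis (X \<omega>) * complex_of_real (exp (- ((r * \<phi> \<omega> y)\<^sup>2) / 2))"
        unfolding N_def by (simp add: integral_std_normal_cis)
      also have "(r * \<phi> \<omega> y)\<^sup>2 = 2 * \<mu> * (\<phi> \<omega> y)\<^sup>2" by (simp add: power_mult_distrib r2)
      finally show ?thesis by (auto simp: mult_ac)
    qed
    have int: "integrable (M \<Otimes>\<^sub>M N) (\<lambda>(\<omega>, \<zeta>). complex_of_real (w \<omega>) * cis (X \<omega> + r * \<zeta> * \<phi> \<omega> y))"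
    proof -
      interpret MN: finite_measure "M \<Otimes>\<^sub>M N"
        by (intro finite_measure_pair_measure) (rule N.finite_measure_axioms finite_measure_axioms)+
      show ?thesis
        by (rule MN.integrable_const_bound[where B = 1]) (auto simp: norm_mult w)
    qed
    have inner: "(\<integral>\<omega>. complex_of_real (w \<omega>) * cis (X \<omega> + r * \<zeta> * \<phi> \<omega> y) \<partial>M)
        = complex_of_real (Z * exp (- Q / 2) * exp (- ((r * b) * \<zeta> + c0 * \<zeta>\<^sup>2 / 2)))" for \<zeta>
    proof -
      \<comment> \<open>For fixed \<open>\<zeta>\<close> the auxiliary term is one more point
        \<open>y\<close> with coefficient \<open>r * \<zeta>\<close>, so the assumption on
        \<open>w\<close> applies with \<open>Suc n\<close> points.\<close>
      let ?x = "\<lambda>j. if j < n then x j else y" and ?c = "\<lambda>j. if j < n then c j else r * \<zeta>"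
      have "(\<Sum>j<Suc n. \<Sum>k<Suc n. ?c j * ?c k * K (?x j) (?x k))
          = Q + ((\<Sum>j<n. c j * (r * \<zeta>) * K (x j) y) + ((\<Sum>k<n. (r * \<zeta>) * c k * K y (x k)) + r * \<zeta> * (r * \<zeta>) * K y y))"
        unfolding Q_def by (simp add: sum.distrib)
      also have "(\<Sum>j<n. c j * (r * \<zeta>) * K (x j) y) + ((\<Sum>k<n. (r * \<zeta>) * c k * K y (x k)) + r * \<zeta> * (r * \<zeta>) * K y y)
          = 2 * (r * b) * \<zeta> + c0 * \<zeta>\<^sup>2"
        unfolding b_def B_def c0_def
        by (simp add: sum_distrib_left sum_distrib_right sum.distrib[symmetric] power2_eq_square algebra_simps)
          (simp add: add_divide_distrib)
      finally have q: "(\<Sum>j<Suc n. \<Sum>k<Suc n. ?c j * ?c k * K (?x j) (?x k)) = Q + (2 * (r * b) * \<zeta> + c0 * \<zeta>\<^sup>2)"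
        by simp
      have "(\<integral>\<omega>. complex_of_real (w \<omega>) * cis (\<Sum>j<Suc n. ?c j * \<phi> \<omega> (?x j)) \<partial>M)
          = complex_of_real (Z * exp (- (1/2) * (Q + (2 * (r * b) * \<zeta> + c0 * \<zeta>\<^sup>2))))"
        unfolding q[symmetric] using x y by (intro gaussian_weightD[OF g]) auto
      also have "(\<lambda>\<omega>. \<Sum>j<Suc n. ?c j * \<phi> \<omega> (?x j)) = (\<lambda>\<omega>. X \<omega> + r * \<zeta> * \<phi> \<omega> y)"
        by (simp add: X_def)
      finally show ?thesis
        by (simp add: exp_add[symmetric] mult.assoc fun_eq_iff X_def field_simps flip: of_real_mult)
    qed
    have Kq: "(\<Sum>j<n. \<Sum>k<n. c j * c k * K' (x j) (x k)) = Q - r\<^sup>2 * b\<^sup>2 / (1 + c0)"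
      unfolding Q_def K'_def b_def power2_eq_square[of "sum _ _"] sum_product
      by (simp add: sum_subtractf right_diff_distrib sum_distrib_left sum_divide_distrib mult_ac)
    have "(LINT \<omega>|M. complex_of_real (exp (- (\<mu> * (\<phi> \<omega> y)\<^sup>2)) * w \<omega>) * cis (X \<omega>))
        = (\<integral>\<omega>. (\<integral>\<zeta>. complex_of_real (w \<omega>) * cis (X \<omega> + r * \<zeta> * \<phi> \<omega> y) \<partial>N) \<partial>M)"
      unfolding HS ..
    also have "\<dots> = (\<integral>\<zeta>. (\<integral>\<omega>. complex_of_real (w \<omega>) * cis (X \<omega> + r * \<zeta> * \<phi> \<omega> y) \<partial>M) \<partial>N)"
      by (rule Fubini_integral[OF int, symmetric])
    also have "\<dots> = complex_of_real (\<integral>\<zeta>. Z * exp (- Q / 2) * exp (- ((r * b) * \<zeta> + c0 * \<zeta>\<^sup>2 / 2)) \<partial>N)"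
      unfolding inner by (rule integral_complex_of_real)
    also have "(\<integral>\<zeta>. Z * exp (- Q / 2) * exp (- ((r * b) * \<zeta> + c0 * \<zeta>\<^sup>2 / 2)) \<partial>N)
        = Z * exp (- Q / 2) * (exp ((r * b)\<^sup>2 / (2 * (1 + c0))) / sqrt (1 + c0))"
      unfolding N_def integral_std_normal_exp_quadratic[OF c0, symmetric] by simp
    also have "\<dots> = Z / sqrt (1 + c0) * exp (- (1/2) * (Q - r\<^sup>2 * b\<^sup>2 / (1 + c0)))"
      using c0 by (simp add: exp_add[symmetric] power_mult_distrib field_simps)
    finally show "(LINT \<omega>|M. complex_of_real (exp (- (\<mu> * (\<phi> \<omega> y)\<^sup>2)) * w \<omega>) * cis (\<Sum>j<n. c j * \<phi> \<omega> (x j)))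
        = complex_of_real (Z / sqrt (1 + c0) * exp (- (1/2) * (\<Sum>j<n. \<Sum>k<n. c j * c k * K' (x j) (x k))))"
      unfolding Kq X_def .
  qed
  then show ?thesis by blast
qed

lemma prod_list_exp_bounds:
  fixes f :: "'a \<Rightarrow> real"
  assumes "\<And>x. 0 \<le> f x"
  shows "0 \<le> (\<Prod>x\<leftarrow>xs. exp (- f x))" "(\<Prod>x\<leftarrow>xs. exp (- f x)) \<le> 1"
proof -
  show nn: "0 \<le> (\<Prod>x\<leftarrow>xs. exp (- f x))" for xs by (induction xs) auto
  show "(\<Prod>x\<leftarrow>xs. exp (- f x)) \<le> 1"
    by (induction xs) (auto intro!: mult_le_one nn simp: assms)
qed

lemma prod_list_exp_measurable:
  fixes f :: "'w \<Rightarrow> 'a \<Rightarrow> real"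
  assumes "\<And>x. x \<in> set xs \<Longrightarrow> (\<lambda>\<omega>. f \<omega> x) \<in> borel_measurable M"
  shows "(\<lambda>\<omega>. \<Prod>x\<leftarrow>xs. exp (- f \<omega> x)) \<in> borel_measurable M"
  using assms by (induction xs) (auto intro!: borel_measurable_times)

text \<open>One rank-one step per entry. Lists rather than sets, because the points are later
  integrated independently and may coincide.\<close>

lemma (in finite_measure) gaussian_weight_list:
  assumes g: "gaussian_weight M S \<phi> (\<lambda>_. 1) Z K" and xs: "set xs \<subseteq> S" and \<mu>: "0 \<le> \<mu>"
    and \<phi>m: "\<And>x. x \<in> S \<Longrightarrow> (\<lambda>\<omega>. \<phi> \<omega> x) \<in> borel_measurable M"
  shows "\<exists>Z' K'. gaussian_weight M S \<phi> (\<lambda>\<omega>. \<Prod>x\<leftarrow>xs. exp (- (\<mu> * (\<phi> \<omega> x)\<^sup>2))) Z' K'"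
  using xs
proof (induction xs)
  case Nil
  then show ?case using g by auto
next
  case (Cons y xs)
  then obtain Z' K' where g': "gaussian_weight M S \<phi> (\<lambda>\<omega>. \<Prod>x\<leftarrow>xs. exp (- (\<mu> * (\<phi> \<omega> x)\<^sup>2))) Z' K'"
    by auto
  have "0 \<le> (\<Prod>x\<leftarrow>xs. exp (- (\<mu> * (\<phi> \<omega> x)\<^sup>2)))" "(\<Prod>x\<leftarrow>xs. exp (- (\<mu> * (\<phi> \<omega> x)\<^sup>2))) \<le> 1" for \<omega>
    using \<mu> by (auto intro!: prod_list_exp_bounds)
  moreover have "(\<lambda>\<omega>. \<Prod>x\<leftarrow>xs. exp (- (\<mu> * (\<phi> \<omega> x)\<^sup>2))) \<in> borel_measurable M"
    using Cons.prems \<phi>m by (intro prod_list_exp_measurable) auto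
  ultimately show ?case
    using gaussian_weight_step[OF g' _ \<mu> _ _ _ \<phi>m, of y] Cons.prems by auto
qed

section \<open>Second moments from characteristic functions, and the inequality at one point\<close>

lemma exp_minus_le_quadratic:
  fixes x :: real
  assumes "0 \<le> x"
  shows "exp (- x) \<le> 1 - x + x\<^sup>2 / 2"
proof -
  \<comment> \<open>The two quadratics are second-order Taylor polynomials of \<open>exp x\<close>
    and \<open>exp (- x)\<close>; their product exceeds 1 by \<open>x ^ 4 / 4\<close>.\<close>
  have "1 \<le> (1 + x + x\<^sup>2 / 2) * (1 - x + x\<^sup>2 / 2)"
  proof -
    have "(1 + x + x\<^sup>2 / 2) * (1 - x + x\<^sup>2 / 2) = 1 + x ^ 4 / 4"
      by (simp add: field_simps power2_eq_square power4_eq_xxxx)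
    then show ?thesis by simp
  qed
  also have "\<dots> \<le> exp x * (1 - x + x\<^sup>2 / 2)"
  proof (rule mult_right_mono[OF exp_lower_Taylor_quadratic[OF assms]])
    have "0 \<le> ((1 - x)\<^sup>2 + 1) / 2" by simp
    also have "\<dots> = 1 - x + x\<^sup>2 / 2" by (simp add: power2_eq_square field_simps)
    finally show "0 \<le> 1 - x + x\<^sup>2 / 2" .
  qed
  finally show ?thesis by (simp add: exp_minus field_simps)
qed

lemma cos_ge_quadratic: "1 - x\<^sup>2 / 2 \<le> cos (x::real)"
proof -
  have "(sin (x / 2))\<^sup>2 \<le> (x / 2)\<^sup>2"
    using abs_sin_x_le_abs_x[of "x / 2"] by (simp only: abs_le_square_iff)
  then show ?thesis using cos_double_sin[of "x / 2"] by (simp add: power2_eq_square)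
qed

text \<open>Fatou's lemma on rescaled \<open>1 - cos\<close> terms, whose means are read off the
  characteristic function and stay below \<open>K y y\<close>.\<close>

lemma (in prob_space) gaussian_weight_one_square_integrable:
  assumes g: "gaussian_weight M S \<phi> (\<lambda>_. 1) 1 K" and y: "y \<in> S"
    and [measurable]: "(\<lambda>\<omega>. \<phi> \<omega> y) \<in> borel_measurable M"
  shows "integrable M (\<lambda>\<omega>. (\<phi> \<omega> y)\<^sup>2)"
proof -
  define F where "F n \<omega> = 2 * (1 - cos (\<phi> \<omega> y / real (Suc n))) * (real (Suc n))\<^sup>2" for n \<omega>
  have Fm [measurable]: "F n \<in> borel_measurable M" for n
    unfolding F_def by measurable
  have nn: "0 \<le> F n \<omega>" for n \<omega> by (simp add: F_def)
  have K: "0 \<le> K y y" by (rule gaussian_weight_variance_nonneg[OF g y]) simp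
  have cos_int: "integrable M (\<lambda>\<omega>. cos (t * \<phi> \<omega> y))" for t
    by (rule integrable_const_bound[where B = 1]) auto
  have cisint: "integrable M (\<lambda>\<omega>. cis (t * \<phi> \<omega> y))" for t
    by (rule integrable_const_bound[where B = 1]) auto
  have ecos: "(\<integral>\<omega>. cos (t * \<phi> \<omega> y) \<partial>M) = exp (- (t\<^sup>2 * K y y / 2))" for t
    using gaussian_weight_one_point[OF g y, of t] integral_Re[OF cisint[of t]]
    by (simp add: complex_eq_iff)
  have bound: "(\<integral>\<^sup>+\<omega>. ennreal (F n \<omega>) \<partial>M) \<le> ennreal (K y y)" for n
  proof -
    let ?t = "1 / real (Suc n)"
    have int: "integrable M (F n)"
      unfolding F_def using cos_int[of ?t] by (auto intro!: integrable_diff)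
    have "(\<integral>\<omega>. F n \<omega> \<partial>M) = 2 * (1 - exp (- (?t\<^sup>2 * K y y / 2))) * (real (Suc n))\<^sup>2"
      unfolding F_def using ecos[of ?t] cos_int[of ?t]
      by (simp add: prob_space)
    also have "\<dots> \<le> 2 * (?t\<^sup>2 * K y y / 2) * (real (Suc n))\<^sup>2"
    proof -
      have "1 - exp (- (?t\<^sup>2 * K y y / 2)) \<le> ?t\<^sup>2 * K y y / 2"
        using exp_ge_add_one_self[of "- (?t\<^sup>2 * K y y / 2)"] by linarith
      then show ?thesis by (intro mult_right_mono mult_left_mono) auto
    qed
    also have "\<dots> = K y y" by (simp add: power_divide)
    finally show ?thesis
      by (subst nn_integral_eq_integral[OF int]) (auto simp: nn intro!: ennreal_leI)
  qed
  have lim: "(\<lambda>n. F n \<omega>) \<longlonglongrightarrow> (\<phi> \<omega> y)\<^sup>2" for \<omega>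
  proof -
    \<comment> \<open>By the half-angle formula \<open>F n\<close> is 4 times the square of a
      difference quotient of \<open>sin (?x * h)\<close> at 0, with
      \<open>h = 1 / Suc n\<close>.\<close>
    let ?x = "\<phi> \<omega> y / 2"
    have "DERIV (\<lambda>h. sin (?x * h)) 0 :> ?x" by (auto intro!: derivative_eq_intros)
    then have "((\<lambda>h. sin (?x * h) / h) \<longlongrightarrow> ?x) (at 0)" by (simp add: DERIV_def)
    moreover have "filterlim (\<lambda>n. inverse (real (Suc n))) (at 0) sequentially"
      by (simp add: filterlim_at LIMSEQ_inverse_real_of_nat del: of_nat_Suc)
    ultimately have "(\<lambda>n. sin (?x * inverse (real (Suc n))) / inverse (real (Suc n))) \<longlonglongrightarrow> ?x"
      by (rule filterlim_compose)
    then have "(\<lambda>n. 4 * (sin (?x * inverse (real (Suc n))) / inverse (real (Suc n)))\<^sup>2) \<longlonglongrightarrow> 4 * ?x\<^sup>2"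
      by (rule tendsto_mult_left[OF tendsto_power])
    also have "(\<lambda>n. 4 * (sin (?x * inverse (real (Suc n))) / inverse (real (Suc n)))\<^sup>2) = (\<lambda>n. F n \<omega>)"
    proof
      fix n
      have "cos (\<phi> \<omega> y / real (Suc n)) = 1 - 2 * (sin (?x * inverse (real (Suc n))))\<^sup>2"
        using cos_double_sin[of "?x * inverse (real (Suc n))"] by (simp add: field_simps del: of_nat_Suc)
      then show "4 * (sin (?x * inverse (real (Suc n))) / inverse (real (Suc n)))\<^sup>2 = F n \<omega>"
        unfolding F_def by (simp add: power_divide power_inverse divide_inverse[of _ "inverse _"] power_mult_distrib del: of_nat_Suc)
    qed
    finally show ?thesis by (simp add: power_divide)
  qed
  have "(\<integral>\<^sup>+\<omega>. ennreal ((\<phi> \<omega> y)\<^sup>2) \<partial>M) = (\<integral>\<^sup>+\<omega>. liminf (\<lambda>n. ennreal (F n \<omega>)) \<partial>M)"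
    by (intro nn_integral_cong lim_imp_Liminf[symmetric] tendsto_ennrealI lim) simp
  also have "\<dots> \<le> liminf (\<lambda>n. \<integral>\<^sup>+\<omega>. ennreal (F n \<omega>) \<partial>M)"
    by (rule nn_integral_liminf) simp
  also have "\<dots> \<le> ennreal (K y y)"
    using Liminf_mono[of "\<lambda>n. \<integral>\<^sup>+\<omega>. ennreal (F n \<omega>) \<partial>M" "\<lambda>_. ennreal (K y y)" sequentially] bound
    by (simp add: Liminf_const)
  also have "\<dots> < \<infinity>" by simp
  finally show ?thesis by (intro integrableI_nonneg) auto
qed

text \<open>The mean of the cosine is known exactly. For the square the lower bound
  \<open>Z * K y y\<close> suffices, since its coefficient \<open>a\<^sup>2 / 2\<close> is
  nonnegative. What remains is \<open>exp y \<ge> 1 + y\<close> with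
  \<open>y = a\<^sup>2 * (b - K y y) / 2\<close>, where \<open>K y y\<close> is the
  variance.\<close>

lemma (in prob_space) gaussian_weight_cos_ge:
  assumes g: "gaussian_weight M S \<phi> w Z K" and y: "y \<in> S"
    and [measurable]: "(\<lambda>\<omega>. \<phi> \<omega> y) \<in> borel_measurable M" "w \<in> borel_measurable M"
    and w: "\<And>\<omega>. 0 \<le> w \<omega>" "\<And>\<omega>. w \<omega> \<le> 1"
    and sq: "integrable M (\<lambda>\<omega>. (\<phi> \<omega> y)\<^sup>2)"
  shows "0 \<le> (\<integral>\<omega>. w \<omega> * (exp (a\<^sup>2 * b / 2) * cos (a * \<phi> \<omega> y) - 1 - a\<^sup>2 * b / 2 + a\<^sup>2 * (\<phi> \<omega> y)\<^sup>2 / 2) \<partial>M)"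
proof -
  let ?k = "K y y"
  have Z: "Z > 0" using g by (simp add: gaussian_weight_def)
  have k: "0 \<le> ?k" by (rule gaussian_weight_variance_nonneg[OF g y w(1)])
  have cisint: "integrable M (\<lambda>\<omega>. complex_of_real (w \<omega>) * cis (t * \<phi> \<omega> y))" for t
    by (rule integrable_const_bound[where B = 1]) (auto simp: norm_mult w)
  have ci: "integrable M (\<lambda>\<omega>. w \<omega> * cos (t * \<phi> \<omega> y))" for t
    by (rule integrable_const_bound[where B = 1]) (auto simp: abs_mult w intro!: mult_le_one)
  have ecos: "(\<integral>\<omega>. w \<omega> * cos (t * \<phi> \<omega> y) \<partial>M) = Z * exp (- (t\<^sup>2 * ?k / 2))" for t
    using gaussian_weight_one_point[OF g y, of t] integral_Re[OF cisint[of t]]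
    by (simp add: complex_eq_iff)
  have wi: "integrable M w" using ci[of 0] by simp
  have ew: "(\<integral>\<omega>. w \<omega> \<partial>M) = Z" using ecos[of 0] by simp
  have wsq: "integrable M (\<lambda>\<omega>. w \<omega> * (\<phi> \<omega> y)\<^sup>2)"
    by (rule Bochner_Integration.integrable_bound[OF sq]) (auto simp: abs_mult w intro!: mult_left_le_one_le)
  \<comment> \<open>The square dominates \<open>2 * (1 - cos (t * p)) / t\<^sup>2\<close>, whose
    weighted mean is explicit; the error \<open>t\<^sup>2 * ?k\<^sup>2 / 4\<close> comes from the
    quadratic bound on \<open>exp\<close> and disappears as \<open>t\<close> tends to 0.\<close>
  have ge: "Z * (?k - t\<^sup>2 * ?k\<^sup>2 / 4) \<le> (\<integral>\<omega>. w \<omega> * (\<phi> \<omega> y)\<^sup>2 \<partial>M)" if t: "t > 0" for t :: real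
  proof -
    have "2 * (1 - cos (t * p)) / t\<^sup>2 \<le> p\<^sup>2" for p
      using cos_ge_quadratic[of "t * p"] t by (simp add: field_simps power_mult_distrib)
    note le = mult_left_mono[OF this w(1)]
    have pt: "2 / t\<^sup>2 * (w \<omega> - w \<omega> * cos (t * \<phi> \<omega> y)) \<le> w \<omega> * (\<phi> \<omega> y)\<^sup>2" for \<omega>
      using le[of \<omega> "\<phi> \<omega> y"]
      by (simp add: right_diff_distrib mult_ac diff_divide_distrib)
    have "(t\<^sup>2 * ?k / 2) - (t\<^sup>2 * ?k / 2)\<^sup>2 / 2 \<le> 1 - exp (- (t\<^sup>2 * ?k / 2))"
      using exp_minus_le_quadratic[of "t\<^sup>2 * ?k / 2"] k by simp
    then have "2 / t\<^sup>2 * Z * ((t\<^sup>2 * ?k / 2) - (t\<^sup>2 * ?k / 2)\<^sup>2 / 2) \<le> 2 / t\<^sup>2 * Z * (1 - exp (- (t\<^sup>2 * ?k / 2)))"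
      using Z by (intro mult_left_mono) auto
    also have "2 / t\<^sup>2 * Z * ((t\<^sup>2 * ?k / 2) - (t\<^sup>2 * ?k / 2)\<^sup>2 / 2) = Z * (?k - t\<^sup>2 * ?k\<^sup>2 / 4)"
      using t by (simp add: field_simps power2_eq_square)
    also have "2 / t\<^sup>2 * Z * (1 - exp (- (t\<^sup>2 * ?k / 2))) = (\<integral>\<omega>. 2 / t\<^sup>2 * (w \<omega> - w \<omega> * cos (t * \<phi> \<omega> y)) \<partial>M)"
    proof -
      have "(\<integral>\<omega>. w \<omega> - w \<omega> * cos (t * \<phi> \<omega> y) \<partial>M) = Z * (1 - exp (- (t\<^sup>2 * ?k / 2)))"
        using wi ci[of t] by (subst Bochner_Integration.integral_diff) (simp_all add: ew ecos right_diff_distrib)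
      then show ?thesis by (simp only: integral_mult_right_zero mult.assoc)
    qed
    also have "\<dots> \<le> (\<integral>\<omega>. w \<omega> * (\<phi> \<omega> y)\<^sup>2 \<partial>M)"
      using wi ci[of t] wsq pt by (intro integral_mono) auto
    finally show ?thesis .
  qed
  have "((\<lambda>t. Z * (?k - t\<^sup>2 * ?k\<^sup>2 / 4)) \<longlongrightarrow> Z * (?k - 0\<^sup>2 * ?k\<^sup>2 / 4)) (at_right 0)"
    by (intro tendsto_intros) simp_all
  then have lower: "Z * ?k \<le> (\<integral>\<omega>. w \<omega> * (\<phi> \<omega> y)\<^sup>2 \<partial>M)"
    using tendsto_upperbound[of "\<lambda>t. Z * (?k - t\<^sup>2 * ?k\<^sup>2 / 4)" "Z * ?k" "at_right 0"] ge
    by (auto simp: eventually_at_right_less eventually_at_filter)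
  have "0 \<le> Z * (exp (a\<^sup>2 * (b - ?k) / 2) - (1 + a\<^sup>2 * (b - ?k) / 2))"
    using Z exp_ge_add_one_self[of "a\<^sup>2 * (b - ?k) / 2"] by (intro mult_nonneg_nonneg) auto
  also have "\<dots> = exp (a\<^sup>2 * b / 2) * (Z * exp (- (a\<^sup>2 * ?k / 2))) - Z - a\<^sup>2 * b / 2 * Z + a\<^sup>2 / 2 * (Z * ?k)"
    by (simp add: exp_add[symmetric] field_simps exp_diff exp_minus)
  also have "\<dots> \<le> exp (a\<^sup>2 * b / 2) * (\<integral>\<omega>. w \<omega> * cos (a * \<phi> \<omega> y) \<partial>M) - (\<integral>\<omega>. w \<omega> \<partial>M)
       - a\<^sup>2 * b / 2 * (\<integral>\<omega>. w \<omega> \<partial>M) + a\<^sup>2 / 2 * (\<integral>\<omega>. w \<omega> * (\<phi> \<omega> y)\<^sup>2 \<partial>M)"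
    unfolding ecos ew using lower by (intro add_left_mono mult_left_mono) auto
  also have "\<dots> = (\<integral>\<omega>. exp (a\<^sup>2 * b / 2) * (w \<omega> * cos (a * \<phi> \<omega> y)) - w \<omega> - a\<^sup>2 * b / 2 * w \<omega> + a\<^sup>2 / 2 * (w \<omega> * (\<phi> \<omega> y)\<^sup>2) \<partial>M)"
    using ci[of a] wi wsq by simp
  also have "\<dots> = (\<integral>\<omega>. w \<omega> * (exp (a\<^sup>2 * b / 2) * cos (a * \<phi> \<omega> y) - 1 - a\<^sup>2 * b / 2 + a\<^sup>2 * (\<phi> \<omega> y)\<^sup>2 / 2) \<partial>M)"
    by (intro Bochner_Integration.integral_cong refl) (simp add: algebra_simps)
  finally show ?thesis .
qed

section \<open>Mixtures of quadratic weights\<close>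

lemma integrable_pair_fst:
  fixes f :: "'a \<Rightarrow> 'b::{banach, second_countable_topology}"
  assumes "finite_measure M" "finite_measure N" "integrable M f"
  shows "integrable (M \<Otimes>\<^sub>M N) (\<lambda>p. f (fst p))"
proof -
  interpret M: finite_measure M by fact
  interpret N: finite_measure N by fact
  interpret pair_sigma_finite M N ..
  have [measurable]: "f \<in> borel_measurable M" using assms(3) by simp
  show ?thesis
    using assms(3) by (intro Fubini_integrable) auto
qed

lemma integrable_pair_bounded_by_fst:
  fixes f :: "'a \<times> 'c \<Rightarrow> 'b::{banach, second_countable_topology}" and g :: "'a \<Rightarrow> real"
  assumes "finite_measure M" "finite_measure N" "integrable M g"
    and "f \<in> borel_measurable (M \<Otimes>\<^sub>M N)"
    and "\<And>x y. x \<in> space M \<Longrightarrow> y \<in> space N \<Longrightarrow> norm (f (x, y)) \<le> g x"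
  shows "integrable (M \<Otimes>\<^sub>M N) f"
  using integrable_pair_fst[OF assms(1-3)] assms(4)
proof (rule Bochner_Integration.integrable_bound)
  show "AE p in M \<Otimes>\<^sub>M N. norm (f p) \<le> norm (g (fst p))"
    using assms(5) by (intro AE_I2) (fastforce simp: space_pair_measure)
qed

lemma (in finite_measure) integral_bounded_by_one:
  fixes f :: "'a \<Rightarrow> real"
  assumes "\<And>x. 0 \<le> f x" "\<And>x. f x \<le> 1"
  shows "0 \<le> (\<integral>x. f x \<partial>M)" "(\<integral>x. f x \<partial>M) \<le> measure M (space M)"
proof -
  show "0 \<le> (\<integral>x. f x \<partial>M)" using assms by simp
  show "(\<integral>x. f x \<partial>M) \<le> measure M (space M)"
  proof (cases "integrable M f")
    case True
    then have "(\<integral>x. f x \<partial>M) \<le> (\<integral>x. 1 \<partial>M)" using assms by (intro integral_mono) auto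
    then show ?thesis by simp
  \<comment> \<open>A non-integrable \<open>f\<close> has integral 0 by convention, so the bound
    holds for sections at every point, including those outside the underlying space.\<close>
  qed (simp add: not_integrable_integral_eq)
qed

text \<open>By Fubini, each factor of the power is traded for one more point in \<open>xs\<close>,
  integrated over \<open>m\<close>. Hence the induction on \<open>k\<close> for all lists
  \<open>xs\<close> at once.\<close>

lemma (in prob_space) integral_mixture_nonneg:
  fixes \<phi> :: "'a \<Rightarrow> 'x \<Rightarrow> real"
  assumes m: "finite_measure m" and \<mu>: "0 \<le> \<mu>"
    and \<phi>m [measurable]: "(\<lambda>(\<omega>, x). \<phi> \<omega> x) \<in> borel_measurable (M \<Otimes>\<^sub>M m)"
    and H: "integrable M H"
    and pos: "\<And>xs. set xs \<subseteq> space m \<Longrightarrow> 0 \<le> (\<integral>\<omega>. (\<Prod>x\<leftarrow>xs. exp (- (\<mu> * (\<phi> \<omega> x)\<^sup>2))) * H \<omega> \<partial>M)"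
    and xs: "set xs \<subseteq> space m"
  shows "0 \<le> (\<integral>\<omega>. (\<Prod>x\<leftarrow>xs. exp (- (\<mu> * (\<phi> \<omega> x)\<^sup>2))) * (\<integral>x. exp (- (\<mu> * (\<phi> \<omega> x)\<^sup>2)) \<partial>m) ^ k * H \<omega> \<partial>M)"
  using xs
proof (induction k arbitrary: xs)
  case 0
  then show ?case using pos by simp
next
  case (Suc k)
  interpret m: finite_measure m by fact
  interpret pair_sigma_finite M m ..
  define G where "G \<omega> = (\<integral>x. exp (- (\<mu> * (\<phi> \<omega> x)\<^sup>2)) \<partial>m)" for \<omega>
  define p where "p \<omega> = (\<Prod>x\<leftarrow>xs. exp (- (\<mu> * (\<phi> \<omega> x)\<^sup>2)))" for \<omega>
  let ?L = "measure m (space m)"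
  have [measurable]: "H \<in> borel_measurable M" using H by simp
  have [measurable]: "G \<in> borel_measurable M" unfolding G_def by measurable
  have [measurable]: "p \<in> borel_measurable M"
    unfolding p_def using Suc.prems by (intro prod_list_exp_measurable) auto
  have p: "0 \<le> p \<omega>" "p \<omega> \<le> 1" for \<omega>
    unfolding p_def using \<mu> by (intro prod_list_exp_bounds; simp)+
  have G: "0 \<le> G \<omega>" "G \<omega> \<le> ?L" for \<omega>
    unfolding G_def using \<mu> by (intro m.integral_bounded_by_one; simp)+
  define F where "F \<omega> x = exp (- (\<mu> * (\<phi> \<omega> x)\<^sup>2)) * p \<omega> * G \<omega> ^ k * H \<omega>" for \<omega> x
  have int: "integrable (M \<Otimes>\<^sub>M m) (case_prod F)"
  proof (rule integrable_pair_bounded_by_fst[where g = "\<lambda>\<omega>. ?L ^ k * \<bar>H \<omega>\<bar>"])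
    fix \<omega> x
    have "exp (- (\<mu> * (\<phi> \<omega> x)\<^sup>2)) * p \<omega> * G \<omega> ^ k \<le> 1 * 1 * ?L ^ k"
      using p[of \<omega>] G[of \<omega>] \<mu> by (intro mult_mono power_mono) auto
    then show "norm (case (\<omega>, x) of (\<omega>, x) \<Rightarrow> F \<omega> x) \<le> ?L ^ k * \<bar>H \<omega>\<bar>"
      using p[of \<omega>] G[of \<omega>] by (simp add: F_def abs_mult mult_right_mono)
  next
    show "case_prod F \<in> borel_measurable (M \<Otimes>\<^sub>M m)" unfolding F_def by measurable
  qed (use H in \<open>auto intro: finite_measure_axioms m\<close>)
  have "0 \<le> (\<integral>x. (\<integral>\<omega>. F \<omega> x \<partial>M) \<partial>m)"
  proof (rule Bochner_Integration.integral_nonneg)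
    fix x assume "x \<in> space m"
    then show "0 \<le> (\<integral>\<omega>. F \<omega> x \<partial>M)"
      using Suc.IH[of "x # xs"] Suc.prems by (simp add: F_def G_def p_def)
  qed
  also have "\<dots> = (\<integral>\<omega>. (\<integral>x. F \<omega> x \<partial>m) \<partial>M)"
    by (rule Fubini_integral[OF int])
  also have "(\<lambda>\<omega>. \<integral>x. F \<omega> x \<partial>m) = (\<lambda>\<omega>. p \<omega> * G \<omega> ^ Suc k * H \<omega>)"
    by (simp add: F_def G_def mult_ac)
  finally show ?case by (simp add: G_def p_def)
qed

text \<open>With \<open>G\<close> the integral of \<open>exp (- \<mu> \<phi>\<^sup>2)\<close>, the
  weight equals \<open>exp (- r * ?L) * exp (r * G)\<close>. The exponential series in
  \<open>r * G\<close> has nonnegative coefficients, and each power of \<open>G\<close> is covered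
  by the mixture lemma.\<close>

lemma (in prob_space) integral_poisson_mixture_nonneg:
  fixes \<phi> :: "'a \<Rightarrow> 'x \<Rightarrow> real"
  assumes m: "finite_measure m" and \<mu>: "0 \<le> \<mu>"
    and \<phi>m [measurable]: "(\<lambda>(\<omega>, x). \<phi> \<omega> x) \<in> borel_measurable (M \<Otimes>\<^sub>M m)"
    and H: "integrable M H"
    and pos: "\<And>xs. set xs \<subseteq> space m \<Longrightarrow> 0 \<le> (\<integral>\<omega>. (\<Prod>x\<leftarrow>xs. exp (- (\<mu> * (\<phi> \<omega> x)\<^sup>2))) * H \<omega> \<partial>M)"
    and r: "0 \<le> r"
  shows "0 \<le> (\<integral>\<omega>. exp (- (\<integral>x. r * (1 - exp (- (\<mu> * (\<phi> \<omega> x)\<^sup>2))) \<partial>m)) * H \<omega> \<partial>M)"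
proof -
  interpret m: finite_measure m by fact
  define G where "G \<omega> = (\<integral>x. exp (- (\<mu> * (\<phi> \<omega> x)\<^sup>2)) \<partial>m)" for \<omega>
  let ?L = "measure m (space m)"
  have [measurable]: "H \<in> borel_measurable M" using H by simp
  have Gm [measurable]: "G \<in> borel_measurable M" unfolding G_def by measurable
  have G: "0 \<le> G \<omega>" "G \<omega> \<le> ?L" for \<omega>
    unfolding G_def using \<mu> by (intro m.integral_bounded_by_one; simp)+
  have eq: "exp (- (\<integral>x. r * (1 - exp (- (\<mu> * (\<phi> \<omega> x)\<^sup>2))) \<partial>m)) = exp (- r * ?L) * exp (r * G \<omega>)"
    if "\<omega> \<in> space M" for \<omega>
  proof -
    have [measurable]: "\<phi> \<omega> \<in> borel_measurable m" using that by measurable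
    have "integrable m (\<lambda>x. exp (- (\<mu> * (\<phi> \<omega> x)\<^sup>2)))"
      using \<mu> by (intro m.integrable_const_bound[where B = 1]) auto
    then have "(\<integral>x. r * (1 - exp (- (\<mu> * (\<phi> \<omega> x)\<^sup>2))) \<partial>m) = r * ?L - r * G \<omega>"
      by (simp add: G_def right_diff_distrib)
    then show ?thesis by (simp flip: exp_add)
  qed
  define s where "s K \<omega> = (\<Sum>k<K. (r * G \<omega>) ^ k / fact k) * H \<omega>" for K \<omega>
  have s_nonneg: "0 \<le> (\<integral>\<omega>. s K \<omega> \<partial>M)" for K
  proof -
    have int: "integrable M (\<lambda>\<omega>. G \<omega> ^ k * H \<omega>)" for k
    proof (rule Bochner_Integration.integrable_bound)
      show "integrable M (\<lambda>\<omega>. ?L ^ k * H \<omega>)" using H by simp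
      show "AE \<omega> in M. norm (G \<omega> ^ k * H \<omega>) \<le> norm (?L ^ k * H \<omega>)"
        using G by (intro AE_I2) (auto simp: abs_mult intro!: mult_right_mono power_mono)
    qed auto
    have "(\<integral>\<omega>. s K \<omega> \<partial>M) = (\<integral>\<omega>. (\<Sum>k<K. r ^ k / fact k * (G \<omega> ^ k * H \<omega>)) \<partial>M)"
      by (simp add: s_def sum_distrib_right power_mult_distrib mult.assoc)
    also have "\<dots> = (\<Sum>k<K. r ^ k / fact k * (\<integral>\<omega>. G \<omega> ^ k * H \<omega> \<partial>M))"
      using int by (subst Bochner_Integration.integral_sum) auto
    also have "\<dots> \<ge> 0"
      using integral_mixture_nonneg[OF m \<mu> \<phi>m H pos, of "[]"] r
      by (intro sum_nonneg mult_nonneg_nonneg) (auto simp: G_def)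
    finally show ?thesis .
  qed
  \<comment> \<open>Partial sums of a series with nonnegative terms lie below
    \<open>exp (r * G)\<close>, hence below \<open>exp (r * ?L)\<close>, which gives the dominating
    function.\<close>
  have "(\<lambda>K. \<integral>\<omega>. s K \<omega> \<partial>M) \<longlonglongrightarrow> (\<integral>\<omega>. exp (r * G \<omega>) * H \<omega> \<partial>M)"
  proof (rule integral_dominated_convergence)
    show "integrable M (\<lambda>\<omega>. exp (r * ?L) * \<bar>H \<omega>\<bar>)" using H by simp
    show "AE \<omega> in M. (\<lambda>K. s K \<omega>) \<longlonglongrightarrow> exp (r * G \<omega>) * H \<omega>"
      unfolding s_def
      using exp_converges[of "r * G _"]
      by (intro AE_I2 tendsto_mult_right) (simp add: sums_def scaleR_conv_of_real divide_inverse mult.commute)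
    fix K
    show "AE \<omega> in M. norm (s K \<omega>) \<le> exp (r * ?L) * \<bar>H \<omega>\<bar>"
    proof (rule AE_I2)
      fix \<omega>
      have nn: "0 \<le> r * G \<omega>" using r G by simp
      have "(\<Sum>k<K. (r * G \<omega>) ^ k / fact k) \<le> exp (r * G \<omega>)"
        using exp_converges[of "r * G \<omega>"] nn sum_le_suminf[of "\<lambda>k. (r * G \<omega>) ^ k / fact k" "{..<K}"]
        by (simp add: sums_iff divide_inverse mult.commute)
      also have "\<dots> \<le> exp (r * ?L)" using r G by (simp add: mult_left_mono)
      finally have "(\<Sum>k<K. (r * G \<omega>) ^ k / fact k) \<le> exp (r * ?L)" .
      moreover have "0 \<le> (\<Sum>k<K. (r * G \<omega>) ^ k / fact k)" using nn by (intro sum_nonneg) auto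
      ultimately show "norm (s K \<omega>) \<le> exp (r * ?L) * \<bar>H \<omega>\<bar>"
        by (auto simp: s_def abs_mult intro!: mult_right_mono)
    qed
  qed (auto simp: s_def)
  then have "0 \<le> (\<integral>\<omega>. exp (r * G \<omega>) * H \<omega> \<partial>M)"
    using s_nonneg by (intro LIMSEQ_le_const) auto
  then have "0 \<le> exp (- r * ?L) * (\<integral>\<omega>. exp (r * G \<omega>) * H \<omega> \<partial>M)" by simp
  also have "\<dots> = (\<integral>\<omega>. exp (- r * ?L) * (exp (r * G \<omega>) * H \<omega>) \<partial>M)" by simp
  also have "\<dots> = (\<integral>\<omega>. exp (- (\<integral>x. r * (1 - exp (- (\<mu> * (\<phi> \<omega> x)\<^sup>2))) \<partial>m)) * H \<omega> \<partial>M)"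
    by (intro Bochner_Integration.integral_cong refl) (simp only: eq mult.assoc)
  finally show ?thesis .
qed

section \<open>From Poisson mixtures to the exponential of the quadratic functional\<close>

definition exp_neg :: "ennreal \<Rightarrow> real" where
  "exp_neg I = (if I = \<infinity> then 0 else exp (- enn2real I))"

lemma exp_neg_bounds: "0 \<le> exp_neg I" "exp_neg I \<le> 1"
  by (auto simp: exp_neg_def)

lemma measurable_exp_neg [measurable]: "exp_neg \<in> borel_measurable borel"
  unfolding exp_neg_def by measurable

lemma tendsto_exp_neg:
  assumes "((\<lambda>n. ennreal (J n)) \<longlongrightarrow> I) F" "\<And>n. 0 \<le> J n"
  shows "((\<lambda>n. exp (- J n)) \<longlongrightarrow> exp_neg I) F"
proof (cases "I = \<infinity>")
  case True
  then have "filterlim J at_top F" using assms(1) by (simp add: ennreal_tendsto_top_eq_at_top)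
  then have "((\<lambda>n. exp (- J n)) \<longlongrightarrow> 0) F"
    by (intro filterlim_compose[OF exp_at_bot]) (simp add: filterlim_uminus_at_bot)
  then show ?thesis using True by (simp add: exp_neg_def)
next
  case False
  then have "((\<lambda>n. enn2real (ennreal (J n))) \<longlongrightarrow> enn2real I) F"
    using assms(1) by (intro tendsto_enn2real) (auto simp: top.not_eq_extremum)
  then have "((\<lambda>n. exp (- J n)) \<longlongrightarrow> exp (- enn2real I)) F"
    using assms(2) by (intro tendsto_intros) simp
  then show ?thesis using False by (simp add: exp_neg_def)
qed

text \<open>Halving \<open>t\<close> takes a square root of the exponential, and
  \<open>1 - y\<^sup>2 \<le> 2 * (1 - y)\<close>. Powers of 2 are chosen so that monotone
  convergence applies, also where the limiting integral is infinite.\<close>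

lemma incseq_pow2_one_minus_exp: "incseq (\<lambda>n. 2 ^ n * (1 - exp (- (t / 2 ^ n :: real))))"
proof (rule incseq_SucI)
  fix n
  let ?y = "exp (- (t / 2 ^ Suc n))"
  have e: "exp (- (t / 2 ^ n)) = ?y * ?y" by (simp flip: exp_add)
  have "(1 - ?y * ?y) \<le> 2 * (1 - ?y)"
    using zero_le_power2[of "1 - ?y"] by (simp add: power2_eq_square algebra_simps)
  then have "2 ^ n * (1 - ?y * ?y) \<le> 2 ^ n * (2 * (1 - ?y))" by (rule mult_left_mono) simp
  then show "2 ^ n * (1 - exp (- (t / 2 ^ n))) \<le> 2 ^ Suc n * (1 - exp (- (t / 2 ^ Suc n)))"
    unfolding e by (simp add: mult_ac)
qed

lemma tendsto_pow2_one_minus_exp: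
  assumes t: "0 \<le> (t::real)"
  shows "(\<lambda>n. 2 ^ n * (1 - exp (- (t / 2 ^ n)))) \<longlonglongrightarrow> t"
proof (rule real_tendsto_sandwich)
  show "\<forall>\<^sub>F n in sequentially. t - t\<^sup>2 / 2 * (1 / 2) ^ n \<le> 2 ^ n * (1 - exp (- (t / 2 ^ n)))"
  proof (intro always_eventually allI)
    fix n :: nat
    have "2 ^ n * (t / 2 ^ n - (t / 2 ^ n)\<^sup>2 / 2) \<le> 2 ^ n * (1 - exp (- (t / 2 ^ n)))"
      using exp_minus_le_quadratic[of "t / 2 ^ n"] t by (intro mult_left_mono) auto
    then show "t - t\<^sup>2 / 2 * (1 / 2) ^ n \<le> 2 ^ n * (1 - exp (- (t / 2 ^ n)))"
      by (simp add: right_diff_distrib power2_eq_square power_one_over)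
  qed
  show "\<forall>\<^sub>F n in sequentially. 2 ^ n * (1 - exp (- (t / 2 ^ n))) \<le> t"
  proof (intro always_eventually allI)
    fix n :: nat
    have "2 ^ n * (1 - exp (- (t / 2 ^ n))) \<le> 2 ^ n * (t / 2 ^ n)"
      using exp_ge_add_one_self[of "- (t / 2 ^ n)"] by (intro mult_left_mono) auto
    then show "2 ^ n * (1 - exp (- (t / 2 ^ n))) \<le> t" by simp
  qed
  have "(\<lambda>n. t - t\<^sup>2 / 2 * (1 / 2) ^ n) \<longlonglongrightarrow> t - t\<^sup>2 / 2 * 0"
    by (intro tendsto_intros LIMSEQ_realpow_zero) auto
  then show "(\<lambda>n. t - t\<^sup>2 / 2 * (1 / 2) ^ n) \<longlonglongrightarrow> t" by simp
qed simp

text \<open>Many points of small weight: intensity \<open>2 ^ n\<close> and coefficient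
  \<open>\<mu> / 2 ^ n\<close> give exponents \<open>J n\<close> increasing to the integral of
  \<open>\<mu> \<phi>\<^sup>2\<close>, finite or not. The weights stay in [0, 1], so
  \<open>H\<close> dominates and nonnegativity passes to the limit.\<close>

lemma (in prob_space) integral_exp_neg_nonneg:
  fixes \<phi> :: "'a \<Rightarrow> 'x \<Rightarrow> real"
  assumes m: "finite_measure m" and \<mu>: "0 \<le> \<mu>"
    and \<phi>m [measurable]: "(\<lambda>(\<omega>, x). \<phi> \<omega> x) \<in> borel_measurable (M \<Otimes>\<^sub>M m)"
    and H: "integrable M H"
    and pos: "\<And>xs \<nu>. 0 \<le> \<nu> \<Longrightarrow> set xs \<subseteq> space m \<Longrightarrow>
        0 \<le> (\<integral>\<omega>. (\<Prod>x\<leftarrow>xs. exp (- (\<nu> * (\<phi> \<omega> x)\<^sup>2))) * H \<omega> \<partial>M)"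
  shows "0 \<le> (\<integral>\<omega>. exp_neg (\<integral>\<^sup>+x. ennreal (\<mu> * (\<phi> \<omega> x)\<^sup>2) \<partial>m) * H \<omega> \<partial>M)"
proof -
  interpret m: finite_measure m by fact
  have [measurable]: "H \<in> borel_measurable M" using H by simp
  define f where "f n \<omega> x = 2 ^ n * (1 - exp (- (\<mu> / 2 ^ n * (\<phi> \<omega> x)\<^sup>2)))" for n :: nat and \<omega> x
  define J where "J n \<omega> = (\<integral>x. f n \<omega> x \<partial>m)" for n \<omega>
  have fm [measurable]: "(\<lambda>(\<omega>, x). f n \<omega> x) \<in> borel_measurable (M \<Otimes>\<^sub>M m)" for n
    unfolding f_def by measurable
  have Jm [measurable]: "J n \<in> borel_measurable M" for n unfolding J_def by measurable
  have f: "0 \<le> f n \<omega> x" "f n \<omega> x \<le> 2 ^ n" for n \<omega> x using \<mu> by (auto simp: f_def)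
  have J: "0 \<le> J n \<omega>" for n \<omega> unfolding J_def using f by simp
  have lim: "(\<lambda>n. exp (- J n \<omega>)) \<longlonglongrightarrow> exp_neg (\<integral>\<^sup>+x. ennreal (\<mu> * (\<phi> \<omega> x)\<^sup>2) \<partial>m)"
    if \<omega>: "\<omega> \<in> space M" for \<omega>
  proof (rule tendsto_exp_neg[OF _ J])
    have [measurable]: "f n \<omega> \<in> borel_measurable m" for n using \<omega> by measurable
    have "integrable m (f n \<omega>)" for n
      using f by (intro m.integrable_const_bound[where B = "2 ^ n"]) auto
    then have "ennreal (J n \<omega>) = (\<integral>\<^sup>+x. ennreal (f n \<omega> x) \<partial>m)" for n
      unfolding J_def using f by (subst nn_integral_eq_integral) auto
    moreover have "(\<lambda>n. \<integral>\<^sup>+x. ennreal (f n \<omega> x) \<partial>m) \<longlonglongrightarrow> (\<integral>\<^sup>+x. ennreal (\<mu> * (\<phi> \<omega> x)\<^sup>2) \<partial>m)"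
    proof (rule nn_integral_LIMSEQ)
      show "incseq (\<lambda>n x. ennreal (f n \<omega> x))"
        using incseq_pow2_one_minus_exp[of "\<mu> * (\<phi> \<omega> _)\<^sup>2"]
        by (auto simp: incseq_def le_fun_def f_def intro!: ennreal_leI)
      show "(\<lambda>n. ennreal (f n \<omega> x)) \<longlonglongrightarrow> ennreal (\<mu> * (\<phi> \<omega> x)\<^sup>2)" for x
        using tendsto_pow2_one_minus_exp[of "\<mu> * (\<phi> \<omega> x)\<^sup>2"] \<mu>
        by (intro tendsto_ennrealI) (simp add: f_def)
    qed auto
    ultimately show "(\<lambda>n. ennreal (J n \<omega>)) \<longlonglongrightarrow> (\<integral>\<^sup>+x. ennreal (\<mu> * (\<phi> \<omega> x)\<^sup>2) \<partial>m)" by simp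
  qed
  have "(\<lambda>n. \<integral>\<omega>. exp (- J n \<omega>) * H \<omega> \<partial>M)
      \<longlonglongrightarrow> (\<integral>\<omega>. exp_neg (\<integral>\<^sup>+x. ennreal (\<mu> * (\<phi> \<omega> x)\<^sup>2) \<partial>m) * H \<omega> \<partial>M)"
  proof (rule integral_dominated_convergence)
    show "integrable M (\<lambda>\<omega>. \<bar>H \<omega>\<bar>)" using H by simp
    show "AE \<omega> in M. (\<lambda>n. exp (- J n \<omega>) * H \<omega>)
        \<longlonglongrightarrow> exp_neg (\<integral>\<^sup>+x. ennreal (\<mu> * (\<phi> \<omega> x)\<^sup>2) \<partial>m) * H \<omega>"
      by (intro AE_I2 tendsto_mult_right lim)
    show "AE \<omega> in M. norm (exp (- J n \<omega>) * H \<omega>) \<le> \<bar>H \<omega>\<bar>" for n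
      using J by (intro AE_I2) (auto simp: abs_mult intro!: mult_left_le_one_le)
  qed auto
  moreover have "0 \<le> (\<integral>\<omega>. exp (- J n \<omega>) * H \<omega> \<partial>M)" for n
    unfolding J_def f_def using \<mu> pos
    by (intro integral_poisson_mixture_nonneg[OF m _ \<phi>m H] pos) auto
  ultimately show ?thesis by (intro LIMSEQ_le_const) auto
qed

text \<open>For a Gaussian weight of variance \<open>k\<close> the integral is a positive multiple of
  \<open>exp t - 1 - t\<close> with \<open>t = a\<^sup>2 (b - k) / 2\<close>. The integrand enters linearly, so
  nonnegativity survives the mixtures and limits that produce \<open>exp_neg\<close>; normality of the
  limiting weighted field is never needed.\<close>

lemma (in prob_space) gaussian_exp_neg_cos_ge:
  fixes \<phi> :: "'a \<Rightarrow> 'x \<Rightarrow> real"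
  assumes g: "gaussian_weight M (space m) \<phi> (\<lambda>_. 1) 1 K"
    and m: "finite_measure m" and \<mu>: "0 \<le> \<mu>"
    and \<phi>m [measurable]: "(\<lambda>(\<omega>, x). \<phi> \<omega> x) \<in> borel_measurable (M \<Otimes>\<^sub>M m)"
    and y: "y \<in> space m"
  shows "0 \<le> (\<integral>\<omega>. exp_neg (\<integral>\<^sup>+x. ennreal (\<mu> * (\<phi> \<omega> x)\<^sup>2) \<partial>m) *
     (exp (a\<^sup>2 * b / 2) * cos (a * \<phi> \<omega> y) - 1 - a\<^sup>2 * b / 2 + a\<^sup>2 * (\<phi> \<omega> y)\<^sup>2 / 2) \<partial>M)"
proof (rule integral_exp_neg_nonneg[OF m \<mu> \<phi>m])
  have \<phi>x: "(\<lambda>\<omega>. \<phi> \<omega> x) \<in> borel_measurable M" if "x \<in> space m" for x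
    using that by measurable
  note [measurable] = \<phi>x[OF y]
  have sq: "integrable M (\<lambda>\<omega>. (\<phi> \<omega> y)\<^sup>2)"
    by (rule gaussian_weight_one_square_integrable[OF g y \<phi>x[OF y]])
  have "integrable M (\<lambda>\<omega>. cos (a * \<phi> \<omega> y))"
    by (rule integrable_const_bound[where B = 1]) auto
  then show "integrable M (\<lambda>\<omega>. exp (a\<^sup>2 * b / 2) * cos (a * \<phi> \<omega> y) - 1 - a\<^sup>2 * b / 2 + a\<^sup>2 * (\<phi> \<omega> y)\<^sup>2 / 2)"
    using sq by auto
  fix xs \<nu> assume \<nu>: "0 \<le> (\<nu>::real)" and xs: "set xs \<subseteq> space m"
  obtain Z K' where "gaussian_weight M (space m) \<phi> (\<lambda>\<omega>. \<Prod>x\<leftarrow>xs. exp (- (\<nu> * (\<phi> \<omega> x)\<^sup>2))) Z K'"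
    using gaussian_weight_list[OF g xs \<nu> \<phi>x] by auto
  then show "0 \<le> (\<integral>\<omega>. (\<Prod>x\<leftarrow>xs. exp (- (\<nu> * (\<phi> \<omega> x)\<^sup>2))) *
     (exp (a\<^sup>2 * b / 2) * cos (a * \<phi> \<omega> y) - 1 - a\<^sup>2 * b / 2 + a\<^sup>2 * (\<phi> \<omega> y)\<^sup>2 / 2) \<partial>M)"
    using \<nu> xs \<phi>x
    by (intro gaussian_weight_cos_ge[where \<phi> = \<phi> and y = y and S = "space m"] y sq prod_list_exp_bounds prod_list_exp_measurable) auto
qed

section \<open>The sine-Gordon representation\<close>

definition circle_measure :: "real measure" where
  "circle_measure = uniform_measure lborel {0..2 * pi}"

lemma sets_circle_measure [measurable_cong]: "sets circle_measure = sets borel"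
  by (simp add: circle_measure_def)

lemma space_circle_measure [simp]: "space circle_measure = UNIV"
  by (simp add: circle_measure_def)

lemma prob_space_circle_measure: "prob_space circle_measure"
  unfolding circle_measure_def by (rule prob_space_uniform_measure) auto

lemma integral_circle_measure:
  fixes f :: "real \<Rightarrow> 'a::{banach, second_countable_topology}"
  assumes [measurable]: "f \<in> borel_measurable borel"
  shows "(\<integral>\<theta>. f \<theta> \<partial>circle_measure) = (1 / (2 * pi)) *\<^sub>R (LINT \<theta>:{0..2 * pi}|lborel. f \<theta>)"
proof -
  have eq: "circle_measure = density lborel (\<lambda>x. ennreal (indicator {0..2 * pi} x / (2 * pi)))"
    unfolding circle_measure_def uniform_measure_def
    by (intro density_cong) (auto simp: indicator_def divide_ennreal simp flip: ennreal_1)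
  have "(\<integral>\<theta>. f \<theta> \<partial>circle_measure)
      = (\<integral>\<theta>. (indicator {0..2 * pi} \<theta> / (2 * pi)) *\<^sub>R f \<theta> \<partial>lborel)"
    unfolding eq by (subst integral_density) auto
  also have "\<dots> = (\<integral>\<theta>. (1 / (2 * pi)) *\<^sub>R (indicator {0..2 * pi} \<theta> *\<^sub>R f \<theta>) \<partial>lborel)"
    by (intro Bochner_Integration.integral_cong refl) simp
  also have "\<dots> = (1 / (2 * pi)) *\<^sub>R (\<integral>\<theta>. indicator {0..2 * pi} \<theta> *\<^sub>R f \<theta> \<partial>lborel)"
    by (rule integral_scaleR_right)
  finally show ?thesis unfolding set_lebesgue_integral_def .
qed

lemma integral_circle_measure_cis:
  "(\<integral>\<theta>. cis (of_int k * \<theta>) \<partial>circle_measure) = (if k = 0 then 1 else 0)"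
proof (cases "k = 0")
  case True
  interpret prob_space circle_measure by (rule prob_space_circle_measure)
  show ?thesis using True prob_space by (simp del: space_circle_measure)
next
  case False
  let ?F = "\<lambda>\<theta>. cis (of_int k * \<theta>) / (\<i> * of_int k)"
  have "(LINT \<theta>:{0..2 * pi}|lborel. cis (of_int k * \<theta>)) = ?F (2 * pi) - ?F 0"
    unfolding set_lebesgue_integral_def
  proof (rule integral_FTC_atLeastAtMost)
    fix \<theta> :: real
    have "((\<lambda>\<theta>. exp (\<i> * of_int k * of_real \<theta>) / (\<i> * of_int k))
          has_vector_derivative exp (\<i> * of_int k * of_real \<theta>)) (at \<theta> within {0..2 * pi})"
      using False by (auto intro!: derivative_eq_intros has_vector_derivative_real_field)
    then show "(?F has_vector_derivative cis (of_int k * \<theta>)) (at \<theta> within {0..2 * pi})"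
      by (simp add: cis_conv_exp mult_ac)
  qed (auto intro!: continuous_intros)
  also have "cis (of_int k * (2 * pi)) = 1"
    by (metis cis_multiple_2pi Ints_of_int mult.commute mult.assoc)
  finally have "(LINT \<theta>:{0..2 * pi}|lborel. cis (of_int k * \<theta>)) = 0" by simp
  then show ?thesis using False by (subst integral_circle_measure) auto
qed

text \<open>Used twice: with \<open>Y = 1\<close> it turns the mean of \<open>exp W\<close> into the
  grand canonical series of moments, and with a Fourier mode for \<open>Y\<close> it expands the
  Fourier coefficients of \<open>weight\<close>.\<close>

lemma (in finite_measure) sums_integral_exp_bounded:
  fixes Y :: "'a \<Rightarrow> 'b::{banach, second_countable_topology}" and X :: "'a \<Rightarrow> real"
  assumes [measurable]: "X \<in> borel_measurable M" and X: "\<And>\<omega>. \<omega> \<in> space M \<Longrightarrow> \<bar>X \<omega>\<bar> \<le> C"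
    and Y: "integrable M Y"
  shows "(\<lambda>n. \<integral>\<omega>. (X \<omega> ^ n / fact n) *\<^sub>R Y \<omega> \<partial>M) sums (\<integral>\<omega>. exp (X \<omega>) *\<^sub>R Y \<omega> \<partial>M)"
proof -
  have [measurable]: "Y \<in> borel_measurable M" using Y by simp
  have pw: "\<bar>X \<omega> ^ n / fact n\<bar> \<le> C ^ n / fact n" if "\<omega> \<in> space M" for \<omega> n
    using X[OF that] by (auto simp: power_abs intro!: divide_right_mono power_mono)
  have int: "integrable M (\<lambda>\<omega>. (X \<omega> ^ n / fact n) *\<^sub>R Y \<omega>)" for n
  proof (rule Bochner_Integration.integrable_bound)
    show "integrable M (\<lambda>\<omega>. (C ^ n / fact n) *\<^sub>R Y \<omega>)" using Y by simp
    show "AE \<omega> in M. norm ((X \<omega> ^ n / fact n) *\<^sub>R Y \<omega>) \<le> norm ((C ^ n / fact n) *\<^sub>R Y \<omega>)"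
      using pw by (intro AE_I2) (force intro!: mult_right_mono simp del: abs_divide intro: order_trans[OF _ abs_ge_self])
  qed measurable
  have summ: "summable (\<lambda>n. x ^ n / fact n)" for x :: real
    using summable_exp[of x] by (simp add: divide_inverse mult.commute)
  have "(\<lambda>n. \<integral>\<omega>. (X \<omega> ^ n / fact n) *\<^sub>R Y \<omega> \<partial>M) sums (\<integral>\<omega>. (\<Sum>n. (X \<omega> ^ n / fact n) *\<^sub>R Y \<omega>) \<partial>M)"
  proof (rule sums_integral[OF int])
    show "AE \<omega> in M. summable (\<lambda>n. norm ((X \<omega> ^ n / fact n) *\<^sub>R Y \<omega>))"
    proof (rule AE_I2)
      show "summable (\<lambda>n. norm ((X \<omega> ^ n / fact n) *\<^sub>R Y \<omega>))" for \<omega>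
        using summable_mult2[OF summ[of "\<bar>X \<omega>\<bar>"], where c = "norm (Y \<omega>)"] by (simp add: power_abs)
    qed
    show "summable (\<lambda>n. \<integral>\<omega>. norm ((X \<omega> ^ n / fact n) *\<^sub>R Y \<omega>) \<partial>M)"
    proof (rule summable_comparison_test')
      show "summable (\<lambda>n. C ^ n / fact n * (\<integral>\<omega>. norm (Y \<omega>) \<partial>M))" by (intro summable_mult2 summ)
      fix n :: nat
      have "(\<integral>\<omega>. norm ((X \<omega> ^ n / fact n) *\<^sub>R Y \<omega>) \<partial>M) \<le> (\<integral>\<omega>. C ^ n / fact n * norm (Y \<omega>) \<partial>M)"
      proof (rule integral_mono)
        show "norm ((X \<omega> ^ n / fact n) *\<^sub>R Y \<omega>) \<le> C ^ n / fact n * norm (Y \<omega>)" if "\<omega> \<in> space M" for \<omega>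
          using mult_right_mono[OF pw[OF that], of "norm (Y \<omega>)"] by simp
      qed (use Y in \<open>auto intro!: integrable_norm[OF int] simp del: norm_scaleR\<close>)
      then show "norm (\<integral>\<omega>. norm ((X \<omega> ^ n / fact n) *\<^sub>R Y \<omega>) \<partial>M) \<le> C ^ n / fact n * (\<integral>\<omega>. norm (Y \<omega>) \<partial>M)"
        by (simp del: norm_scaleR)
    qed
  qed
  also have "(\<lambda>\<omega>. \<Sum>n. (X \<omega> ^ n / fact n) *\<^sub>R Y \<omega>) = (\<lambda>\<omega>. exp (X \<omega>) *\<^sub>R Y \<omega>)"
  proof
    fix \<omega>
    have "(\<Sum>n. (X \<omega> ^ n / fact n) *\<^sub>R Y \<omega>) = (\<Sum>n. X \<omega> ^ n / fact n) *\<^sub>R Y \<omega>"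
      by (rule suminf_scaleR_left[symmetric, OF summ])
    also have "(\<Sum>n. X \<omega> ^ n / fact n) = exp (X \<omega>)"
      by (simp add: exp_def divide_inverse mult.commute)
    finally show "(\<Sum>n. (X \<omega> ^ n / fact n) *\<^sub>R Y \<omega>) = exp (X \<omega>) *\<^sub>R Y \<omega>" .
  qed
  finally show ?thesis .
qed

text \<open>The hypothesis says that the signed measure with masses \<open>p \<alpha>\<close> at
  \<open>x \<alpha>\<close> has no odd moments. Multiplying by the even function
  \<open>exp (b x\<^sup>2)\<close>, which is the shape of the self-energy factor in the activities,
  preserves this, and \<open>sin\<close> is a series in odd powers.\<close>

lemma sum_exp_square_sin_eq_0:
  fixes p x :: "'a \<Rightarrow> real"
  assumes odd: "\<And>n::nat. (\<Sum>\<alpha>\<in>A. p \<alpha> * x \<alpha> ^ (2 * n + 1)) = 0"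
  shows "(\<Sum>\<alpha>\<in>A. p \<alpha> * exp (b * (x \<alpha>)\<^sup>2) * sin (t * x \<alpha>)) = 0"
proof -
  have step: "(\<Sum>\<alpha>\<in>A. p \<alpha> * exp (b * (x \<alpha>)\<^sup>2) * x \<alpha> ^ (2 * k + 1)) = 0" for k
  proof -
    have "(\<lambda>m. \<Sum>\<alpha>\<in>A. p \<alpha> * x \<alpha> ^ (2 * k + 1) * ((b * (x \<alpha>)\<^sup>2) ^ m /\<^sub>R fact m))
        sums (\<Sum>\<alpha>\<in>A. p \<alpha> * x \<alpha> ^ (2 * k + 1) * exp (b * (x \<alpha>)\<^sup>2))"
      by (intro sums_sum sums_mult exp_converges)
    also have "(\<lambda>m. \<Sum>\<alpha>\<in>A. p \<alpha> * x \<alpha> ^ (2 * k + 1) * ((b * (x \<alpha>)\<^sup>2) ^ m /\<^sub>R fact m)) = (\<lambda>m. 0)"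
    proof
      fix m
      have "(\<Sum>\<alpha>\<in>A. p \<alpha> * x \<alpha> ^ (2 * k + 1) * ((b * (x \<alpha>)\<^sup>2) ^ m /\<^sub>R fact m))
          = (\<Sum>\<alpha>\<in>A. b ^ m / fact m * (p \<alpha> * x \<alpha> ^ (2 * (k + m) + 1)))"
        by (intro sum.cong refl) (simp add: power_mult_distrib power_add divide_inverse mult_ac flip: power_mult)
      also have "\<dots> = 0" unfolding sum_distrib_left[symmetric] odd by simp
      finally show "(\<Sum>\<alpha>\<in>A. p \<alpha> * x \<alpha> ^ (2 * k + 1) * ((b * (x \<alpha>)\<^sup>2) ^ m /\<^sub>R fact m)) = 0" .
    qed
    finally have "(\<Sum>\<alpha>\<in>A. p \<alpha> * x \<alpha> ^ (2 * k + 1) * exp (b * (x \<alpha>)\<^sup>2)) = 0"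
      using sums_unique2 sums_zero by blast
    then show ?thesis by (simp add: mult_ac)
  qed
  have "(\<lambda>n. \<Sum>\<alpha>\<in>A. p \<alpha> * exp (b * (x \<alpha>)\<^sup>2) * ((- 1) ^ n / fact (2 * n + 1) * (t * x \<alpha>) ^ (2 * n + 1)))
        sums (\<Sum>\<alpha>\<in>A. p \<alpha> * exp (b * (x \<alpha>)\<^sup>2) * sin (t * x \<alpha>))"
    by (intro sums_sum sums_mult sin_paired)
  also have "(\<lambda>n. \<Sum>\<alpha>\<in>A. p \<alpha> * exp (b * (x \<alpha>)\<^sup>2) * ((- 1) ^ n / fact (2 * n + 1) * (t * x \<alpha>) ^ (2 * n + 1))) = (\<lambda>n. 0)"
  proof
    fix n
    have "(\<Sum>\<alpha>\<in>A. p \<alpha> * exp (b * (x \<alpha>)\<^sup>2) * ((- 1) ^ n / fact (2 * n + 1) * (t * x \<alpha>) ^ (2 * n + 1)))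
        = (\<Sum>\<alpha>\<in>A. (- 1) ^ n / fact (2 * n + 1) * t ^ (2 * n + 1) * (p \<alpha> * exp (b * (x \<alpha>)\<^sup>2) * x \<alpha> ^ (2 * n + 1)))"
      by (intro sum.cong refl) (simp add: power_mult_distrib mult_ac)
    also have "\<dots> = 0" unfolding sum_distrib_left[symmetric] step by simp
    finally show "(\<Sum>\<alpha>\<in>A. p \<alpha> * exp (b * (x \<alpha>)\<^sup>2) * ((- 1) ^ n / fact (2 * n + 1) * (t * x \<alpha>) ^ (2 * n + 1))) = 0" .
  qed
  finally show ?thesis using sums_unique2 sums_zero by blast
qed

section \<open>Replacing the region by a finite reference measure\<close>

lemma density_PiM_indicator:
  assumes v: "sigma_finite_measure v" and \<Lambda>: "\<Lambda> \<in> sets v" and I: "finite I"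
  shows "PiM I (\<lambda>_. density v (indicator \<Lambda>)) = density (PiM I (\<lambda>_. v)) (\<lambda>x. \<Prod>i\<in>I. indicator \<Lambda> (x i))"
proof -
  interpret v: sigma_finite_measure v by fact
  interpret pv: product_sigma_finite "\<lambda>_::'b. v" ..
  have "sigma_finite_measure (density v (indicator \<Lambda>))"
    using v.sigma_finite_iff_density_finite[of "indicator \<Lambda>"] \<Lambda> by (auto simp: indicator_def)
  then interpret m: product_sigma_finite "\<lambda>_::'b. density v (indicator \<Lambda>)"
    by (simp add: product_sigma_finite_def)
  note [measurable] = \<Lambda> I
  show ?thesis
  proof (rule m.PiM_eqI[OF I, symmetric])
    show "sets (density (PiM I (\<lambda>_. v)) (\<lambda>x. \<Prod>i\<in>I. indicator \<Lambda> (x i))) = sets (PiM I (\<lambda>_. density v (indicator \<Lambda>)))"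
      by (simp cong: sets_PiM_cong)
    fix A :: "'b \<Rightarrow> _" assume "\<And>i. i \<in> I \<Longrightarrow> A i \<in> sets (density v (indicator \<Lambda>))"
    then have A: "\<And>i. i \<in> I \<Longrightarrow> A i \<in> sets v" by simp
    have "emeasure (density (PiM I (\<lambda>_. v)) (\<lambda>x. \<Prod>i\<in>I. indicator \<Lambda> (x i))) (PiE I A)
        = (\<integral>\<^sup>+x. (\<Prod>i\<in>I. indicator \<Lambda> (x i)) * indicator (PiE I A) x \<partial>PiM I (\<lambda>_. v))"
      using A I by (intro emeasure_density) (auto intro!: sets_PiM_I_finite)
    also have "\<dots> = (\<integral>\<^sup>+x. (\<Prod>i\<in>I. indicator \<Lambda> (x i) * indicator (A i) (x i)) \<partial>PiM I (\<lambda>_. v))"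
    proof (intro nn_integral_cong)
      fix x assume "x \<in> space (PiM I (\<lambda>_. v))"
      then have "indicator (PiE I A) x = (\<Prod>i\<in>I. indicator (A i) (x i) :: ennreal)"
        using I by (auto simp: space_PiM indicator_def PiE_iff prod_zero_iff)
      then show "(\<Prod>i\<in>I. indicator \<Lambda> (x i)) * indicator (PiE I A) x = (\<Prod>i\<in>I. indicator \<Lambda> (x i) * indicator (A i) (x i) :: ennreal)"
        by (simp add: prod.distrib)
    qed
    also have "\<dots> = (\<Prod>i\<in>I. \<integral>\<^sup>+x. indicator \<Lambda> x * indicator (A i) x \<partial>v)"
      using A I by (intro pv.product_nn_integral_prod) auto
    also have "\<dots> = (\<Prod>i\<in>I. emeasure (density v (indicator \<Lambda>)) (A i))"
      using A by (intro prod.cong refl) (simp add: emeasure_density)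
    finally show "emeasure (density (PiM I (\<lambda>_. v)) (\<lambda>x. \<Prod>i\<in>I. indicator \<Lambda> (x i))) (PiE I A)
        = (\<Prod>i\<in>I. emeasure (density v (indicator \<Lambda>)) (A i))" .
  qed
qed

lemma Uen_measurable:
  assumes u: "(\<lambda>(x, y). u x y) \<in> borel_measurable (v \<Otimes>\<^sub>M v)"
  shows "Uen ech u n \<alpha> \<in> borel_measurable (PiM {..<n} (\<lambda>_. v))"
  unfolding Uen_def
proof (intro borel_measurable_times borel_measurable_const borel_measurable_sum)
  fix j k assume "j \<in> {..<n}" "k \<in> {..<n}"
  then have "(\<lambda>x. (x j, x k)) \<in> PiM {..<n} (\<lambda>_. v) \<rightarrow>\<^sub>M v \<Otimes>\<^sub>M v" by measurable
  from measurable_compose[OF this u]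
  show "(\<lambda>x. u (x j) (x k)) \<in> borel_measurable (PiM {..<n} (\<lambda>_. v))" by simp
qed

text \<open>Moving the indicators into the measure makes it finite while its space stays that of
  \<open>v\<close>, so a basepoint outside \<open>\<Lambda>\<close> remains admissible.\<close>

lemma Xi_density:
  assumes v: "sigma_finite_measure v" and \<Lambda>: "\<Lambda> \<in> sets v"
    and u: "(\<lambda>(x, y). u x y) \<in> borel_measurable (v \<Otimes>\<^sub>M v)"
  shows "Xi v \<Lambda> ech s z u \<beta> u0 = Xi (density v (indicator \<Lambda>)) UNIV ech s z u \<beta> u0"
proof -
  note [measurable] = \<Lambda>
  have "(\<integral>\<^sup>+ x. (\<Prod>j<n. indicator \<Lambda> (x j)) *
             ennreal (exp (- \<beta> * Uen ech u n \<alpha> x) * r) \<partial>(PiM {..<n} (\<lambda>_. v)))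
      = (\<integral>\<^sup>+ x. ennreal (exp (- \<beta> * Uen ech u n \<alpha> x) * r) \<partial>(PiM {..<n} (\<lambda>_. density v (indicator \<Lambda>))))"
    for n \<alpha> r
  proof -
    note [measurable] = Uen_measurable[OF u, of ech n \<alpha>]
    show ?thesis
      unfolding density_PiM_indicator[OF v \<Lambda> finite_lessThan]
      by (intro nn_integral_density[symmetric]) measurable
  qed
  then show ?thesis unfolding Xi_def by simp
qed

text \<open>The \<open>W\<close> of the overview when \<open>\<zeta>\<close> contains the
  self-energy factor and \<open>\<Phi>\<close> is the scaled field plus \<open>\<theta>\<close>. For
  \<open>\<zeta>\<close> without that factor and \<open>\<Phi>\<close> constantly
  \<open>\<theta>\<close> it is \<open>W\<^sub>0\<close>.\<close>

definition sine_gordon_energy ::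
    "'x measure \<Rightarrow> (nat \<Rightarrow> real) \<Rightarrow> (nat \<Rightarrow> int) \<Rightarrow> nat \<Rightarrow> ('x \<Rightarrow> real) \<Rightarrow> real" where
  "sine_gordon_energy m \<zeta> q s \<Phi> = (\<Sum>\<alpha>=1..s. \<zeta> \<alpha> * (\<integral>x. cos (of_int (q \<alpha>) * \<Phi> x) \<partial>m))"

lemma abs_sine_gordon_energy_le:
  assumes m: "finite_measure m" and \<zeta>: "\<And>\<alpha>. \<alpha> \<in> {1..s} \<Longrightarrow> 0 \<le> \<zeta> \<alpha>"
  shows "\<bar>sine_gordon_energy m \<zeta> q s \<Phi>\<bar> \<le> measure m (space m) * (\<Sum>\<alpha>=1..s. \<zeta> \<alpha>)"
proof -
  interpret finite_measure m by fact
  have c: "\<bar>\<integral>x. cos (of_int (q \<alpha>) * \<Phi> x) \<partial>m\<bar> \<le> measure m (space m)" for \<alpha>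
  proof (cases "integrable m (\<lambda>x. cos (of_int (q \<alpha>) * \<Phi> x))")
    case True
    have "\<bar>\<integral>x. cos (of_int (q \<alpha>) * \<Phi> x) \<partial>m\<bar> \<le> (\<integral>x. \<bar>cos (of_int (q \<alpha>) * \<Phi> x)\<bar> \<partial>m)"
      by (rule integral_abs_bound)
    also have "\<dots> \<le> (\<integral>x. 1 \<partial>m)" using True by (intro integral_mono) auto
    finally show ?thesis by simp
  qed (simp add: not_integrable_integral_eq)
  have "\<bar>sine_gordon_energy m \<zeta> q s \<Phi>\<bar> \<le> (\<Sum>\<alpha>=1..s. \<bar>\<zeta> \<alpha> * (\<integral>x. cos (of_int (q \<alpha>) * \<Phi> x) \<partial>m)\<bar>)"
    unfolding sine_gordon_energy_def by (rule sum_abs)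
  also have "\<dots> \<le> (\<Sum>\<alpha>=1..s. \<zeta> \<alpha> * measure m (space m))"
    using \<zeta> c by (intro sum_mono) (auto simp: abs_mult intro!: mult_left_mono)
  finally show ?thesis by (simp add: mult.commute flip: sum_distrib_right)
qed

text \<open>The circle variable \<open>\<theta>\<close> projects onto neutral configurations, and charge symmetry makes
  the energy real.\<close>

lemma Xi_eq_sine_gordon:
  fixes m :: "'x measure" and u :: "'x \<Rightarrow> 'x \<Rightarrow> real"
    and \<beta> e u0 c :: real and s :: nat and z :: "nat \<Rightarrow> real" and q :: "nat \<Rightarrow> int"
    and x0 :: 'x and P :: "'w measure" and \<psi> :: "'w \<Rightarrow> 'x \<Rightarrow> real"
  defines "\<Phi> \<equiv> \<lambda>\<omega> \<theta> x. sqrt \<beta> * e * (\<psi> \<omega> x - \<psi> \<omega> x0) + \<theta>"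
    and "\<zeta> \<equiv> \<lambda>\<alpha>. exp (\<beta> * (e * of_int (q \<alpha>))\<^sup>2 * u0 / 2) * (exp (e * of_int (q \<alpha>) * c) * z \<alpha>)"
  assumes m: "finite_measure m" and P: "prob_space P"
    and u_meas: "(\<lambda>(x, y). u x y) \<in> borel_measurable (m \<Otimes>\<^sub>M m)"
    and \<beta>: "\<beta> > 0" and e: "e > 0"
    and z: "\<And>\<alpha>. \<alpha> \<in> {1..s} \<Longrightarrow> z \<alpha> > 0"
    and charge_sym: "\<And>n::nat. (\<Sum>\<alpha>=1..s. (e * of_int (q \<alpha>)) ^ (2*n+1)
                        * exp (e * of_int (q \<alpha>) * c) * z \<alpha>) = 0"
    and x0: "x0 \<in> space m"
    and \<psi>_meas: "(\<lambda>(\<omega>, x). \<psi> \<omega> x) \<in> borel_measurable (P \<Otimes>\<^sub>M m)"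
    and gauss: "\<And>n (x::nat \<Rightarrow> 'x) (cc::nat \<Rightarrow> real). (\<And>j. j < n \<Longrightarrow> x j \<in> space m) \<Longrightarrow> (\<Sum>j<n. cc j) = 0 \<Longrightarrow>
                  (LINT \<omega>|P. cis (\<Sum>j<n. cc j * \<psi> \<omega> (x j)))
                    = complex_of_real (exp (- (1/2) * (\<Sum>j<n. \<Sum>k<n. cc j * cc k * u (x j) (x k))))"
  shows "Xi m UNIV (\<lambda>\<alpha>. e * of_int (q \<alpha>)) s z u \<beta> u0
    = ennreal (\<integral>(\<omega>, \<theta>). exp (sine_gordon_energy m \<zeta> q s (\<Phi> \<omega> \<theta>)) \<partial>(P \<Otimes>\<^sub>M circle_measure))"
proof -
  interpret m: finite_measure m by fact
  interpret P: prob_space P by fact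
  interpret T: prob_space circle_measure by (rule prob_space_circle_measure)
  interpret PT: pair_prob_space P circle_measure ..
  define R where "R = P \<Otimes>\<^sub>M circle_measure"
  interpret R: prob_space R unfolding R_def by (rule PT.prob_space_axioms)
  interpret Pm: product_sigma_finite "\<lambda>_::nat. m" ..
  have sets_R [measurable_cong]: "sets R = sets (P \<Otimes>\<^sub>M borel)"
    unfolding R_def by (rule sets_pair_measure_cong) (simp_all add: sets_circle_measure)
  note [measurable] = \<psi>_meas
  have [measurable]: "(\<lambda>\<omega>. \<psi> \<omega> x) \<in> borel_measurable P" if "x \<in> space m" for x
    using that by measurable
  define ech where "ech = (\<lambda>\<alpha>. e * of_int (q \<alpha>))"
  define \<kappa> where "\<kappa> = sqrt \<beta> * e"
  have \<kappa>2: "\<kappa>\<^sup>2 = \<beta> * e\<^sup>2" using \<beta> by (simp add: \<kappa>_def power_mult_distrib)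
  define F where "F r = \<Phi> (fst r) (snd r)" for r
  have F_eq: "F r x = \<kappa> * (\<psi> (fst r) x - \<psi> (fst r) x0) + snd r" for r x
    by (simp add: F_def \<Phi>_def \<kappa>_def)
  have Fm [measurable]: "(\<lambda>(r, x). F r x) \<in> borel_measurable (R \<Otimes>\<^sub>M m)"
    unfolding F_eq using x0 by measurable
  have Fx [measurable]: "F r \<in> borel_measurable m" if "r \<in> space R" for r
    using that by measurable
  have \<zeta>_nn: "0 \<le> \<zeta> \<alpha>" if "\<alpha> \<in> {1..s}" for \<alpha> using z[OF that] by (simp add: \<zeta>_def)
  define W where "W r = sine_gordon_energy m \<zeta> q s (F r)" for r
  have Wm [measurable]: "W \<in> borel_measurable R"
    unfolding W_def sine_gordon_energy_def by measurable
  define C where "C = measure m (space m) * (\<Sum>\<alpha>=1..s. \<zeta> \<alpha>)"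
  have WC: "\<bar>W r\<bar> \<le> C" for r
    unfolding W_def C_def by (rule abs_sine_gordon_energy_le[OF m \<zeta>_nn])
  have sin0: "(\<Sum>\<alpha>=1..s. \<zeta> \<alpha> * sin (of_int (q \<alpha>) * t)) = 0" for t
  proof -
    have "(\<Sum>\<alpha>=1..s. (exp (ech \<alpha> * c) * z \<alpha>) * exp (\<beta> * u0 / 2 * (ech \<alpha>)\<^sup>2) * sin (t / e * ech \<alpha>)) = 0"
      using charge_sym by (intro sum_exp_square_sin_eq_0) (simp add: ech_def mult_ac)
    then show ?thesis using e by (simp add: \<zeta>_def ech_def mult_ac)
  qed
  have int_cis: "integrable m (\<lambda>x. cis (of_int k * F r x))" if "r \<in> space R" for r and k :: int
    using that by (intro m.integrable_const_bound[where B = 1]) auto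
  \<comment> \<open>Charge symmetry removes the total sine, so \<open>cos\<close> may be replaced by
    \<open>cis\<close>; powers of the energy then expand into pure exponentials, whose means are
    characteristic functions.\<close>
  have W_cis: "complex_of_real (W r) = (\<Sum>\<alpha>=1..s. complex_of_real (\<zeta> \<alpha>) * (\<integral>x. cis (of_int (q \<alpha>) * F r x) \<partial>m))"
    if r: "r \<in> space R" for r
  proof (rule complex_eqI)
    have re: "Re (\<integral>x. cis (of_int k * F r x) \<partial>m) = (\<integral>x. cos (of_int k * F r x) \<partial>m)" for k :: int
      using integral_Re[OF int_cis[OF r, of k]] by simp
    have im: "Im (\<integral>x. cis (of_int k * F r x) \<partial>m) = (\<integral>x. sin (of_int k * F r x) \<partial>m)" for k :: int
      using integral_Im[OF int_cis[OF r, of k]] by simp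
    show "Re (complex_of_real (W r)) = Re (\<Sum>\<alpha>=1..s. complex_of_real (\<zeta> \<alpha>) * (\<integral>x. cis (of_int (q \<alpha>) * F r x) \<partial>m))"
      by (simp add: re W_def sine_gordon_energy_def)
    have "(\<Sum>\<alpha>=1..s. \<zeta> \<alpha> * (\<integral>x. sin (of_int (q \<alpha>) * F r x) \<partial>m))
        = (\<integral>x. (\<Sum>\<alpha>=1..s. \<zeta> \<alpha> * sin (of_int (q \<alpha>) * F r x)) \<partial>m)"
      using integrable_Im[OF int_cis[OF r]] by (subst Bochner_Integration.integral_sum) auto
    also have "\<dots> = 0" by (simp only: sin0) simp
    finally show "Im (complex_of_real (W r)) = Im (\<Sum>\<alpha>=1..s. complex_of_real (\<zeta> \<alpha>) * (\<integral>x. cis (of_int (q \<alpha>) * F r x) \<partial>m))"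
      by (simp add: im)
  qed
  define E where "E n \<alpha> = (\<integral>x. exp (- \<beta> * Uen ech u n \<alpha> x) \<partial>PiM {..<n} (\<lambda>_. m))" for n \<alpha>
  have Pm_fin: "finite_measure (PiM {..<n} (\<lambda>_. m))" for n :: nat
  proof
    interpret finite_product_sigma_finite "\<lambda>_::nat. m" "{..<n}" by standard simp
    show "emeasure (PiM {..<n} (\<lambda>_. m)) (space (PiM {..<n} (\<lambda>_. m))) \<noteq> \<infinity>"
      by (simp add: space_PiM measure_times m.emeasure_eq_measure ennreal_power)
  qed
  \<comment> \<open>The integral over \<open>\<theta>\<close> vanishes unless the total charge is 0.
    In the neutral case the basepoint value cancels and the Gaussian hypothesis gives the Boltzmann
    factor.\<close>
  have charfun: "(\<integral>r. cis (\<Sum>j<n. of_int (q (\<alpha> j)) * F r (x j)) \<partial>R)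
      = (if (\<Sum>j<n. q (\<alpha> j)) = 0 then complex_of_real (exp (- \<beta> * Uen ech u n \<alpha> x)) else 0)"
    if x: "\<And>j. j < n \<Longrightarrow> x j \<in> space m" for n \<alpha> x
  proof -
    let ?Q = "\<Sum>j<n. q (\<alpha> j)"
    let ?S = "\<lambda>\<omega>. \<Sum>j<n. of_int (q (\<alpha> j)) * (\<psi> \<omega> (x j) - \<psi> \<omega> x0)"
    have Sm [measurable]: "?S \<in> borel_measurable P"
      using x x0 by (intro borel_measurable_sum) auto
    have eq: "(\<Sum>j<n. of_int (q (\<alpha> j)) * F (\<omega>, \<theta>) (x j)) = \<kappa> * ?S \<omega> + of_int ?Q * \<theta>" for \<omega> \<theta>
      by (simp add: F_eq distrib_left sum.distrib sum_distrib_left sum_distrib_right mult_ac)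
    have "(\<integral>r. cis (\<Sum>j<n. of_int (q (\<alpha> j)) * F r (x j)) \<partial>R)
        = (\<integral>r. (case r of (\<omega>, \<theta>) \<Rightarrow> cis (\<kappa> * ?S \<omega>) * cis (of_int ?Q * \<theta>)) \<partial>(P \<Otimes>\<^sub>M circle_measure))"
      unfolding R_def
      by (intro Bochner_Integration.integral_cong refl) (auto simp: eq cis_mult simp del: of_int_sum)
    also have "\<dots> = (\<integral>\<omega>. (\<integral>\<theta>. cis (\<kappa> * ?S \<omega>) * cis (of_int ?Q * \<theta>) \<partial>circle_measure) \<partial>P)"
      by (rule PT.integral_fst[symmetric], rule PT.integrable_const_bound[where B = 1])
        (auto simp: norm_mult simp del: of_int_sum)
    also have "\<dots> = (\<integral>\<omega>. cis (\<kappa> * ?S \<omega>) \<partial>P) * (if ?Q = 0 then 1 else 0)"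
      by (simp add: integral_circle_measure_cis del: of_int_sum)
    also have "\<dots> = (if ?Q = 0 then complex_of_real (exp (- \<beta> * Uen ech u n \<alpha> x)) else 0)"
    proof (cases "?Q = 0")
      case True
      then have Q: "(\<Sum>j<n. of_int (q (\<alpha> j)) :: real) = 0" by (metis of_int_0 of_int_sum)
      have "\<kappa> * ?S \<omega> = (\<Sum>j<n. \<kappa> * of_int (q (\<alpha> j)) * \<psi> \<omega> (x j)) - \<kappa> * \<psi> \<omega> x0 * (\<Sum>j<n. of_int (q (\<alpha> j)))" for \<omega>
        by (simp add: right_diff_distrib sum_subtractf sum_distrib_left mult_ac)
      then have S: "\<kappa> * ?S \<omega> = (\<Sum>j<n. \<kappa> * of_int (q (\<alpha> j)) * \<psi> \<omega> (x j))" for \<omega>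
        using Q by simp
      have "(\<integral>\<omega>. cis (\<kappa> * ?S \<omega>) \<partial>P)
          = complex_of_real (exp (- (1/2) * (\<Sum>j<n. \<Sum>k<n. (\<kappa> * of_int (q (\<alpha> j))) * (\<kappa> * of_int (q (\<alpha> k))) * u (x j) (x k))))"
        unfolding S using x Q by (intro gauss) (auto simp flip: sum_distrib_left)
      also have "(\<Sum>j<n. \<Sum>k<n. (\<kappa> * of_int (q (\<alpha> j))) * (\<kappa> * of_int (q (\<alpha> k))) * u (x j) (x k))
          = \<kappa>\<^sup>2 * (\<Sum>j<n. \<Sum>k<n. of_int (q (\<alpha> j)) * of_int (q (\<alpha> k)) * u (x j) (x k))"
        by (simp add: sum_distrib_left power2_eq_square mult_ac)
      also have "- (1/2) * \<dots> = - \<beta> * Uen ech u n \<alpha> x"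
        unfolding Uen_def ech_def \<kappa>2 by (simp add: sum_distrib_left power2_eq_square mult_ac)
      finally show ?thesis using True by simp
    qed simp
    finally show ?thesis .
  qed
  have space_Pm: "x j \<in> space m" if "x \<in> space (PiM {..<n} (\<lambda>_. m))" "j < n" for x j and n :: nat
    using that by (auto simp: space_PiM PiE_iff)
  have neutral: "\<alpha> \<in> neutral_configs ech s n \<longleftrightarrow> \<alpha> \<in> {..<n} \<rightarrow>\<^sub>E {1..s} \<and> (\<Sum>j<n. q (\<alpha> j)) = 0" for \<alpha> n
  proof -
    have "(\<Sum>j<n. ech (\<alpha> j)) = e * of_int (\<Sum>j<n. q (\<alpha> j))"
      by (simp add: ech_def sum_distrib_left)
    then show ?thesis unfolding neutral_configs_def using e by (simp del: of_int_sum)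
  qed
  have fin: "finite ({..<n} \<rightarrow>\<^sub>E {1..s})" for n :: nat by (intro finite_PiE) auto
  have Em: "(\<lambda>x. exp (- \<beta> * Uen ech u n \<alpha> x)) \<in> borel_measurable (PiM {..<n} (\<lambda>_. m))" for n \<alpha>
    using Uen_measurable[OF u_meas, of ech n \<alpha>] by measurable
  \<comment> \<open>For neutral charges the Boltzmann factor is the modulus of a mean of unit
    complex numbers. This makes it integrable over the finite product measure.\<close>
  have E_le: "exp (- \<beta> * Uen ech u n \<alpha> x) \<le> 1"
    if \<alpha>: "\<alpha> \<in> neutral_configs ech s n" and x: "x \<in> space (PiM {..<n} (\<lambda>_. m))" for n \<alpha> x
  proof -
    have "exp (- \<beta> * Uen ech u n \<alpha> x) = norm (\<integral>r. cis (\<Sum>j<n. of_int (q (\<alpha> j)) * F r (x j)) \<partial>R)"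
      using charfun[of n x \<alpha>] space_Pm[OF x] \<alpha> by (simp add: neutral)
    also have "\<dots> \<le> (\<integral>r. norm (cis (\<Sum>j<n. of_int (q (\<alpha> j)) * F r (x j))) \<partial>R)"
      by (rule integral_norm_bound)
    also have "\<dots> = 1" using R.prob_space by simp
    finally show ?thesis .
  qed
  have E_int: "integrable (PiM {..<n} (\<lambda>_. m)) (\<lambda>x. exp (- \<beta> * Uen ech u n \<alpha> x))"
    if "\<alpha> \<in> neutral_configs ech s n" for n \<alpha>
    using E_le[OF that] Em
    by (intro finite_measure.integrable_const_bound[OF Pm_fin, where B = 1] AE_I2) auto
  have prod_cis: "(\<integral>r. (\<Prod>j<n. \<integral>x. cis (of_int (q (\<alpha> j)) * F r x) \<partial>m) \<partial>R)
      = (if (\<Sum>j<n. q (\<alpha> j)) = 0 then complex_of_real (E n \<alpha>) else 0)" for n \<alpha>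
  proof -
    interpret PM: finite_measure "PiM {..<n} (\<lambda>_. m)" by (rule Pm_fin)
    interpret RP: pair_sigma_finite R "PiM {..<n} (\<lambda>_. m)" ..
    have Fj: "(\<lambda>p. F (fst p) (snd p j)) \<in> borel_measurable (R \<Otimes>\<^sub>M PiM {..<n} (\<lambda>_. m))" if "j \<in> {..<n}" for j
    proof -
      have "(\<lambda>p. (fst p, snd p j)) \<in> R \<Otimes>\<^sub>M PiM {..<n} (\<lambda>_. m) \<rightarrow>\<^sub>M R \<Otimes>\<^sub>M m"
        using that by measurable
      from measurable_compose[OF this Fm] show ?thesis by simp
    qed
    have sumF [measurable]: "(\<lambda>p. \<Sum>j<n. of_int (q (\<alpha> j)) * F (fst p) (snd p j)) \<in> borel_measurable (R \<Otimes>\<^sub>M PiM {..<n} (\<lambda>_. m))"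
      using Fj by (intro borel_measurable_sum borel_measurable_times) auto
    have int: "integrable (R \<Otimes>\<^sub>M PiM {..<n} (\<lambda>_. m)) (\<lambda>(r, x). cis (\<Sum>j<n. of_int (q (\<alpha> j)) * F r (x j)))"
      by (rule finite_measure.integrable_const_bound[where B = 1])
        (auto intro!: finite_measure_pair_measure R.finite_measure_axioms PM.finite_measure_axioms
              simp: split_beta')
    have "(\<integral>r. (\<Prod>j<n. \<integral>x. cis (of_int (q (\<alpha> j)) * F r x) \<partial>m) \<partial>R)
        = (\<integral>r. (\<integral>x. cis (\<Sum>j<n. of_int (q (\<alpha> j)) * F r (x j)) \<partial>PiM {..<n} (\<lambda>_. m)) \<partial>R)"
    proof (intro Bochner_Integration.integral_cong refl)
      fix r assume r: "r \<in> space R"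
      have "(\<integral>x. (\<Prod>j<n. cis (of_int (q (\<alpha> j)) * F r (x j))) \<partial>PiM {..<n} (\<lambda>_. m))
          = (\<Prod>j<n. \<integral>x. cis (of_int (q (\<alpha> j)) * F r x) \<partial>m)"
        by (rule Pm.product_integral_prod[where f = "\<lambda>j x. cis (of_int (q (\<alpha> j)) * F r x)"]) (auto intro: int_cis r)
      moreover have "(\<Prod>j<n. cis (of_int (q (\<alpha> j)) * F r (x j))) = cis (\<Sum>j<n. of_int (q (\<alpha> j)) * F r (x j))" for x
        by (induction n) (auto simp: cis_mult)
      ultimately show "(\<Prod>j<n. \<integral>x. cis (of_int (q (\<alpha> j)) * F r x) \<partial>m)
          = (\<integral>x. cis (\<Sum>j<n. of_int (q (\<alpha> j)) * F r (x j)) \<partial>PiM {..<n} (\<lambda>_. m))" by simp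
    qed
    also have "\<dots> = (\<integral>x. (\<integral>r. cis (\<Sum>j<n. of_int (q (\<alpha> j)) * F r (x j)) \<partial>R) \<partial>PiM {..<n} (\<lambda>_. m))"
      by (rule RP.Fubini_integral[OF int, symmetric])
    also have "\<dots> = (\<integral>x. (if (\<Sum>j<n. q (\<alpha> j)) = 0 then complex_of_real (exp (- \<beta> * Uen ech u n \<alpha> x)) else 0) \<partial>PiM {..<n} (\<lambda>_. m))"
      by (intro Bochner_Integration.integral_cong refl charfun space_Pm)
    also have "\<dots> = (if (\<Sum>j<n. q (\<alpha> j)) = 0 then complex_of_real (E n \<alpha>) else 0)"
      by (simp add: E_def)
    finally show ?thesis .
  qed
  have prod_int: "integrable R (\<lambda>r. \<Prod>j<n. \<integral>x. cis (of_int (q (\<alpha> j)) * F r x) \<partial>m)" for \<alpha> :: "nat \<Rightarrow> nat" and n :: nat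
  proof (rule R.integrable_const_bound[where B = "measure m (space m) ^ n"])
    have "norm (\<integral>x. cis (of_int (q (\<alpha> j)) * F r x) \<partial>m) \<le> measure m (space m)" for j r
      using integral_norm_bound[of m "\<lambda>x. cis (of_int (q (\<alpha> j)) * F r x)"] by simp
    then have "(\<Prod>j<n. norm (\<integral>x. cis (of_int (q (\<alpha> j)) * F r x) \<partial>m)) \<le> (\<Prod>j<n. measure m (space m))" for r
      by (intro prod_mono) auto
    then show "AE r in R. norm (\<Prod>j<n. \<integral>x. cis (of_int (q (\<alpha> j)) * F r x) \<partial>m) \<le> measure m (space m) ^ n"
      by (simp add: prod_norm)
    show "(\<lambda>r. \<Prod>j<n. \<integral>x. cis (of_int (q (\<alpha> j)) * F r x) \<partial>m) \<in> borel_measurable R"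
      by (intro borel_measurable_prod) measurable
  qed
  \<comment> \<open>The power expands over all assignments of species to \<open>n\<close> particles,
    Fubini exchanges field and positions, and \<open>\<theta>\<close> keeps the neutral assignments:
    the \<open>n\<close>-th moment is \<open>fact n\<close> times the \<open>n\<close>-th term of
    the series.\<close>
  have moment: "(\<integral>r. W r ^ n \<partial>R) = (\<Sum>\<alpha>\<in>neutral_configs ech s n. (\<Prod>j<n. \<zeta> (\<alpha> j)) * E n \<alpha>)" for n
  proof -
    have "complex_of_real (\<integral>r. W r ^ n \<partial>R) = (\<integral>r. complex_of_real (W r) ^ n \<partial>R)"
      by (simp flip: integral_complex_of_real)
    also have "\<dots> = (\<integral>r. (\<Sum>\<alpha>\<in>{..<n} \<rightarrow>\<^sub>E {1..s}. complex_of_real (\<Prod>j<n. \<zeta> (\<alpha> j)) *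
        (\<Prod>j<n. \<integral>x. cis (of_int (q (\<alpha> j)) * F r x) \<partial>m)) \<partial>R)"
    proof (intro Bochner_Integration.integral_cong refl)
      fix r assume r: "r \<in> space R"
      have "complex_of_real (W r) ^ n = (\<Prod>j<n. \<Sum>a\<in>{1..s}. complex_of_real (\<zeta> a) * (\<integral>x. cis (of_int (q a) * F r x) \<partial>m))"
        by (simp add: W_cis[OF r])
      also have "\<dots> = (\<Sum>\<alpha>\<in>{..<n} \<rightarrow>\<^sub>E {1..s}. \<Prod>j<n. complex_of_real (\<zeta> (\<alpha> j)) * (\<integral>x. cis (of_int (q (\<alpha> j)) * F r x) \<partial>m))"
        by (rule prod_sum_PiE) auto
      finally show "complex_of_real (W r) ^ n = (\<Sum>\<alpha>\<in>{..<n} \<rightarrow>\<^sub>E {1..s}. complex_of_real (\<Prod>j<n. \<zeta> (\<alpha> j)) *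
        (\<Prod>j<n. \<integral>x. cis (of_int (q (\<alpha> j)) * F r x) \<partial>m))"
        by (simp add: prod.distrib)
    qed
    also have "\<dots> = (\<Sum>\<alpha>\<in>{..<n} \<rightarrow>\<^sub>E {1..s}. complex_of_real (\<Prod>j<n. \<zeta> (\<alpha> j)) *
        (if (\<Sum>j<n. q (\<alpha> j)) = 0 then complex_of_real (E n \<alpha>) else 0))"
      using prod_int by (subst Bochner_Integration.integral_sum) (auto simp: prod_cis simp del: of_real_prod)
    also have "\<dots> = (\<Sum>\<alpha>\<in>neutral_configs ech s n. complex_of_real ((\<Prod>j<n. \<zeta> (\<alpha> j)) * E n \<alpha>))"
    proof (rule sum.mono_neutral_cong_right[OF fin])
      show "neutral_configs ech s n \<subseteq> {..<n} \<rightarrow>\<^sub>E {1..s}" using neutral by blast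
    qed (simp_all add: neutral)
    finally have "complex_of_real (\<integral>r. W r ^ n \<partial>R) = complex_of_real (\<Sum>\<alpha>\<in>neutral_configs ech s n. (\<Prod>j<n. \<zeta> (\<alpha> j)) * E n \<alpha>)"
      by simp
    then show ?thesis by (simp only: of_real_eq_iff)
  qed
  define a where "a n = (\<Sum>\<alpha>\<in>neutral_configs ech s n. (\<Prod>j<n. \<zeta> (\<alpha> j)) * E n \<alpha>)" for n
  have E_nn: "0 \<le> E n \<alpha>" for n \<alpha> by (simp add: E_def)
  have prod_nn: "0 \<le> (\<Prod>j<n. \<zeta> (\<alpha> j)) * E n \<alpha>" if "\<alpha> \<in> neutral_configs ech s n" for n \<alpha>
    using that \<zeta>_nn E_nn by (intro mult_nonneg_nonneg prod_nonneg) (auto simp: neutral PiE_iff)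
  have a_nn: "0 \<le> a n" for n unfolding a_def by (intro sum_nonneg prod_nn)
  have term_eq: "(\<integral>\<^sup>+ x. (\<Prod>j<n. indicator UNIV (x j)) *
             ennreal (exp (- \<beta> * Uen ech u n \<alpha> x) * (\<Prod>j<n. exp (\<beta> * (ech (\<alpha> j))\<^sup>2 * u0 / 2) * z (\<alpha> j)))
         \<partial>(PiM {..<n} (\<lambda>_. m))) = ennreal ((\<Prod>j<n. \<zeta> (\<alpha> j)) * E n \<alpha>)"
    if \<alpha>: "\<alpha> \<in> neutral_configs ech s n" for n \<alpha>
  proof -
    \<comment> \<open>The tilt by \<open>c\<close> multiplies to \<open>exp\<close> of
      \<open>c\<close> times the total charge, which is 1 here; so \<open>z\<close> and its tilted
      version give the same neutral terms.\<close>
    have "(\<Prod>j<n. exp (e * of_int (q (\<alpha> j)) * c)) = exp (e * c * of_int (\<Sum>j<n. q (\<alpha> j)))"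
      by (simp add: exp_sum[symmetric] sum_distrib_left mult_ac)
    then have "(\<Prod>j<n. exp (e * of_int (q (\<alpha> j)) * c)) = 1" using \<alpha> by (simp add: neutral del: of_int_sum)
    then have \<zeta>_prod: "(\<Prod>j<n. \<zeta> (\<alpha> j)) = (\<Prod>j<n. exp (\<beta> * (ech (\<alpha> j))\<^sup>2 * u0 / 2) * z (\<alpha> j))"
      by (simp add: \<zeta>_def ech_def prod.distrib)
    have nn: "0 \<le> (\<Prod>j<n. \<zeta> (\<alpha> j))"
      using \<alpha> \<zeta>_nn by (intro prod_nonneg) (auto simp: neutral PiE_iff)
    have "(\<integral>\<^sup>+ x. ennreal (exp (- \<beta> * Uen ech u n \<alpha> x) * (\<Prod>j<n. \<zeta> (\<alpha> j))) \<partial>(PiM {..<n} (\<lambda>_. m)))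
        = ennreal (\<integral>x. exp (- \<beta> * Uen ech u n \<alpha> x) * (\<Prod>j<n. \<zeta> (\<alpha> j)) \<partial>(PiM {..<n} (\<lambda>_. m)))"
      using E_int[OF \<alpha>] nn by (intro nn_integral_eq_integral) auto
    then show ?thesis unfolding \<zeta>_prod[symmetric] by (simp add: E_def mult.commute)
  qed
  have "Xi m UNIV ech s z u \<beta> u0 = (\<Sum>n. ennreal (a n / fact n))"
    unfolding Xi_def
  proof (intro suminf_cong)
    fix n :: nat
    have "(\<Sum>\<alpha>\<in>neutral_configs ech s n. \<integral>\<^sup>+ x. (\<Prod>j<n. indicator UNIV (x j)) *
             ennreal (exp (- \<beta> * Uen ech u n \<alpha> x) * (\<Prod>j<n. exp (\<beta> * (ech (\<alpha> j))\<^sup>2 * u0 / 2) * z (\<alpha> j)))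
         \<partial>(PiM {..<n} (\<lambda>_. m))) = (\<Sum>\<alpha>\<in>neutral_configs ech s n. ennreal ((\<Prod>j<n. \<zeta> (\<alpha> j)) * E n \<alpha>))"
      by (rule sum.cong[OF refl term_eq])
    also have "\<dots> = ennreal (a n)" unfolding a_def using prod_nn by (rule sum_ennreal)
    finally show "ennreal (1 / fact n) * (\<Sum>\<alpha>\<in>neutral_configs ech s n. \<integral>\<^sup>+ x. (\<Prod>j<n. indicator UNIV (x j)) *
             ennreal (exp (- \<beta> * Uen ech u n \<alpha> x) * (\<Prod>j<n. exp (\<beta> * (ech (\<alpha> j))\<^sup>2 * u0 / 2) * z (\<alpha> j)))
         \<partial>(PiM {..<n} (\<lambda>_. m))) = ennreal (a n / fact n)"
      using a_nn by (simp flip: ennreal_mult)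
  qed
  also have "\<dots> = ennreal (\<integral>r. exp (W r) \<partial>R)"
  proof (rule suminf_ennreal_eq)
    show "0 \<le> a n / fact n" for n using a_nn by simp
    have "(\<lambda>n. \<integral>r. (W r ^ n / fact n) *\<^sub>R (1::real) \<partial>R) sums (\<integral>r. exp (W r) *\<^sub>R (1::real) \<partial>R)"
      using WC by (intro R.sums_integral_exp_bounded[where C = C]) auto
    then show "(\<lambda>n. a n / fact n) sums (\<integral>r. exp (W r) \<partial>R)"
      by (simp add: moment a_def)
  qed
  finally show ?thesis
    unfolding ech_def R_def W_def F_def by (simp add: split_beta')
qed

section \<open>Nonnegative Fourier coefficients and the mean-field bound\<close>

text \<open>Multiplying by a cosine of frequency \<open>q \<alpha>\<close> averages the Fourier
  coefficients at \<open>k + q \<alpha>\<close> and \<open>k - q \<alpha>\<close>. Real nonnegative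
  coefficients therefore stay so, by induction over all \<open>k\<close> simultaneously.\<close>

lemma integral_circle_power_cos_cis:
  fixes zp :: "nat \<Rightarrow> real" and q :: "nat \<Rightarrow> int" and k :: int
  assumes zp: "\<And>\<alpha>. \<alpha> \<in> {1..s} \<Longrightarrow> 0 \<le> zp \<alpha>"
  defines "A \<equiv> \<lambda>n k. \<integral>\<theta>. (\<Sum>\<alpha>=1..s. zp \<alpha> * cos (of_int (q \<alpha>) * \<theta>)) ^ n *\<^sub>R cis (of_int k * \<theta>) \<partial>circle_measure"
  shows "0 \<le> Re (A n k) \<and> Im (A n k) = 0"
proof (induction n arbitrary: k)
  case 0
  then show ?case by (simp add: A_def integral_circle_measure_cis)
next
  case (Suc n)
  interpret prob_space circle_measure by (rule prob_space_circle_measure)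
  define B where "B \<theta> = (\<Sum>\<alpha>=1..s. zp \<alpha> * cos (of_int (q \<alpha>) * \<theta>))" for \<theta>
  have [measurable]: "B \<in> borel_measurable borel" unfolding B_def by measurable
  have B: "\<bar>B \<theta>\<bar> \<le> (\<Sum>\<alpha>=1..s. zp \<alpha>)" for \<theta>
    unfolding B_def using zp
    by (intro order_trans[OF sum_abs] sum_mono) (auto simp: abs_mult mult_left_le)
  have int: "integrable circle_measure (\<lambda>\<theta>. B \<theta> ^ n *\<^sub>R cis (of_int k * \<theta>))" for k
    using B by (intro integrable_const_bound[where B = "(\<Sum>\<alpha>=1..s. zp \<alpha>) ^ n"] AE_I2)
      (auto simp: power_abs intro!: power_mono)
  have cc: "cos x *\<^sub>R cis y = (cis (y + x) + cis (y - x)) /\<^sub>R 2" for x y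
    by (simp add: complex_eq_iff cos_add cos_diff sin_add sin_diff)
  have "A (Suc n) k = (\<integral>\<theta>. (\<Sum>\<alpha>=1..s. (zp \<alpha> / 2) *\<^sub>R (B \<theta> ^ n *\<^sub>R cis (of_int (k + q \<alpha>) * \<theta>)
      + B \<theta> ^ n *\<^sub>R cis (of_int (k - q \<alpha>) * \<theta>))) \<partial>circle_measure)"
    unfolding A_def
  proof (intro Bochner_Integration.integral_cong refl)
    fix \<theta>
    have "B \<theta> ^ Suc n *\<^sub>R cis (of_int k * \<theta>) = (\<Sum>\<alpha>=1..s. (zp \<alpha> * B \<theta> ^ n) *\<^sub>R (cos (of_int (q \<alpha>) * \<theta>) *\<^sub>R cis (of_int k * \<theta>)))"
      by (simp add: B_def[of \<theta>] sum_distrib_right scaleR_sum_left mult_ac)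
    also have "\<dots> = (\<Sum>\<alpha>=1..s. (zp \<alpha> / 2) *\<^sub>R (B \<theta> ^ n *\<^sub>R cis (of_int (k + q \<alpha>) * \<theta>)
      + B \<theta> ^ n *\<^sub>R cis (of_int (k - q \<alpha>) * \<theta>)))"
      unfolding cc by (intro sum.cong refl) (simp add: scaleR_add_right distrib_right left_diff_distrib)
    finally show "(\<Sum>\<alpha>=1..s. zp \<alpha> * cos (of_int (q \<alpha>) * \<theta>)) ^ Suc n *\<^sub>R cis (of_int k * \<theta>)
      = (\<Sum>\<alpha>=1..s. (zp \<alpha> / 2) *\<^sub>R (B \<theta> ^ n *\<^sub>R cis (of_int (k + q \<alpha>) * \<theta>)
      + B \<theta> ^ n *\<^sub>R cis (of_int (k - q \<alpha>) * \<theta>)))" unfolding B_def .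
  qed
  also have "\<dots> = (\<Sum>\<alpha>=1..s. (zp \<alpha> / 2) *\<^sub>R (A n (k + q \<alpha>) + A n (k - q \<alpha>)))"
    using int unfolding A_def B_def[symmetric]
    by (subst Bochner_Integration.integral_sum) (auto simp del: of_int_add of_int_diff)
  finally show ?case
    using Suc.IH zp by (auto intro!: sum_nonneg mult_nonneg_nonneg)
qed

lemma weight_measurable [measurable]: "weight L zp q s \<in> borel_measurable borel"
  unfolding weight_def by measurable

lemma weight_pos: "0 < weight L zp q s \<theta>"
  by (simp add: weight_def)

lemma weight_le:
  assumes "0 \<le> L" "\<And>\<alpha>. \<alpha> \<in> {1..s} \<Longrightarrow> 0 \<le> zp \<alpha>"
  shows "weight L zp q s \<theta> \<le> exp (L * (\<Sum>\<alpha>=1..s. zp \<alpha>))"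
  unfolding weight_def exp_le_cancel_iff using assms
  by (intro mult_left_mono sum_mono) (auto simp: mult_left_le)

text \<open>All three facts follow from the termwise expansion of the exponential weight: every
  Fourier coefficient of a power of the cosine sum is real and nonnegative. The factor
  \<open>2 * pi\<close> between \<open>circle_measure\<close> and Lebesgue measure cancels in
  \<open>eta_hat\<close>.\<close>

lemma integral_weight_cos_sin:
  fixes k :: int
  assumes L: "0 \<le> L" and zp: "\<And>\<alpha>. \<alpha> \<in> {1..s} \<Longrightarrow> 0 \<le> zp \<alpha>"
  shows "0 \<le> (\<integral>\<theta>. weight L zp q s \<theta> * cos (of_int k * \<theta>) \<partial>circle_measure)"
    and "(\<integral>\<theta>. weight L zp q s \<theta> * sin (of_int k * \<theta>) \<partial>circle_measure) = 0"
    and "Re (eta_hat L zp q s k) = (\<integral>\<theta>. weight L zp q s \<theta> * cos (of_int k * \<theta>) \<partial>circle_measure)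
           / (\<integral>\<theta>. weight L zp q s \<theta> \<partial>circle_measure)"
proof -
  interpret prob_space circle_measure by (rule prob_space_circle_measure)
  define B where "B \<theta> = (\<Sum>\<alpha>=1..s. zp \<alpha> * cos (of_int (q \<alpha>) * \<theta>))" for \<theta>
  have [measurable]: "B \<in> borel_measurable borel" unfolding B_def by measurable
  have B: "\<bar>B \<theta>\<bar> \<le> (\<Sum>\<alpha>=1..s. zp \<alpha>)" for \<theta>
    unfolding B_def using zp
    by (intro order_trans[OF sum_abs] sum_mono) (auto simp: abs_mult mult_left_le)
  have w: "weight L zp q s = (\<lambda>\<theta>. exp (L * B \<theta>))" by (simp add: weight_def B_def fun_eq_iff)
  define G where "G = (\<integral>\<theta>. weight L zp q s \<theta> *\<^sub>R cis (of_int k * \<theta>) \<partial>circle_measure)"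
  have sums: "(\<lambda>n. \<integral>\<theta>. ((L * B \<theta>) ^ n / fact n) *\<^sub>R cis (of_int k * \<theta>) \<partial>circle_measure) sums G"
    unfolding G_def w
  proof (rule sums_integral_exp_bounded)
    show "\<bar>L * B \<theta>\<bar> \<le> L * (\<Sum>\<alpha>=1..s. zp \<alpha>)" for \<theta>
      using L B by (simp add: abs_mult mult_left_mono)
    show "integrable circle_measure (\<lambda>\<theta>. cis (of_int k * \<theta>))"
      by (rule integrable_const_bound[where B = 1]) auto
  qed measurable
  have "(\<integral>\<theta>. ((L * B \<theta>) ^ n / fact n) *\<^sub>R cis (of_int k * \<theta>) \<partial>circle_measure)
      = (L ^ n / fact n) *\<^sub>R (\<integral>\<theta>. B \<theta> ^ n *\<^sub>R cis (of_int k * \<theta>) \<partial>circle_measure)" for n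
    by (subst integral_scaleR_right[symmetric]) (simp add: power_mult_distrib)
  then have terms: "0 \<le> Re (\<integral>\<theta>. ((L * B \<theta>) ^ n / fact n) *\<^sub>R cis (of_int k * \<theta>) \<partial>circle_measure)"
      "Im (\<integral>\<theta>. ((L * B \<theta>) ^ n / fact n) *\<^sub>R cis (of_int k * \<theta>) \<partial>circle_measure) = 0" for n
    using L integral_circle_power_cos_cis[of s zp q n k, OF zp] by (auto simp: B_def)
  have G: "0 \<le> Re G" "Im G = 0"
    using sums_le[OF terms(1) sums_zero] sums unfolding sums_complex_iff terms(2)
    by (auto dest: sums_unique2[OF sums_zero])
  have int: "integrable circle_measure (\<lambda>\<theta>. weight L zp q s \<theta> *\<^sub>R cis (of_int k * \<theta>))"
    using weight_le[OF L zp] less_imp_le[OF weight_pos]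
    by (intro integrable_const_bound[where B = "exp (L * (\<Sum>\<alpha>=1..s. zp \<alpha>))"]) auto
  have re: "Re G = (\<integral>\<theta>. weight L zp q s \<theta> * cos (of_int k * \<theta>) \<partial>circle_measure)"
    using integral_Re[OF int] by (simp add: G_def)
  have im: "Im G = (\<integral>\<theta>. weight L zp q s \<theta> * sin (of_int k * \<theta>) \<partial>circle_measure)"
    using integral_Im[OF int] by (simp add: G_def)
  show "0 \<le> (\<integral>\<theta>. weight L zp q s \<theta> * cos (of_int k * \<theta>) \<partial>circle_measure)"
    and "(\<integral>\<theta>. weight L zp q s \<theta> * sin (of_int k * \<theta>) \<partial>circle_measure) = 0"
    using G re im by simp_all
  have "G = (1 / (2 * pi)) *\<^sub>R (LINT \<theta>:{0..2*pi}|lborel. complex_of_real (weight L zp q s \<theta>) * cis (of_int k * \<theta>))"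
    unfolding G_def by (subst integral_circle_measure) (auto simp: scaleR_conv_of_real)
  moreover have "(\<integral>\<theta>. weight L zp q s \<theta> \<partial>circle_measure) = (1 / (2 * pi)) *\<^sub>R (LINT \<theta>:{0..2*pi}|lborel. weight L zp q s \<theta>)"
    by (rule integral_circle_measure) simp
  ultimately have "eta_hat L zp q s k = G / complex_of_real (\<integral>\<theta>. weight L zp q s \<theta> \<partial>circle_measure)"
    unfolding eta_hat_def by (simp add: scaleR_conv_of_real)
  then show "Re (eta_hat L zp q s k) = (\<integral>\<theta>. weight L zp q s \<theta> * cos (of_int k * \<theta>) \<partial>circle_measure)
           / (\<integral>\<theta>. weight L zp q s \<theta> \<partial>circle_measure)"
    by (simp add: re)
qed

section \<open>The weighted inequality integrated over the region\<close>

lemma exp_neg_mult_le: "exp_neg x * enn2real x \<le> 1"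
proof (cases "x = \<infinity>")
  case False
  have "enn2real x \<le> exp (enn2real x)"
    using exp_ge_add_one_self[of "enn2real x"] by linarith
  then show ?thesis using False by (simp add: exp_neg_def exp_minus field_simps)
qed (simp add: exp_neg_def)

text \<open>Integrating the one-point inequality over the position turns
  \<open>a\<^sup>2 \<phi>\<^sup>2 / 2\<close> into a multiple of the very exponent \<open>J\<close>
  of the weight; this is why \<open>\<mu>\<close> must be positive to divide by.\<close>

lemma (in prob_space) gaussian_exp_neg_energy_ge:
  fixes \<phi> :: "'a \<Rightarrow> 'x \<Rightarrow> real"
  assumes g: "gaussian_weight M (space m) \<phi> (\<lambda>_. 1) 1 K"
    and m: "finite_measure m" and \<mu>: "0 < \<mu>"
    and \<phi>m [measurable]: "(\<lambda>(\<omega>, x). \<phi> \<omega> x) \<in> borel_measurable (M \<Otimes>\<^sub>M m)"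
  defines "J \<equiv> \<lambda>\<omega>. \<integral>\<^sup>+x. ennreal (\<mu> * (\<phi> \<omega> x)\<^sup>2) \<partial>m"
  shows "0 \<le> (\<integral>\<omega>. exp_neg (J \<omega>) * (exp (a\<^sup>2 * b / 2) * (\<integral>x. cos (a * \<phi> \<omega> x) \<partial>m)
      - (1 + a\<^sup>2 * b / 2) * measure m (space m) + a\<^sup>2 / 2 * (enn2real (J \<omega>) / \<mu>)) \<partial>M)"
proof -
  interpret m: finite_measure m by fact
  interpret pair_sigma_finite M m ..
  let ?L = "measure m (space m)"
  define f where "f t = exp (a\<^sup>2 * b / 2) * cos (a * t) - 1 - a\<^sup>2 * b / 2 + a\<^sup>2 * t\<^sup>2 / 2" for t
  have [measurable]: "f \<in> borel_measurable borel" unfolding f_def by measurable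
  have [measurable]: "J \<in> borel_measurable M" unfolding J_def by measurable
  have DJ: "ennreal (exp_neg x) * x \<le> 1" for x
  proof (cases "x = \<infinity>")
    case False
    then have "ennreal (exp_neg x) * x = ennreal (exp_neg x * enn2real x)"
      by (cases x) (auto simp: ennreal_mult exp_neg_bounds)
    then show ?thesis using exp_neg_mult_le[of x] by (simp add: ennreal_le_1)
  qed (simp add: exp_neg_def)
  \<comment> \<open>Fubini needs this control of the square. It comes from the weight: integrating
    over \<open>x\<close> first leaves \<open>exp_neg (J \<omega>) * J \<omega>\<close>, which is at
    most 1.\<close>
  have int_sq: "integrable (M \<Otimes>\<^sub>M m) (\<lambda>(\<omega>, x). exp_neg (J \<omega>) * (\<mu> * (\<phi> \<omega> x)\<^sup>2))"
  proof (rule integrableI_nonneg)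
    show "AE p in M \<Otimes>\<^sub>M m. 0 \<le> (case p of (\<omega>, x) \<Rightarrow> exp_neg (J \<omega>) * (\<mu> * (\<phi> \<omega> x)\<^sup>2))"
      using \<mu> by (intro AE_I2) (auto simp: exp_neg_bounds)
    have "(\<integral>\<^sup>+p. ennreal (case p of (\<omega>, x) \<Rightarrow> exp_neg (J \<omega>) * (\<mu> * (\<phi> \<omega> x)\<^sup>2)) \<partial>(M \<Otimes>\<^sub>M m))
        = (\<integral>\<^sup>+\<omega>. (\<integral>\<^sup>+x. ennreal (exp_neg (J \<omega>)) * ennreal (\<mu> * (\<phi> \<omega> x)\<^sup>2) \<partial>m) \<partial>M)"
      using \<mu> by (subst m.nn_integral_fst[symmetric]) (auto simp: ennreal_mult exp_neg_bounds)
    also have "\<dots> = (\<integral>\<^sup>+\<omega>. ennreal (exp_neg (J \<omega>)) * J \<omega> \<partial>M)"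
      unfolding J_def by (intro nn_integral_cong nn_integral_cmult) measurable
    also have "\<dots> \<le> (\<integral>\<^sup>+\<omega>. 1 \<partial>M)" by (intro nn_integral_mono DJ)
    also have "\<dots> < \<infinity>" by (simp add: emeasure_space_1)
    finally show "(\<integral>\<^sup>+p. ennreal (case p of (\<omega>, x) \<Rightarrow> exp_neg (J \<omega>) * (\<mu> * (\<phi> \<omega> x)\<^sup>2)) \<partial>(M \<Otimes>\<^sub>M m)) < \<infinity>" .
  qed measurable
  have int_bd: "integrable (M \<Otimes>\<^sub>M m) (\<lambda>(\<omega>, x). exp_neg (J \<omega>) * (exp (a\<^sup>2 * b / 2) * cos (a * \<phi> \<omega> x) - 1 - a\<^sup>2 * b / 2))"
  proof (rule finite_measure.integrable_const_bound)
    show "finite_measure (M \<Otimes>\<^sub>M m)" by (intro finite_measure_pair_measure finite_measure_axioms m)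
    show "AE p in M \<Otimes>\<^sub>M m. norm (case p of (\<omega>, x) \<Rightarrow> exp_neg (J \<omega>) * (exp (a\<^sup>2 * b / 2) * cos (a * \<phi> \<omega> x) - 1 - a\<^sup>2 * b / 2))
        \<le> exp (a\<^sup>2 * b / 2) + 1 + \<bar>a\<^sup>2 * b / 2\<bar>"
    proof (intro AE_I2, clarify)
      fix \<omega> x
      have "\<bar>exp (a\<^sup>2 * b / 2) * cos (a * \<phi> \<omega> x)\<bar> \<le> exp (a\<^sup>2 * b / 2)"
        by (simp add: abs_mult mult_left_le)
      then have "\<bar>exp (a\<^sup>2 * b / 2) * cos (a * \<phi> \<omega> x) - 1 - a\<^sup>2 * b / 2\<bar> \<le> exp (a\<^sup>2 * b / 2) + 1 + \<bar>a\<^sup>2 * b / 2\<bar>"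
        by linarith
      then show "norm (exp_neg (J \<omega>) * (exp (a\<^sup>2 * b / 2) * cos (a * \<phi> \<omega> x) - 1 - a\<^sup>2 * b / 2))
          \<le> exp (a\<^sup>2 * b / 2) + 1 + \<bar>a\<^sup>2 * b / 2\<bar>"
        by (rule order_trans[rotated]) (simp add: abs_mult exp_neg_bounds mult_left_le_one_le)
    qed
  qed measurable
  have int: "integrable (M \<Otimes>\<^sub>M m) (\<lambda>(\<omega>, x). exp_neg (J \<omega>) * f (\<phi> \<omega> x))"
  proof -
    have eq: "exp_neg (J \<omega>) * f (\<phi> \<omega> x) = exp_neg (J \<omega>) * (exp (a\<^sup>2 * b / 2) * cos (a * \<phi> \<omega> x) - 1 - a\<^sup>2 * b / 2)
        + a\<^sup>2 / (2 * \<mu>) * (exp_neg (J \<omega>) * (\<mu> * (\<phi> \<omega> x)\<^sup>2))" for \<omega> x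
      using \<mu> by (simp add: f_def field_simps)
    show ?thesis
      unfolding eq using Bochner_Integration.integrable_add[OF int_bd integrable_mult_right[OF int_sq, of "a\<^sup>2 / (2 * \<mu>)"]]
      by (simp add: split_beta')
  qed
  have "0 \<le> (\<integral>x. (\<integral>\<omega>. exp_neg (J \<omega>) * f (\<phi> \<omega> x) \<partial>M) \<partial>m)"
    unfolding J_def f_def using \<mu>
    by (intro Bochner_Integration.integral_nonneg gaussian_exp_neg_cos_ge[OF g m _ \<phi>m]) auto
  also have "\<dots> = (\<integral>\<omega>. (\<integral>x. exp_neg (J \<omega>) * f (\<phi> \<omega> x) \<partial>m) \<partial>M)"
    by (rule Fubini_integral[OF int])
  also have "\<dots> = (\<integral>\<omega>. exp_neg (J \<omega>) * (exp (a\<^sup>2 * b / 2) * (\<integral>x. cos (a * \<phi> \<omega> x) \<partial>m)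
      - (1 + a\<^sup>2 * b / 2) * ?L + a\<^sup>2 / 2 * (enn2real (J \<omega>) / \<mu>)) \<partial>M)"
  proof (intro Bochner_Integration.integral_cong refl)
    fix \<omega> assume \<omega>: "\<omega> \<in> space M"
    then have [measurable]: "\<phi> \<omega> \<in> borel_measurable m" by measurable
    show "(\<integral>x. exp_neg (J \<omega>) * f (\<phi> \<omega> x) \<partial>m) = exp_neg (J \<omega>) * (exp (a\<^sup>2 * b / 2) * (\<integral>x. cos (a * \<phi> \<omega> x) \<partial>m)
      - (1 + a\<^sup>2 * b / 2) * ?L + a\<^sup>2 / 2 * (enn2real (J \<omega>) / \<mu>))"
    \<comment> \<open>For infinite \<open>J\<close> the weight is 0 and kills both sides, whatever
      default values the real integral and \<open>enn2real\<close> take.\<close>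
    proof (cases "J \<omega> = \<infinity>")
      case True
      then show ?thesis by (simp add: exp_neg_def)
    next
      case False
      have "integrable m (\<lambda>x. \<mu> * (\<phi> \<omega> x)\<^sup>2)"
        using False \<mu> by (intro integrableI_nonneg) (auto simp: J_def top.not_eq_extremum)
      moreover from this have "enn2real (J \<omega>) = \<mu> * (\<integral>x. (\<phi> \<omega> x)\<^sup>2 \<partial>m)"
        unfolding J_def using \<mu> by (subst nn_integral_eq_integral) auto
      moreover have "integrable m (\<lambda>x. cos (a * \<phi> \<omega> x))"
        by (rule m.integrable_const_bound[where B = 1]) auto
      ultimately show ?thesis
        using \<mu> by (simp add: f_def algebra_simps)
    qed
  qed
  finally show ?thesis .
qed

text \<open>The ideal gas is the interacting gas with \<open>u = 0\<close> and
  \<open>u0 = 0\<close>, so the sine-Gordon formula applies with the zero field. The probability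
  space of that field is arbitrary; \<open>circle_measure\<close> is reused for it.\<close>

lemma Xi0_eq_integral_weight:
  fixes m :: "'x measure" and e c :: real and z :: "nat \<Rightarrow> real" and q :: "nat \<Rightarrow> int"
  assumes m: "finite_measure m" and e: "e > 0"
    and z: "\<And>\<alpha>. \<alpha> \<in> {1..s} \<Longrightarrow> z \<alpha> > 0"
    and charge_sym: "\<And>n::nat. (\<Sum>\<alpha>=1..s. (e * of_int (q \<alpha>)) ^ (2*n+1)
                        * exp (e * of_int (q \<alpha>) * c) * z \<alpha>) = 0"
    and x0: "x0 \<in> space m"
  shows "Xi0 (measure m (space m)) (\<lambda>\<alpha>. e * of_int (q \<alpha>)) s z
    = ennreal (\<integral>\<theta>. weight (measure m (space m)) (\<lambda>\<alpha>. exp (e * of_int (q \<alpha>) * c) * z \<alpha>) q s \<theta> \<partial>circle_measure)"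
proof -
  interpret m: finite_measure m by fact
  interpret T: prob_space circle_measure by (rule prob_space_circle_measure)
  interpret TT: pair_prob_space circle_measure circle_measure ..
  let ?L = "measure m (space m)"
  let ?w = "weight ?L (\<lambda>\<alpha>. exp (e * of_int (q \<alpha>) * c) * z \<alpha>) q s"
  have pos: "0 \<le> exp (e * of_int (q \<alpha>) * c) * z \<alpha>" if "\<alpha> \<in> {1..s}" for \<alpha>
    using z[OF that] by simp
  have "Xi0 ?L (\<lambda>\<alpha>. e * of_int (q \<alpha>)) s z = Xi m UNIV (\<lambda>\<alpha>. e * of_int (q \<alpha>)) s z (\<lambda>_ _. 0) 1 0"
    unfolding Xi0_def Xi_def
  proof (intro suminf_cong arg_cong2[where f = times] refl sum.cong)
    fix n \<alpha> assume "\<alpha> \<in> neutral_configs (\<lambda>\<alpha>. e * of_int (q \<alpha>)) s n"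
    then have "0 \<le> (\<Prod>j<n. z (\<alpha> j))"
      using z by (intro prod_nonneg) (auto simp: neutral_configs_def PiE_iff intro: less_imp_le)
    moreover have "emeasure (PiM {..<n} (\<lambda>_. m)) (space (PiM {..<n} (\<lambda>_. m))) = ennreal (?L ^ n)"
    proof -
      interpret product_sigma_finite "\<lambda>_::nat. m" ..
      interpret finite_product_sigma_finite "\<lambda>_::nat. m" "{..<n}" by standard simp
      show ?thesis by (simp add: space_PiM measure_times m.emeasure_eq_measure ennreal_power)
    qed
    ultimately show "ennreal (\<Prod>j<n. z (\<alpha> j) * ?L) = (\<integral>\<^sup>+ x. (\<Prod>j<n. indicator UNIV (x j)) *
             ennreal (exp (- 1 * Uen (\<lambda>\<alpha>. e * of_int (q \<alpha>)) (\<lambda>_ _. 0) n \<alpha> x) *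
                      (\<Prod>j<n. exp (1 * (e * of_int (q (\<alpha> j)))\<^sup>2 * 0 / 2) * z (\<alpha> j)))
         \<partial>(PiM {..<n} (\<lambda>_. m)))"
      by (simp add: Uen_def prod.distrib ennreal_mult)
  qed
  also have "\<dots> = ennreal (\<integral>(\<omega>, \<theta>). ?w \<theta> \<partial>(circle_measure \<Otimes>\<^sub>M circle_measure))"
  proof -
    have energy: "exp (sine_gordon_energy m (\<lambda>\<alpha>. exp (1 * (e * of_int (q \<alpha>))\<^sup>2 * 0 / 2) * (exp (e * of_int (q \<alpha>) * c) * z \<alpha>))
        q s (\<lambda>x. sqrt 1 * e * (0 - 0) + \<theta>)) = ?w \<theta>" for \<theta>
      unfolding sine_gordon_energy_def weight_def by (simp add: sum_distrib_left mult_ac)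
    show ?thesis
      unfolding energy[symmetric]
      by (rule Xi_eq_sine_gordon[OF m prob_space_circle_measure _ _ e z charge_sym x0])
        (use T.prob_space in \<open>simp_all del: space_circle_measure\<close>)
  qed
  also have "(\<integral>(\<omega>, \<theta>). ?w \<theta> \<partial>(circle_measure \<Otimes>\<^sub>M circle_measure))
      = (\<integral>\<omega>. (\<integral>\<theta>. ?w \<theta> \<partial>circle_measure) \<partial>circle_measure)"
  proof (intro TT.integral_fst[symmetric] TT.integrable_const_bound AE_I2)
    fix p :: "real \<times> real"
    show "norm (case p of (\<omega>, \<theta>) \<Rightarrow> ?w \<theta>) \<le> exp (?L * (\<Sum>\<alpha>=1..s. exp (e * of_int (q \<alpha>) * c) * z \<alpha>))"
      using weight_le[OF measure_nonneg pos, where \<theta> = "snd p"]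
      by (simp add: split_beta' abs_of_pos[OF weight_pos])
  qed measurable
  also have "\<dots> = (\<integral>\<theta>. ?w \<theta> \<partial>circle_measure)" using T.prob_space by simp
  finally show ?thesis .
qed

text \<open>Subtracting the basepoint value amounts to placing the charge \<open>- t\<close> at
  \<open>x0\<close>, opposite to the total charge \<open>t\<close> of the coefficients. The
  combination is then neutral and the hypothesis applies with one more point.\<close>

lemma gaussian_weight_increments:
  fixes \<psi> :: "'w \<Rightarrow> 'x \<Rightarrow> real"
  assumes x0: "x0 \<in> S"
    and gauss: "\<And>n (x::nat \<Rightarrow> 'x) (cc::nat \<Rightarrow> real). (\<And>j. j < n \<Longrightarrow> x j \<in> S) \<Longrightarrow> (\<Sum>j<n. cc j) = 0 \<Longrightarrow>
                  (LINT \<omega>|P. cis (\<Sum>j<n. cc j * \<psi> \<omega> (x j)))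
                    = complex_of_real (exp (- (1/2) * (\<Sum>j<n. \<Sum>k<n. cc j * cc k * u (x j) (x k))))"
  shows "gaussian_weight P S (\<lambda>\<omega> x. \<psi> \<omega> x - \<psi> \<omega> x0) (\<lambda>_. 1) 1
     (\<lambda>x y. u x y - u x x0 - u x0 y + u x0 x0)"
  unfolding gaussian_weight_def
proof (intro conjI allI impI)
  fix n and x :: "nat \<Rightarrow> 'x" and cc :: "nat \<Rightarrow> real"
  assume x: "\<forall>j<n. x j \<in> S"
  define t where "t = (\<Sum>j<n. cc j)"
  let ?x = "\<lambda>j. if j < n then x j else x0" and ?c = "\<lambda>j. if j < n then cc j else - t"
  have "(LINT \<omega>|P. cis (\<Sum>j<Suc n. ?c j * \<psi> \<omega> (?x j)))
      = complex_of_real (exp (- (1/2) * (\<Sum>j<Suc n. \<Sum>k<Suc n. ?c j * ?c k * u (?x j) (?x k))))"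
    using x x0 by (intro gauss) (auto simp: t_def)
  also have "(\<lambda>\<omega>. \<Sum>j<Suc n. ?c j * \<psi> \<omega> (?x j)) = (\<lambda>\<omega>. \<Sum>j<n. cc j * (\<psi> \<omega> (x j) - \<psi> \<omega> x0))"
    by (simp add: t_def right_diff_distrib sum_subtractf sum_distrib_right)
  also have "(\<Sum>j<Suc n. \<Sum>k<Suc n. ?c j * ?c k * u (?x j) (?x k))
      = (\<Sum>j<n. \<Sum>k<n. cc j * cc k * (u (x j) (x k) - u (x j) x0 - u x0 (x k) + u x0 x0))"
  proof -
    have "(\<Sum>j<Suc n. \<Sum>k<Suc n. ?c j * ?c k * u (?x j) (?x k))
      = (\<Sum>j<n. \<Sum>k<n. cc j * cc k * u (x j) (x k)) - (\<Sum>j<n. cc j * u (x j) x0) * t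
        - t * (\<Sum>k<n. cc k * u x0 (x k)) + t * t * u x0 x0"
      by (simp add: sum.distrib sum_distrib_left sum_distrib_right sum_negf sum_subtractf mult_ac)
    also have "\<dots> = (\<Sum>j<n. \<Sum>k<n. cc j * cc k * (u (x j) (x k) - u (x j) x0 - u x0 (x k) + u x0 x0))"
      unfolding t_def sum_product
      by (simp add: sum_distrib_left sum_distrib_right sum.distrib sum_subtractf algebra_simps)
    finally show ?thesis .
  qed
  finally show "(LINT \<omega>|P. complex_of_real 1 * cis (\<Sum>j<n. cc j * (\<psi> \<omega> (x j) - \<psi> \<omega> x0)))
      = complex_of_real (1 * exp (- (1/2) * (\<Sum>j<n. \<Sum>k<n. cc j * cc k * (u (x j) (x k) - u (x j) x0 - u x0 (x k) + u x0 x0))))"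
    by simp
qed simp

text \<open>Manifold and lattice are treated together as a sigma-finite measure \<open>v\<close>.
  The Gaussian measure modulo constants is represented by a jointly measurable process
  \<open>\<psi>\<close> whose neutral combinations have the prescribed characteristic
  functions.\<close>

theorem theorem1:
  fixes v :: "'x measure" and \<Lambda> :: "'x set" and u :: "'x \<Rightarrow> 'x \<Rightarrow> real"
    and \<beta> e u0 c :: real and s :: nat and z :: "nat \<Rightarrow> real" and q :: "nat \<Rightarrow> int"
    and x0 :: 'x and P :: "'w measure" and \<psi> :: "'w \<Rightarrow> 'x \<Rightarrow> real"
  assumes v_sf: "sigma_finite_measure v"
    and \<Lambda>_meas: "\<Lambda> \<in> sets v" and \<Lambda>_fin: "emeasure v \<Lambda> < \<infinity>"
    and u_sym: "\<forall>x\<in>space v. \<forall>y\<in>space v. u x y = u y x"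
    and u_cpd: "\<forall>n\<ge>2. \<forall>(x::nat \<Rightarrow> 'x) (cc::nat \<Rightarrow> real).
                  (\<forall>j<n. x j \<in> space v) \<longrightarrow> (\<Sum>j<n. cc j) = 0 \<longrightarrow>
                  0 \<le> (\<Sum>j<n. \<Sum>k<n. cc j * cc k * u (x j) (x k))"
    and u_meas: "(\<lambda>(x, y). u x y) \<in> borel_measurable (v \<Otimes>\<^sub>M v)"
    and \<beta>_pos: "\<beta> > 0" and e_pos: "e > 0"
    and z_pos: "\<forall>\<alpha>\<in>{1..s}. z \<alpha> > 0"
    and charge_sym: "\<forall>n::nat. (\<Sum>\<alpha>=1..s. (e * of_int (q \<alpha>)) ^ (2*n+1)
                        * exp (e * of_int (q \<alpha>) * c) * z \<alpha>) = 0"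
    and x0_in: "x0 \<in> space v"
    and P_prob: "prob_space P"
    and \<psi>_meas: "(\<lambda>(\<omega>, x). \<psi> \<omega> x) \<in> borel_measurable (P \<Otimes>\<^sub>M v)"
    and \<psi>_gauss: "\<forall>n (x::nat \<Rightarrow> 'x) (cc::nat \<Rightarrow> real).
                  (\<forall>j<n. x j \<in> space v) \<longrightarrow> (\<Sum>j<n. cc j) = 0 \<longrightarrow>
                  (LINT \<omega>|P. cis (\<Sum>j<n. cc j * \<psi> \<omega> (x j)))
                    = complex_of_real (exp (- (1/2) * (\<Sum>j<n. \<Sum>k<n. cc j * cc k * u (x j) (x k))))"
  shows "Xi v \<Lambda> (\<lambda>\<alpha>. e * of_int (q \<alpha>)) s z u \<beta> u0
         \<ge> Xi0 (measure v \<Lambda>) (\<lambda>\<alpha>. e * of_int (q \<alpha>)) s z *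
           (\<integral>\<^sup>+ \<omega>. exp_neg_V2
                (xi0_inv2 \<beta> (\<lambda>\<alpha>. e * of_int (q \<alpha>)) (\<lambda>\<alpha>. exp (e * of_int (q \<alpha>) * c) * z \<alpha>) q
                   (measure v \<Lambda>) s)
                u0 (measure v \<Lambda>)
                (\<integral>\<^sup>+ x\<in>\<Lambda>. ennreal ((\<psi> \<omega> x - \<psi> \<omega> x0)\<^sup>2) \<partial>v)
            \<partial>P)"
proof -
  interpret v: sigma_finite_measure v by fact
  interpret P: prob_space P by fact
  interpret T: prob_space circle_measure by (rule prob_space_circle_measure)
  interpret PT: pair_prob_space P circle_measure ..
  define m where "m = density v (indicator \<Lambda>)"
  have space_m [simp]: "space m = space v" and sets_m [measurable_cong]: "sets m = sets v"
    by (simp_all add: m_def)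
  note [measurable] = \<Lambda>_meas
  have emeasure_m: "emeasure m (space m) = emeasure v \<Lambda>"
  proof -
    have "(\<integral>\<^sup>+x. indicator \<Lambda> x * indicator (space v) x \<partial>v) = (\<integral>\<^sup>+x. indicator \<Lambda> x \<partial>v)"
      by (intro nn_integral_cong) auto
    then show ?thesis by (simp add: m_def emeasure_density)
  qed
  have m: "finite_measure m"
    by standard (use emeasure_m \<Lambda>_fin in auto)
  interpret m: finite_measure m by fact
  define L where "L = measure v \<Lambda>"
  have L: "L = measure m (space m)" using emeasure_m by (simp add: L_def measure_def)
  have L_nn: "0 \<le> L" by (simp add: L_def)
  have pair_m: "sets (P \<Otimes>\<^sub>M m) = sets (P \<Otimes>\<^sub>M v)" "sets (m \<Otimes>\<^sub>M m) = sets (v \<Otimes>\<^sub>M v)"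
    by (intro sets_pair_measure_cong refl sets_m)+
  have um: "(\<lambda>(x, y). u x y) \<in> borel_measurable (m \<Otimes>\<^sub>M m)"
    using u_meas measurable_cong_sets[OF pair_m(2) refl] by blast
  have \<psi>m [measurable]: "(\<lambda>(\<omega>, x). \<psi> \<omega> x) \<in> borel_measurable (P \<Otimes>\<^sub>M m)"
    using \<psi>_meas measurable_cong_sets[OF pair_m(1) refl] by blast
  have x0: "x0 \<in> space m" using x0_in by simp
  have z: "z \<alpha> > 0" if "\<alpha> \<in> {1..s}" for \<alpha> using z_pos that by blast
  have cs: "(\<Sum>\<alpha>=1..s. (e * of_int (q \<alpha>)) ^ (2*n+1) * exp (e * of_int (q \<alpha>) * c) * z \<alpha>) = 0" for n :: nat
    using charge_sym by blast
  have gauss: "(LINT \<omega>|P. cis (\<Sum>j<n. cc j * \<psi> \<omega> (x j)))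
        = complex_of_real (exp (- (1/2) * (\<Sum>j<n. \<Sum>k<n. cc j * cc k * u (x j) (x k))))"
    if "\<And>j. j < n \<Longrightarrow> x j \<in> space m" "(\<Sum>j<n. cc j) = 0" for n :: nat and x :: "nat \<Rightarrow> 'x" and cc :: "nat \<Rightarrow> real"
    using \<psi>_gauss[rule_format, of n x cc] that by simp
  define \<phi> where "\<phi> \<omega> x = \<psi> \<omega> x - \<psi> \<omega> x0" for \<omega> x
  have [measurable]: "(\<lambda>\<omega>. \<psi> \<omega> x0) \<in> borel_measurable P" using x0 by measurable
  have \<phi>m [measurable]: "(\<lambda>(\<omega>, x). \<phi> \<omega> x) \<in> borel_measurable (P \<Otimes>\<^sub>M m)"
    unfolding \<phi>_def by measurable
  have \<phi>x [measurable]: "\<phi> \<omega> \<in> borel_measurable m" if "\<omega> \<in> space P" for \<omega>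
    using that by measurable
  have gw: "gaussian_weight P (space m) \<phi> (\<lambda>_. 1) 1 (\<lambda>x y. u x y - u x x0 - u x0 y + u x0 x0)"
    using gaussian_weight_increments[OF x0 gauss] unfolding \<phi>_def .
  define zp where "zp \<alpha> = exp (e * of_int (q \<alpha>) * c) * z \<alpha>" for \<alpha>
  have zp: "0 \<le> zp \<alpha>" if "\<alpha> \<in> {1..s}" for \<alpha> using z[OF that] by (simp add: zp_def)
  \<comment> \<open>\<open>a \<alpha>\<close> is the frequency at which the field enters the cosine
    of species \<open>\<alpha>\<close>; its square is \<open>\<beta>\<close> times the squared
    charge, the factor in the definition of the correlation length.\<close>
  define a where "a \<alpha> = sqrt \<beta> * e * of_int (q \<alpha>)" for \<alpha>
  have a2: "(a \<alpha>)\<^sup>2 = \<beta> * (e * of_int (q \<alpha>))\<^sup>2" for \<alpha>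
    using \<beta>_pos by (simp add: a_def power_mult_distrib)
  define w where "w = weight L zp q s"
  have wm [measurable]: "w \<in> borel_measurable borel" by (simp add: w_def)
  have w_pos: "0 < w \<theta>" for \<theta> by (simp add: w_def weight_pos)
  define W0 where "W0 \<theta> = L * (\<Sum>\<alpha>=1..s. zp \<alpha> * cos (of_int (q \<alpha>) * \<theta>))" for \<theta>
  have w_exp: "w \<theta> = exp (W0 \<theta>)" for \<theta> by (simp add: w_def weight_def W0_def)
  have W0m [measurable]: "W0 \<in> borel_measurable borel" unfolding W0_def by measurable
  have W0_le: "\<bar>W0 \<theta>\<bar> \<le> L * (\<Sum>\<alpha>=1..s. zp \<alpha>)" for \<theta>
    unfolding W0_def abs_mult using zp L_nn
    by (auto simp: abs_mult mult_left_le intro!: mult_left_mono order_trans[OF sum_abs] sum_mono)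
  define Cw where "Cw = exp (L * (\<Sum>\<alpha>=1..s. zp \<alpha>))"
  have w_le: "w \<theta> \<le> Cw" for \<theta> unfolding w_def Cw_def by (rule weight_le[OF L_nn zp])
  define N where "N \<alpha> = (\<integral>\<theta>. w \<theta> * cos (of_int (q \<alpha>) * \<theta>) \<partial>circle_measure)" for \<alpha>
  define N0 where "N0 = (\<integral>\<theta>. w \<theta> \<partial>circle_measure)"
  have N_nn: "0 \<le> N \<alpha>" for \<alpha> unfolding N_def w_def by (rule integral_weight_cos_sin(1)[OF L_nn zp])
  have w_int: "integrable circle_measure w"
    using w_le less_imp_le[OF w_pos] by (intro T.integrable_const_bound[where B = Cw]) auto
  have wf_int: "integrable circle_measure (\<lambda>\<theta>. w \<theta> * f \<theta>)"
    if "f \<in> borel_measurable borel" "\<And>\<theta>. \<bar>f \<theta>\<bar> \<le> 1" for f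
    using that w_pos
    by (intro Bochner_Integration.integrable_bound[OF w_int]) (auto simp: abs_mult abs_of_pos[OF w_pos] mult_left_le)
  have N0_pos: "0 < N0"
  proof -
    have "exp (- (L * (\<Sum>\<alpha>=1..s. zp \<alpha>))) \<le> w \<theta>" for \<theta>
      unfolding w_exp using W0_le[of \<theta>] by (simp add: abs_le_iff)
    then have "exp (- (L * (\<Sum>\<alpha>=1..s. zp \<alpha>))) \<le> N0"
      unfolding N0_def using w_int by (intro T.integral_ge_const) auto
    then show ?thesis by (rule less_le_trans[OF exp_gt_zero])
  qed
  define \<xi> where "\<xi> = xi0_inv2 \<beta> (\<lambda>\<alpha>. e * of_int (q \<alpha>)) zp q L s"
  define \<mu> where "\<mu> = \<xi> / 2"
  \<comment> \<open>The mean-field identity: \<open>N \<alpha> / N0\<close> is the real part of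
    \<open>eta_hat\<close> at \<open>q \<alpha>\<close>. It will match the quadratic term of
    \<open>V\<^sub>2\<close> with the sum of the quadratic terms of the species.\<close>
  have N0\<mu>: "N0 * \<mu> = (\<Sum>\<alpha>=1..s. zp \<alpha> * N \<alpha> * ((a \<alpha>)\<^sup>2 / 2))"
  proof -
    have eta: "Re (eta_hat L zp q s (q \<alpha>)) = N \<alpha> / N0" for \<alpha>
      unfolding N_def N0_def w_def by (rule integral_weight_cos_sin(3)[OF L_nn zp])
    have "\<xi> = (\<Sum>\<alpha>=1..s. (a \<alpha>)\<^sup>2 * zp \<alpha> * (N \<alpha> / N0))"
      unfolding \<xi>_def xi0_inv2_def a2 by (simp add: eta sum_distrib_left mult_ac)
    then show ?thesis
      using N0_pos by (simp add: \<mu>_def sum_distrib_left sum_divide_distrib mult_ac)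
  qed
  have "0 \<le> N0 * \<mu>"
    unfolding N0\<mu> using zp N_nn by (intro sum_nonneg) auto
  then have \<mu>_nn: "0 \<le> \<mu>" using N0_pos by (simp add: zero_le_mult_iff)
  define J where "J \<omega> = (\<integral>\<^sup>+x. ennreal (\<mu> * (\<phi> \<omega> x)\<^sup>2) \<partial>m)" for \<omega>
  have Jm [measurable]: "J \<in> borel_measurable P" unfolding J_def by measurable
  define D where "D \<omega> = exp_neg (J \<omega>)" for \<omega>
  have Dm [measurable]: "D \<in> borel_measurable P" unfolding D_def by measurable
  have D: "0 \<le> D \<omega>" "D \<omega> \<le> 1" for \<omega> by (simp_all add: D_def exp_neg_bounds)
  have D_int: "integrable P D" using D by (intro P.integrable_const_bound[where B = 1]) auto
  \<comment> \<open>Since \<open>\<mu> \<ge> 0\<close>, the branch of \<open>exp_neg_V2\<close> with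
    negative first argument never occurs. For \<open>\<mu> = 0\<close> both sides are 1, as
    \<open>0 * \<infinity> = 0\<close>; otherwise an infinite integral gives 0 on both
    sides.\<close>
  have V2: "exp_neg_V2 \<xi> u0 L (\<integral>\<^sup>+ x\<in>\<Lambda>. ennreal ((\<psi> \<omega> x - \<psi> \<omega> x0)\<^sup>2) \<partial>v) = ennreal (exp (\<mu> * u0 * L) * D \<omega>)"
    if \<omega>: "\<omega> \<in> space P" for \<omega>
  proof -
    let ?I = "\<integral>\<^sup>+x. ennreal ((\<phi> \<omega> x)\<^sup>2) \<partial>m"
    have [measurable]: "\<phi> \<omega> \<in> borel_measurable v"
      using \<phi>x[OF \<omega>] measurable_cong_sets[OF sets_m refl] by blast
    have I: "(\<integral>\<^sup>+ x\<in>\<Lambda>. ennreal ((\<psi> \<omega> x - \<psi> \<omega> x0)\<^sup>2) \<partial>v) = ?I"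
      unfolding m_def \<phi>_def[symmetric] by (subst nn_integral_density) (auto simp: mult.commute)
    have J: "J \<omega> = ennreal \<mu> * ?I"
      unfolding J_def using \<mu>_nn \<phi>x[OF \<omega>] by (simp add: ennreal_mult nn_integral_cmult)
    show ?thesis
    proof (cases "\<mu> = 0")
      case True
      then show ?thesis by (simp add: exp_neg_V2_def J D_def exp_neg_def \<mu>_def)
    next
      case False
      then have "0 < \<xi>" "\<mu> > 0" using \<mu>_nn by (simp_all add: \<mu>_def)
      then show ?thesis
        unfolding exp_neg_V2_def I D_def exp_neg_def J
        by (auto simp: ennreal_mult_eq_top_iff enn2real_mult \<mu>_def mult_exp_exp algebra_simps ennreal_top_mult ennreal_mult_top)
    qed
  qed
  define \<zeta> where "\<zeta> \<alpha> = exp (\<beta> * (e * of_int (q \<alpha>))\<^sup>2 * u0 / 2) * zp \<alpha>" for \<alpha>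
  have \<zeta>_eq: "\<zeta> \<alpha> = exp ((a \<alpha>)\<^sup>2 * u0 / 2) * zp \<alpha>" for \<alpha> by (simp add: \<zeta>_def a2)
  have \<zeta>: "0 \<le> \<zeta> \<alpha>" if "\<alpha> \<in> {1..s}" for \<alpha> using zp[OF that] by (simp add: \<zeta>_def)
  define \<Phi> where "\<Phi> \<omega> \<theta> x = sqrt \<beta> * e * \<phi> \<omega> x + \<theta>" for \<omega> \<theta> x
  define W where "W \<omega> \<theta> = sine_gordon_energy m \<zeta> q s (\<Phi> \<omega> \<theta>)" for \<omega> \<theta>
  have Xi_eq: "Xi v \<Lambda> (\<lambda>\<alpha>. e * of_int (q \<alpha>)) s z u \<beta> u0
      = ennreal (\<integral>(\<omega>, \<theta>). exp (W \<omega> \<theta>) \<partial>(P \<Otimes>\<^sub>M circle_measure))"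
    unfolding Xi_density[OF v_sf \<Lambda>_meas u_meas] m_def[symmetric] W_def \<Phi>_def \<phi>_def \<zeta>_def zp_def
    by (rule Xi_eq_sine_gordon[OF m P_prob um \<beta>_pos e_pos z cs x0 \<psi>m gauss])
  have Xi0_eq: "Xi0 L (\<lambda>\<alpha>. e * of_int (q \<alpha>)) s z = ennreal N0"
    unfolding N0_def w_def zp_def L by (rule Xi0_eq_integral_weight[OF m e_pos z cs x0])
  \<comment> \<open>The addition formula separates \<open>\<theta>\<close> from the field:
    \<open>Cc\<close> multiplies cosines of \<open>\<theta>\<close>, \<open>Ss\<close> multiplies
    sines.\<close>
  define Cc where "Cc \<alpha> \<omega> = (\<integral>x. cos (a \<alpha> * \<phi> \<omega> x) \<partial>m)" for \<alpha> \<omega>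
  define Ss where "Ss \<alpha> \<omega> = (\<integral>x. sin (a \<alpha> * \<phi> \<omega> x) \<partial>m)" for \<alpha> \<omega>
  have W_eq: "W \<omega> \<theta> = (\<Sum>\<alpha>=1..s. \<zeta> \<alpha> * (Cc \<alpha> \<omega> * cos (of_int (q \<alpha>) * \<theta>) - Ss \<alpha> \<omega> * sin (of_int (q \<alpha>) * \<theta>)))"
    if \<omega>: "\<omega> \<in> space P" for \<omega> \<theta>
    unfolding W_def sine_gordon_energy_def
  proof (intro sum.cong refl arg_cong2[where f = times])
    fix \<alpha>
    note [measurable] = \<phi>x[OF \<omega>]
    have "integrable m (\<lambda>x. cos (a \<alpha> * \<phi> \<omega> x))" "integrable m (\<lambda>x. sin (a \<alpha> * \<phi> \<omega> x))"
      by (auto intro!: m.integrable_const_bound[where B = 1])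
    then show "(\<integral>x. cos (of_int (q \<alpha>) * \<Phi> \<omega> \<theta> x) \<partial>m) = Cc \<alpha> \<omega> * cos (of_int (q \<alpha>) * \<theta>) - Ss \<alpha> \<omega> * sin (of_int (q \<alpha>) * \<theta>)"
      by (simp add: Cc_def Ss_def \<Phi>_def distrib_left cos_add a_def mult_ac)
  qed
  have Wm [measurable]: "(\<lambda>(\<omega>, \<theta>). W \<omega> \<theta>) \<in> borel_measurable (P \<Otimes>\<^sub>M circle_measure)"
    unfolding W_def sine_gordon_energy_def \<Phi>_def by measurable
  have W_le: "\<bar>W \<omega> \<theta>\<bar> \<le> L * (\<Sum>\<alpha>=1..s. \<zeta> \<alpha>)" for \<omega> \<theta>
    unfolding W_def L by (rule abs_sine_gordon_energy_le[OF m \<zeta>])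
  define j where "j \<omega> = enn2real (J \<omega>)" for \<omega>
  have jm [measurable]: "j \<in> borel_measurable P" unfolding j_def by measurable
  have j_nn: "0 \<le> j \<omega>" for \<omega> by (simp add: j_def)
  have Dj: "D \<omega> * j \<omega> \<le> 1" for \<omega> by (simp add: D_def j_def exp_neg_mult_le)
  \<comment> \<open>The first-order term: where \<open>J\<close> is finite,
    \<open>j \<omega> - \<mu> * u0 * L\<close> is \<open>V\<^sub>2\<close>, and its constant part is
    kept out of \<open>D\<close>, as the prefactor \<open>exp (\<mu> * u0 * L)\<close>. Where
    \<open>J\<close> is infinite, \<open>D\<close> and \<open>G\<close> vanish and the pointwise
    bound only says that \<open>exp\<close> is nonnegative.\<close>
  define G where "G \<omega> \<theta> = w \<theta> * (D \<omega> * (W \<omega> \<theta> - W0 \<theta> + j \<omega> - \<mu> * u0 * L))" for \<omega> \<theta>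
  have pointwise: "exp (\<mu> * u0 * L) * (w \<theta> * D \<omega> + G \<omega> \<theta>) \<le> exp (W \<omega> \<theta>)" for \<omega> \<theta>
  proof (cases "J \<omega> = \<infinity>")
    case True
    then show ?thesis by (simp add: G_def D_def exp_neg_def)
  next
    case False
    let ?y = "W \<omega> \<theta> - W0 \<theta> + j \<omega> - \<mu> * u0 * L"
    have "exp (\<mu> * u0 * L) * (w \<theta> * D \<omega> + G \<omega> \<theta>) = exp (\<mu> * u0 * L + W0 \<theta> - j \<omega>) * (1 + ?y)"
      using False by (simp add: G_def D_def exp_neg_def w_exp j_def exp_add exp_diff exp_minus field_simps)
    also have "\<dots> \<le> exp (\<mu> * u0 * L + W0 \<theta> - j \<omega>) * exp ?y"
      by (intro mult_left_mono exp_ge_add_one_self) simp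
    also have "\<dots> = exp (W \<omega> \<theta>)" by (simp flip: exp_add)
    finally show ?thesis .
  qed
  \<comment> \<open>All terms are bounded except \<open>j\<close>, and \<open>j\<close> occurs only
    in the product \<open>D \<omega> * j \<omega>\<close>, which is at most 1.\<close>
  have G_int: "integrable (P \<Otimes>\<^sub>M circle_measure) (\<lambda>(\<omega>, \<theta>). G \<omega> \<theta>)"
  proof (rule PT.integrable_const_bound)
    let ?B = "L * (\<Sum>\<alpha>=1..s. \<zeta> \<alpha>) + L * (\<Sum>\<alpha>=1..s. zp \<alpha>) + \<bar>\<mu> * u0 * L\<bar>"
    show "AE p in P \<Otimes>\<^sub>M circle_measure. norm (case p of (\<omega>, \<theta>) \<Rightarrow> G \<omega> \<theta>) \<le> Cw * (?B + 1)"
    proof (intro AE_I2, clarify)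
      fix \<omega> \<theta>
      have "\<bar>D \<omega> * (W \<omega> \<theta> - W0 \<theta> - \<mu> * u0 * L)\<bar> \<le> \<bar>W \<omega> \<theta> - W0 \<theta> - \<mu> * u0 * L\<bar>"
        using D by (simp add: abs_mult mult_left_le_one_le)
      also have "\<dots> \<le> ?B" using W_le[of \<omega> \<theta>] W0_le[of \<theta>] by linarith
      finally have "\<bar>D \<omega> * (W \<omega> \<theta> - W0 \<theta> - \<mu> * u0 * L) + D \<omega> * j \<omega>\<bar> \<le> ?B + 1"
        using Dj[of \<omega>] mult_nonneg_nonneg[OF D(1)[of \<omega>] j_nn[of \<omega>]] by linarith
      then have "\<bar>D \<omega> * (W \<omega> \<theta> - W0 \<theta> + j \<omega> - \<mu> * u0 * L)\<bar> \<le> ?B + 1"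
        by (simp add: algebra_simps)
      then have "w \<theta> * \<bar>D \<omega> * (W \<omega> \<theta> - W0 \<theta> + j \<omega> - \<mu> * u0 * L)\<bar> \<le> Cw * (?B + 1)"
        using w_le[of \<theta>] by (intro mult_mono) (auto simp: Cw_def)
      then show "norm (G \<omega> \<theta>) \<le> Cw * (?B + 1)"
        by (simp add: G_def abs_mult abs_of_pos[OF w_pos])
    qed
    show "(\<lambda>(\<omega>, \<theta>). G \<omega> \<theta>) \<in> borel_measurable (P \<Otimes>\<^sub>M circle_measure)" unfolding G_def by measurable
  qed
  define g where "g \<alpha> \<omega> = D \<omega> * (exp ((a \<alpha>)\<^sup>2 * u0 / 2) * Cc \<alpha> \<omega> - (1 + (a \<alpha>)\<^sup>2 * u0 / 2) * L)" for \<alpha> \<omega>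
  \<comment> \<open>The sine terms integrate to 0. The constant \<open>N0 * \<mu> * u0 * L\<close>
    is distributed over the species by the mean-field identity and becomes the term
    \<open>(a \<alpha>)\<^sup>2 * u0 / 2 * L\<close> of \<open>g\<close>; the term with
    \<open>j\<close> is left whole for now.\<close>
  have G_theta: "(\<integral>\<theta>. G \<omega> \<theta> \<partial>circle_measure) = (\<Sum>\<alpha>=1..s. zp \<alpha> * N \<alpha> * g \<alpha> \<omega>) + N0 * (D \<omega> * j \<omega>)"
    if \<omega>: "\<omega> \<in> space P" for \<omega>
  proof -
    have cos_int: "integrable circle_measure (\<lambda>\<theta>. w \<theta> * cos (of_int (q \<alpha>) * \<theta>))"
      and sin_int: "integrable circle_measure (\<lambda>\<theta>. w \<theta> * sin (of_int (q \<alpha>) * \<theta>))" for \<alpha>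
      by (intro wf_int; simp)+
    have sin0: "(\<integral>\<theta>. w \<theta> * sin (of_int (q \<alpha>) * \<theta>) \<partial>circle_measure) = 0" for \<alpha>
      unfolding w_def by (rule integral_weight_cos_sin(2)[OF L_nn zp])
    have "(\<integral>\<theta>. G \<omega> \<theta> \<partial>circle_measure) = (\<integral>\<theta>. (\<Sum>\<alpha>=1..s. D \<omega> * (\<zeta> \<alpha> * Cc \<alpha> \<omega> - L * zp \<alpha>) * (w \<theta> * cos (of_int (q \<alpha>) * \<theta>))
        - D \<omega> * \<zeta> \<alpha> * Ss \<alpha> \<omega> * (w \<theta> * sin (of_int (q \<alpha>) * \<theta>))) + D \<omega> * (j \<omega> - \<mu> * u0 * L) * w \<theta> \<partial>circle_measure)"
      unfolding G_def W_eq[OF \<omega>] W0_def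
      by (intro Bochner_Integration.integral_cong refl)
        (simp add: sum_distrib_left sum_subtractf sum.distrib algebra_simps)
    also have "\<dots> = (\<Sum>\<alpha>=1..s. D \<omega> * (\<zeta> \<alpha> * Cc \<alpha> \<omega> - L * zp \<alpha>) * N \<alpha>) + D \<omega> * (j \<omega> - \<mu> * u0 * L) * N0"
      using cos_int sin_int w_int
      by (simp add: Bochner_Integration.integral_add Bochner_Integration.integral_sum
          Bochner_Integration.integral_diff sin0 N_def N0_def)
    also have "D \<omega> * (j \<omega> - \<mu> * u0 * L) * N0 = N0 * (D \<omega> * j \<omega>) - D \<omega> * u0 * L * (N0 * \<mu>)"
      by (simp add: algebra_simps)
    finally show ?thesis
      unfolding N0\<mu> g_def \<zeta>_eq by (simp add: sum_distrib_left sum_subtractf sum.distrib algebra_simps)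
  qed
  have nonneg: "0 \<le> (\<integral>\<omega>. (\<Sum>\<alpha>=1..s. zp \<alpha> * N \<alpha> * g \<alpha> \<omega>) + N0 * (D \<omega> * j \<omega>) \<partial>P)"
  proof (cases "\<mu> = 0")
    case True
    \<comment> \<open>If \<open>\<mu> = 0\<close>, a vanishing sum of nonnegative terms forces each
      species to have zero coefficient or zero charge; for zero charge \<open>Cc\<close> equals
      \<open>L\<close> and \<open>g\<close> vanishes.\<close>
    have "zp \<alpha> * N \<alpha> * g \<alpha> \<omega> = 0" if \<alpha>: "\<alpha> \<in> {1..s}" for \<alpha> \<omega>
    proof -
      have "zp \<alpha> * N \<alpha> * ((a \<alpha>)\<^sup>2 / 2) = 0"
        using N0\<mu> True zp N_nn sum_nonneg_eq_0_iff[of "{1..s}" "\<lambda>\<alpha>. zp \<alpha> * N \<alpha> * ((a \<alpha>)\<^sup>2 / 2)"] \<alpha> by simp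
      then have "zp \<alpha> * N \<alpha> = 0 \<or> a \<alpha> = 0" by auto
      then show ?thesis by (auto simp: g_def Cc_def L)
    qed
    then have "(\<Sum>\<alpha>=1..s. zp \<alpha> * N \<alpha> * g \<alpha> \<omega>) = 0" for \<omega> by (rule sum.neutral[OF ballI])
    then show ?thesis using N0_pos D j_nn by (simp add: less_imp_le)
  next
    case False
    then have \<mu>: "0 < \<mu>" using \<mu>_nn by simp
    have Cc_m: "Cc \<alpha> \<in> borel_measurable P" for \<alpha> unfolding Cc_def by measurable
    have Cc_le: "\<bar>Cc \<alpha> \<omega>\<bar> \<le> L" for \<alpha> \<omega>
      \<comment> \<open>A single cosine integral is the energy of one species with
        \<open>\<zeta> = 1\<close> and \<open>q = 1\<close>.\<close>
      using abs_sine_gordon_energy_le[OF m, of 1 "\<lambda>_. 1" "\<lambda>_. 1" "\<lambda>x. a \<alpha> * \<phi> \<omega> x"]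
      by (simp add: Cc_def sine_gordon_energy_def L)
    have g_int: "integrable P (g \<alpha>)" for \<alpha>
    proof (rule P.integrable_const_bound)
      show "AE \<omega> in P. norm (g \<alpha> \<omega>) \<le> exp ((a \<alpha>)\<^sup>2 * u0 / 2) * L + \<bar>(1 + (a \<alpha>)\<^sup>2 * u0 / 2) * L\<bar>"
      proof (rule AE_I2)
        fix \<omega>
        have "norm (g \<alpha> \<omega>) \<le> \<bar>exp ((a \<alpha>)\<^sup>2 * u0 / 2) * Cc \<alpha> \<omega> - (1 + (a \<alpha>)\<^sup>2 * u0 / 2) * L\<bar>"
          using D by (simp add: g_def abs_mult mult_left_le_one_le)
        also have "\<dots> \<le> \<bar>exp ((a \<alpha>)\<^sup>2 * u0 / 2) * Cc \<alpha> \<omega>\<bar> + \<bar>(1 + (a \<alpha>)\<^sup>2 * u0 / 2) * L\<bar>"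
          by (rule abs_triangle_ineq4)
        also have "\<bar>exp ((a \<alpha>)\<^sup>2 * u0 / 2) * Cc \<alpha> \<omega>\<bar> \<le> exp ((a \<alpha>)\<^sup>2 * u0 / 2) * L"
          using Cc_le by (simp add: abs_mult)
        finally show "norm (g \<alpha> \<omega>) \<le> exp ((a \<alpha>)\<^sup>2 * u0 / 2) * L + \<bar>(1 + (a \<alpha>)\<^sup>2 * u0 / 2) * L\<bar>" by simp
      qed
      show "g \<alpha> \<in> borel_measurable P" unfolding g_def using Cc_m by measurable
    qed
    have Dj_int: "integrable P (\<lambda>\<omega>. D \<omega> * j \<omega>)"
      using Dj D j_nn by (intro P.integrable_const_bound[where B = 1]) auto
    have split: "(\<integral>\<omega>. g \<alpha> \<omega> + (a \<alpha>)\<^sup>2 / 2 / \<mu> * (D \<omega> * j \<omega>) \<partial>P)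
        = (\<integral>\<omega>. g \<alpha> \<omega> \<partial>P) + (a \<alpha>)\<^sup>2 / 2 / \<mu> * (\<integral>\<omega>. D \<omega> * j \<omega> \<partial>P)" for \<alpha>
      using g_int[of \<alpha>] Dj_int
      by (simp only: Bochner_Integration.integral_add integrable_mult_right integral_mult_right_zero)
    \<comment> \<open>Each species receives its own share
      \<open>(a \<alpha>)\<^sup>2 / 2 / \<mu>\<close> of \<open>D \<omega> * j \<omega>\<close>.
      With the coefficients \<open>zp \<alpha> * N \<alpha>\<close> the shares add up to
      \<open>N0\<close>, again by the mean-field identity.\<close>
    have "0 \<le> (\<Sum>\<alpha>=1..s. zp \<alpha> * N \<alpha> * (\<integral>\<omega>. g \<alpha> \<omega> + (a \<alpha>)\<^sup>2 / 2 / \<mu> * (D \<omega> * j \<omega>) \<partial>P))"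
    proof (intro sum_nonneg mult_nonneg_nonneg zp N_nn)
      fix \<alpha>
      show "0 \<le> (\<integral>\<omega>. g \<alpha> \<omega> + (a \<alpha>)\<^sup>2 / 2 / \<mu> * (D \<omega> * j \<omega>) \<partial>P)"
        using P.gaussian_exp_neg_energy_ge[OF gw m \<mu> \<phi>m, of "a \<alpha>" u0]
        unfolding J_def[symmetric] D_def[symmetric] j_def[symmetric] Cc_def[symmetric] L[symmetric] g_def
        by (simp add: distrib_left mult_ac)
    qed
    also have "\<dots> = (\<Sum>\<alpha>=1..s. zp \<alpha> * N \<alpha> * (\<integral>\<omega>. g \<alpha> \<omega> \<partial>P)) + (\<integral>\<omega>. D \<omega> * j \<omega> \<partial>P) / \<mu> * (\<Sum>\<alpha>=1..s. zp \<alpha> * N \<alpha> * ((a \<alpha>)\<^sup>2 / 2))"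
      unfolding split by (simp add: sum_distrib_left sum.distrib distrib_left mult_ac)
    also have "\<dots> = (\<Sum>\<alpha>=1..s. zp \<alpha> * N \<alpha> * (\<integral>\<omega>. g \<alpha> \<omega> \<partial>P)) + N0 * (\<integral>\<omega>. D \<omega> * j \<omega> \<partial>P)"
      unfolding N0\<mu>[symmetric] using \<mu> by simp
    also have "\<dots> = (\<integral>\<omega>. (\<Sum>\<alpha>=1..s. zp \<alpha> * N \<alpha> * g \<alpha> \<omega>) + N0 * (D \<omega> * j \<omega>) \<partial>P)"
      using g_int Dj_int by simp
    finally show ?thesis .
  qed
  have G_nonneg: "0 \<le> (\<integral>(\<omega>, \<theta>). G \<omega> \<theta> \<partial>(P \<Otimes>\<^sub>M circle_measure))"
  proof -
    have "(\<integral>(\<omega>, \<theta>). G \<omega> \<theta> \<partial>(P \<Otimes>\<^sub>M circle_measure)) = (\<integral>\<omega>. (\<integral>\<theta>. G \<omega> \<theta> \<partial>circle_measure) \<partial>P)"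
      by (rule PT.integral_fst[OF G_int, symmetric])
    also have "\<dots> = (\<integral>\<omega>. (\<Sum>\<alpha>=1..s. zp \<alpha> * N \<alpha> * g \<alpha> \<omega>) + N0 * (D \<omega> * j \<omega>) \<partial>P)"
      by (intro Bochner_Integration.integral_cong refl G_theta)
    finally show ?thesis using nonneg by simp
  qed
  have wD_int: "integrable (P \<Otimes>\<^sub>M circle_measure) (\<lambda>(\<omega>, \<theta>). w \<theta> * D \<omega>)"
  proof (rule PT.integrable_const_bound)
    show "AE p in P \<Otimes>\<^sub>M circle_measure. norm (case p of (\<omega>, \<theta>) \<Rightarrow> w \<theta> * D \<omega>) \<le> Cw * 1"
    proof (intro AE_I2, clarify)
      fix \<omega> \<theta>
      have "w \<theta> * D \<omega> \<le> Cw * 1"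
        using w_le[of \<theta>] D[of \<omega>] w_pos[of \<theta>] by (intro mult_mono) auto
      then show "norm (w \<theta> * D \<omega>) \<le> Cw * 1" using w_pos[of \<theta>] D[of \<omega>] by simp
    qed
  qed measurable
  have wD: "(\<integral>(\<omega>, \<theta>). w \<theta> * D \<omega> \<partial>(P \<Otimes>\<^sub>M circle_measure)) = N0 * (\<integral>\<omega>. D \<omega> \<partial>P)"
    unfolding PT.integral_fst[OF wD_int, symmetric] N0_def by simp
  have W_int: "integrable (P \<Otimes>\<^sub>M circle_measure) (\<lambda>(\<omega>, \<theta>). exp (W \<omega> \<theta>))"
  proof (rule PT.integrable_const_bound)
    show "AE p in P \<Otimes>\<^sub>M circle_measure. norm (case p of (\<omega>, \<theta>) \<Rightarrow> exp (W \<omega> \<theta>)) \<le> exp (L * (\<Sum>\<alpha>=1..s. \<zeta> \<alpha>))"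
      using abs_le_D1[OF W_le] by (intro AE_I2) auto
  qed measurable
  \<comment> \<open>The weight \<open>w \<theta> * D \<omega>\<close> factorises over field and
    angle; adding the nonnegative mean of \<open>G\<close> makes the pointwise bound
    applicable.\<close>
  have "N0 * (exp (\<mu> * u0 * L) * (\<integral>\<omega>. D \<omega> \<partial>P))
      \<le> exp (\<mu> * u0 * L) * ((\<integral>(\<omega>, \<theta>). w \<theta> * D \<omega> \<partial>(P \<Otimes>\<^sub>M circle_measure)) + (\<integral>(\<omega>, \<theta>). G \<omega> \<theta> \<partial>(P \<Otimes>\<^sub>M circle_measure)))"
    unfolding wD using G_nonneg by (simp add: distrib_left)
  also have "\<dots> = (\<integral>p. exp (\<mu> * u0 * L) * ((case p of (\<omega>, \<theta>) \<Rightarrow> w \<theta> * D \<omega>) + (case p of (\<omega>, \<theta>) \<Rightarrow> G \<omega> \<theta>)) \<partial>(P \<Otimes>\<^sub>M circle_measure))"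
    using wD_int G_int by simp
  also have "\<dots> \<le> (\<integral>(\<omega>, \<theta>). exp (W \<omega> \<theta>) \<partial>(P \<Otimes>\<^sub>M circle_measure))"
  proof (rule integral_mono)
    show "integrable (P \<Otimes>\<^sub>M circle_measure) (\<lambda>p. exp (\<mu> * u0 * L) * ((case p of (\<omega>, \<theta>) \<Rightarrow> w \<theta> * D \<omega>) + (case p of (\<omega>, \<theta>) \<Rightarrow> G \<omega> \<theta>)))"
      using wD_int G_int by (intro integrable_mult_right Bochner_Integration.integrable_add)
  qed (use W_int pointwise in auto)
  finally have main: "N0 * (exp (\<mu> * u0 * L) * (\<integral>\<omega>. D \<omega> \<partial>P)) \<le> (\<integral>(\<omega>, \<theta>). exp (W \<omega> \<theta>) \<partial>(P \<Otimes>\<^sub>M circle_measure))" .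
  have "(\<integral>\<^sup>+ \<omega>. exp_neg_V2 \<xi> u0 L (\<integral>\<^sup>+ x\<in>\<Lambda>. ennreal ((\<psi> \<omega> x - \<psi> \<omega> x0)\<^sup>2) \<partial>v) \<partial>P)
      = (\<integral>\<^sup>+ \<omega>. ennreal (exp (\<mu> * u0 * L) * D \<omega>) \<partial>P)"
    by (intro nn_integral_cong V2)
  also have "\<dots> = ennreal (\<integral>\<omega>. exp (\<mu> * u0 * L) * D \<omega> \<partial>P)"
    using D_int D by (intro nn_integral_eq_integral) auto
  finally have "Xi0 L (\<lambda>\<alpha>. e * of_int (q \<alpha>)) s z *
      (\<integral>\<^sup>+ \<omega>. exp_neg_V2 \<xi> u0 L (\<integral>\<^sup>+ x\<in>\<Lambda>. ennreal ((\<psi> \<omega> x - \<psi> \<omega> x0)\<^sup>2) \<partial>v) \<partial>P)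
      = ennreal (N0 * (exp (\<mu> * u0 * L) * (\<integral>\<omega>. D \<omega> \<partial>P)))"
    using N0_pos D by (simp add: Xi0_eq ennreal_mult)
  also have "\<dots> \<le> Xi v \<Lambda> (\<lambda>\<alpha>. e * of_int (q \<alpha>)) s z u \<beta> u0"
    unfolding Xi_eq by (rule ennreal_leI[OF main])
  finally show ?thesis unfolding \<xi>_def zp_def L_def .
qed

end
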